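(* Let $d\ge3$. The downward-deviation estimates for the maximum local time, taken at the critical level $\beta=1$, yield the following Gumbel-type fluctuations around the logarithmic centering. (i) Continuous time: as $t\to\infty$, $\ell^*(t)-\gamma^{-1}\log t$ converges in distribution to a Gumbel law with mode $\gamma^{-1}\log\gamma$ and scale parameter $\gamma^{-1}$, i.e. to the law with distribution function $u\mapsto\exp\{-\gamma e^{-\gamma u}\}$, $u\in\mathbb{R}$. (ii) Discrete time: the paper itself gives the downward upper bound, namely, for every fixed $u\in\mathbb{R}$, as $n\to\infty$, $$\mathbb{P}\bigl(\xi^*(n)\le\alpha\log n+u\bigr)\le\exp\bigl\{-(1+o(1))\,c_{1,n,u}\,\gamma(1-\gamma)^u\bigr\}.$$ Combining this with the matching lower bound, which is proved in a separate companion paper on loop-pruned random walk (by a loop-pruning construction), yields the corresponding lattice (discretized) Gumbel-type asymptotics, with the arithmetic oscillation encoded by $c_{1,n,u}$: for every fixed $u\in\mathbb{R}$, as $n\to\infty$, $$\mathbb{P}\bigl(\xi^*(n)\le\alpha\log n+u\bigr)=\exp\bigl\{-(1+o(1))\,c_{1,n,u}\,\gamma(1-\gamma)^u\bigr\}.$$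
   Context: $(S_n)_{n\ge0}$ is the discrete-time simple (nearest-neighbour, symmetric) random walk on $\mathbb{Z}^d$, $d\ge3$, started at $S_0=0$. $(Y_t)_{t\ge0}$ is the continuous-time walk obtained by attaching i.i.d. $\mathrm{Exp}(1)$ holding times (independent of the walk) to $(S_n)$. $\mathbb{P}$ denotes the law governing both walks. The local times are $\xi(n,x)=\sum_{k=0}^n\mathbf 1_{\{S_k=x\}}$ and $\ell(t,x)=\int_0^t\mathbf 1_{\{Y_s=x\}}\,ds$ for $x\in\mathbb{Z}^d$, and their maxima are $\xi^*(n)=\max_{x\in\mathbb{Z}^d}\xi(n,x)$ and $\ell^*(t)=\max_{x\in\mathbb{Z}^d}\ell(t,x)$. The constants are $\gamma=\gamma_d=\mathbb{P}(S_n\ne0\text{ for all }n\ge1)$ and $\alpha=\alpha_d=-1/\log(1-\gamma)$. The oscillating factor is $c_{1,n,u}=n(1-\gamma)^{-u}(1-\gamma)^{\lfloor\alpha\log n+u\rfloor}\in[1,(1-\gamma)^{-1})$, where $\lfloor\cdot\rfloor$ is the integer part. *)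

theory Defs
  imports "HOL-Probability.Probability" "HOL-Library.Landau_Symbols"
begin

text \<open>
  The lattice is \<open>int ^ 'd\<close>, of dimension \<open>CARD('d)\<close>.
\<close>

definition unit_steps :: "(int ^ 'd::finite) set" where
  "unit_steps = range (\<lambda>i. axis i 1) \<union> range (\<lambda>i. axis i (-1))"

locale simple_random_walk = prob_space M
  for M :: "'a measure" +
  fixes S :: "nat \<Rightarrow> 'a \<Rightarrow> int ^ 'd::finite"
  assumes start: "\<And>\<omega>. \<omega> \<in> space M \<Longrightarrow> S 0 \<omega> = 0"
    and indep_steps:
      "indep_vars (\<lambda>_. count_space UNIV) (\<lambda>n \<omega>. S (Suc n) \<omega> - S n \<omega>) UNIV"
    and distr_steps:
      "\<And>n. distr M (count_space UNIV) (\<lambda>\<omega>. S (Suc n) \<omega> - S n \<omega>)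
             = measure_pmf (pmf_of_set unit_steps)"

locale walk_with_holding_times = simple_random_walk M S
  for M :: "'a measure" and S :: "nat \<Rightarrow> 'a \<Rightarrow> int ^ 'd::finite" +
  fixes \<tau> :: "nat \<Rightarrow> 'a \<Rightarrow> real"
  assumes indep_holding: "indep_vars (\<lambda>_. borel) \<tau> UNIV"
    and distr_holding: "\<And>n. distributed M lborel (\<tau> n) (exponential_density 1)"
    and indep_walk_holding:
      "indep_set (sets (vimage_algebra (space M) (\<lambda>\<omega> n. S n \<omega>) (Pi\<^sub>M UNIV (\<lambda>_. count_space UNIV))))
                 (sets (vimage_algebra (space M) (\<lambda>\<omega> n. \<tau> n \<omega>) (Pi\<^sub>M UNIV (\<lambda>_. borel))))"

text \<open>
  The walk sits at \<open>S n\<close> during the time interval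
  \<open>[\<tau> 0 + \<dots> + \<tau> (n - 1), \<tau> 0 + \<dots> + \<tau> n)\<close>. Almost surely the holding times are positive
  and have infinite sum, so that the least index below exists and is the number of jumps
  up to time \<open>t\<close>.
\<close>

definition jump_count :: "(nat \<Rightarrow> 'a \<Rightarrow> real) \<Rightarrow> real \<Rightarrow> 'a \<Rightarrow> nat" where
  "jump_count \<tau> t \<omega> = (LEAST n. t < (\<Sum>k\<le>n. \<tau> k \<omega>))"

definition continuous_walk ::
    "(nat \<Rightarrow> 'a \<Rightarrow> 'b) \<Rightarrow> (nat \<Rightarrow> 'a \<Rightarrow> real) \<Rightarrow> real \<Rightarrow> 'a \<Rightarrow> 'b" where
  "continuous_walk S \<tau> t \<omega> = S (jump_count \<tau> t \<omega>) \<omega>"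

definition discrete_local_time :: "(nat \<Rightarrow> 'a \<Rightarrow> 'b) \<Rightarrow> nat \<Rightarrow> 'b \<Rightarrow> 'a \<Rightarrow> nat" where
  "discrete_local_time S n x \<omega> = (\<Sum>k\<le>n. indicator {x} (S k \<omega>))"

definition continuous_local_time :: "(real \<Rightarrow> 'a \<Rightarrow> 'b) \<Rightarrow> real \<Rightarrow> 'b \<Rightarrow> 'a \<Rightarrow> real" where
  "continuous_local_time Y t x \<omega> = (LBINT s:{0..t}. indicator {x} (Y s \<omega>))"

text \<open>
  The discrete local times at time \<open>n\<close> take values in \<open>{0..n + 1}\<close>, so their range is finite.
  The continuous ones lie in \<open>{0..t}\<close>; their supremum is almost surely attained, since
  almost surely only finitely many sites are visited up to time \<open>t\<close>.
\<close>

definition max_discrete_local_time :: "(nat \<Rightarrow> 'a \<Rightarrow> 'b) \<Rightarrow> nat \<Rightarrow> 'a \<Rightarrow> nat" where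
  "max_discrete_local_time S n \<omega> = Max (range (\<lambda>x. discrete_local_time S n x \<omega>))"

definition max_continuous_local_time :: "(real \<Rightarrow> 'a \<Rightarrow> 'b) \<Rightarrow> real \<Rightarrow> 'a \<Rightarrow> real" where
  "max_continuous_local_time Y t \<omega> = (SUP x. continuous_local_time Y t x \<omega>)"

definition escape_prob :: "'a measure \<Rightarrow> (nat \<Rightarrow> 'a \<Rightarrow> 'b::zero) \<Rightarrow> real" where
  "escape_prob M S = measure M {\<omega> \<in> space M. \<forall>n\<ge>1. S n \<omega> \<noteq> 0}"

definition log_rate :: "real \<Rightarrow> real" where
  "log_rate \<gamma> = - 1 / ln (1 - \<gamma>)"

definition osc_factor :: "real \<Rightarrow> nat \<Rightarrow> real \<Rightarrow> real" where
  "osc_factor \<gamma> n u =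
     real n * (1 - \<gamma>) powr (- u) * (1 - \<gamma>) powi \<lfloor>log_rate \<gamma> * ln (real n) + u\<rfloor>"

text \<open>The Gumbel law with mode \<open>m\<close> and scale \<open>b > 0\<close>, given by its distribution function.\<close>

definition gumbel :: "real \<Rightarrow> real \<Rightarrow> real measure" where
  "gumbel m b = interval_measure (\<lambda>x. exp (- exp (- (x - m) / b)))"

text \<open>
  Convergence in distribution along an arbitrary filter; the library's \<open>weak_conv_m\<close> covers
  sequences only.
\<close>

definition weak_conv_along :: "('i \<Rightarrow> real measure) \<Rightarrow> real measure \<Rightarrow> 'i filter \<Rightarrow> bool" where
  "weak_conv_along Ms N F \<longleftrightarrow>
     (\<forall>x. isCont (cdf N) x \<longrightarrow> ((\<lambda>i. cdf (Ms i) x) \<longlongrightarrow> cdf N x) F)"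

lemma weak_conv_along_sequentially:
  "weak_conv_along Ms N sequentially \<longleftrightarrow> weak_conv_m Ms N"
  by (simp add: weak_conv_along_def weak_conv_m_def weak_conv_def)

end

theory Submission
  imports Defs "HOL-Real_Asymp.Real_Asymp"
begin

text \<open>
  Cut the time into blocks of length \<open>b = n\<^sup>\<epsilon>\<close>, and let \<open>q\<close> be the probability that the total local
  time at the origin exceeds the level, so that \<open>n q\<close> stays bounded. Counting each site at its
  first visit, which by time reversal occurs at a given time with probability close to \<open>\<gamma>\<close>, the
  number of sites that exceed the level within a block has mean \<open>b \<gamma> q (1 + o(1))\<close>. Two sites both
  exceed it with probability at most \<open>q\<^bsup>1+c\<^esup>\<close>, because the Green function satisfies
  \<open>G x \<le> G 0 - 1\<close> for \<open>x \<noteq> 0\<close>. A site whose visits are spread over several blocks needs a long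
  excursion, whose cost is polynomial since \<open>P(S\<^sub>t = 0) = O(t\<^bsup>-3/2\<^esup>)\<close>, whereas only
  \<open>O(log n)\<close> excursions are available. Hence the blocks behave independently and the level is never
  exceeded with probability \<open>(1 - b \<gamma> q)\<^bsup>n/b\<^esup> \<approx> exp (- \<gamma> n q)\<close>.

  Given the walk, the local times of the continuous-time walk at its jump times are independent
  Gamma variables. Both cases thus concern the mean of \<open>\<Prod>x. g (\<xi>(n, x))\<close> with a submultiplicative
  \<open>g\<close>, which is an average over words of steps; the law of large numbers for the jump times then
  gives the limit in continuous time.
\<close>

section \<open>Uniform averages over words\<close>

text \<open>What shapes the estimates is the size of the errors. The level grows like log n while n
  q stays bounded, so errors relative to q have to decay like a power of n. For late revisits
  summability of the return probabilities alone gives no rate; the visits are therefore weighted by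
  the fourth root of their time, which is subadditive over excursions and still summable against
  t^(-3/2). With blocks of length n^e and gaps of length n^(e/2) the late part of the gluing error,
  added over all blocks, is of order log n * n^(-e/8). For pairs of sites the exponent c comes from
  the gap of the Green function: if r is the return probability, the joint exponential moment of the
  visits to two sites is bounded for bases below (1+r)/(2r), and this exceeds 1/sqrt r by the
  inequality between the arithmetic and the geometric mean. A base 1/\<rho> strictly in between
  makes a pair cost \<rho>^(2k), against r^k for a single site. The exponent e is taken small enough
  for the gain to survive the sum over all pairs of a block.\<close>

definition words :: "'b set \<Rightarrow> nat \<Rightarrow> 'b list set" where
  "words B n = {w. set w \<subseteq> B \<and> length w = n}"

definition avg :: "'b set \<Rightarrow> nat \<Rightarrow> ('b list \<Rightarrow> real) \<Rightarrow> real" where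
  "avg B n F = (\<Sum>w\<in>words B n. F w) / real (card B) ^ n"

lemma words_0 [simp]: "words B 0 = {[]}"
  by (auto simp: words_def)

lemma avg_0 [simp]: "avg B 0 F = F []"
  by (simp add: avg_def)

lemma length_words: "w \<in> words B n \<Longrightarrow> length w = n"
  by (simp add: words_def)

lemma finite_words: "finite B \<Longrightarrow> finite (words B n)"
  by (simp add: words_def finite_lists_length_eq)

lemma card_words: "finite B \<Longrightarrow> card (words B n) = card B ^ n"
  by (simp add: words_def card_lists_length_eq)

lemma avg_cong: "(\<And>w. w \<in> words B n \<Longrightarrow> F w = H w) \<Longrightarrow> avg B n F = avg B n H"
  by (simp add: avg_def)

lemma avg_mono: "(\<And>w. w \<in> words B n \<Longrightarrow> F w \<le> H w) \<Longrightarrow> avg B n F \<le> avg B n H"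
  by (auto simp: avg_def intro!: divide_right_mono sum_mono)

lemma avg_nonneg: "(\<And>w. w \<in> words B n \<Longrightarrow> 0 \<le> F w) \<Longrightarrow> 0 \<le> avg B n F"
  by (auto simp: avg_def intro!: divide_nonneg_nonneg sum_nonneg)

lemma avg_const [simp]: "finite B \<Longrightarrow> B \<noteq> {} \<Longrightarrow> avg B n (\<lambda>_. c) = c"
  by (simp add: avg_def card_words)

lemma avg_add: "avg B n (\<lambda>w. F w + H w) = avg B n F + avg B n H"
  by (simp add: avg_def sum.distrib add_divide_distrib)

lemma avg_diff: "avg B n (\<lambda>w. F w - H w) = avg B n F - avg B n H"
  by (simp add: avg_def sum_subtractf diff_divide_distrib)

lemma avg_cmult: "avg B n (\<lambda>w. c * F w) = c * avg B n F"
  by (simp add: avg_def sum_distrib_left)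

lemma avg_multc: "avg B n (\<lambda>w. F w * c) = avg B n F * c"
  by (simp add: avg_def sum_distrib_right)

lemma avg_divide: "avg B n (\<lambda>w. F w / c) = avg B n F / c"
  using avg_multc[of B n F "inverse c"] by (simp add: divide_inverse)

lemma avg_sum: "avg B n (\<lambda>w. \<Sum>i\<in>I. F i w) = (\<Sum>i\<in>I. avg B n (F i))"
  unfolding avg_def sum_divide_distrib[symmetric] by (subst sum.swap) simp

lemma avg_Suc: "avg B (Suc n) F = (\<Sum>u\<in>B. avg B n (\<lambda>w. F (u # w))) / real (card B)"
proof -
  have "bij_betw (\<lambda>(u, w). u # w) (B \<times> words B n) (words B (Suc n))"
    unfolding bij_betw_def
    by (auto simp: words_def inj_on_def length_Suc_conv image_iff)
  from sum.reindex_bij_betw[OF this, of F, symmetric]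
  have "sum F (words B (Suc n)) = (\<Sum>u\<in>B. \<Sum>w\<in>words B n. F (u # w))"
    by (simp add: sum.cartesian_product case_prod_unfold)
  then show ?thesis
    by (simp add: avg_def sum_divide_distrib field_simps)
qed

text \<open>Markov property at a fixed time: the two parts of a uniform word are independent and
  uniform.\<close>

lemma avg_append: "avg B (m + n) F = avg B m (\<lambda>v. avg B n (\<lambda>w. F (v @ w)))"
  by (induction m arbitrary: F) (simp_all add: avg_Suc)

lemma avg_bij: "bij_betw h (words B n) (words B n) \<Longrightarrow> avg B n (\<lambda>w. F (h w)) = avg B n F"
  by (simp add: avg_def sum.reindex_bij_betw)

lemma avg_rev: "avg B n (\<lambda>w. F (rev w)) = avg B n F"
  by (rule avg_bij, rule bij_betwI[where g = rev]) (auto simp: words_def)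

lemma avg_map: 
  assumes "bij_betw \<phi> B B"
  shows "avg B n (\<lambda>w. F (map \<phi> w)) = avg B n F"
proof (induction n arbitrary: F)
  case (Suc n)
  have "(\<Sum>u\<in>B. avg B n (\<lambda>w. F (\<phi> u # map \<phi> w))) = (\<Sum>u\<in>B. avg B n (\<lambda>w. F (\<phi> u # w)))"
    by (intro sum.cong refl Suc[where F = "\<lambda>w. F (_ # w)"])
  also have "\<dots> = (\<Sum>u\<in>B. avg B n (\<lambda>w. F (u # w)))"
    using sum.reindex_bij_betw[OF assms, of "\<lambda>u. avg B n (\<lambda>w. F (u # w))"] by simp
  finally show ?case
    by (simp add: avg_Suc)
qed simp

text \<open>Nonnegativity of the variance.\<close>

lemma avg_square_le:
  assumes "finite B" "B \<noteq> {}"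
  shows "(avg B n F)\<^sup>2 \<le> avg B n (\<lambda>w. (F w)\<^sup>2)"
proof -
  let ?c = "avg B n F"
  have "0 \<le> avg B n (\<lambda>w. (F w - ?c)\<^sup>2)"
    by (rule avg_nonneg) simp
  also have "\<dots> = avg B n (\<lambda>w. (F w)\<^sup>2 + (?c\<^sup>2 - (2 * ?c) * F w))"
    by (rule avg_cong) (simp add: power2_eq_square algebra_simps)
  also have "\<dots> = avg B n (\<lambda>w. (F w)\<^sup>2) - ?c\<^sup>2"
    using assms by (simp add: avg_add avg_diff avg_cmult power2_eq_square)
  finally show ?thesis by simp
qed

lemma avg_pos:
  assumes "finite B" "w \<in> words B n" "0 < F w" "\<And>w. w \<in> words B n \<Longrightarrow> 0 \<le> F w"
  shows "0 < avg B n F"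
proof -
  have "0 < card B ^ n"
    using assms(1,2) card_gt_0_iff[of "words B n"] card_words[of B n] finite_words[of B n] by auto
  moreover have "0 < sum F (words B n)"
    using assms finite_words by (intro sum_pos2[where i = w]) auto
  ultimately show ?thesis
    by (simp add: avg_def)
qed

section \<open>The heat kernel\<close>

text \<open>Conditionally on the coordinates in which the steps are taken, the coordinates of the
  walk are independent one-dimensional walks.  The counts \<open>K\<close> of the coordinates are
  multinomial, and size biasing bounds the mean of \<open>\<Prod>i. 1 / (K i + 1)\<close>.\<close>

primrec line_prob :: "nat \<Rightarrow> int \<Rightarrow> real" where
  "line_prob 0 y = of_bool (y = 0)"
| "line_prob (Suc n) y = (line_prob n (y - 1) + line_prob n (y + 1)) / 2"

lemma line_prob_nonneg: "0 \<le> line_prob n y"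
  by (induction n arbitrary: y) auto

text \<open>After \<open>j\<close> steps up among \<open>n\<close> the walk is at
  \<open>2 * j - n\<close>; sites of the wrong parity are left to
  \<open>line_prob_odd\<close>.\<close>

lemma line_prob_eq: "line_prob n (2 * int j - int n) = real (n choose j) / 2 ^ n"
proof (induction n arbitrary: j)
  case 0
  show ?case by (cases j) auto
next
  case (Suc n)
  have *: "2 * int j - int (Suc n) + 1 = 2 * int j - int n" by simp
  show ?case
  proof (cases j)
    case 0
    \<comment> \<open>For \<open>j = 0\<close> one of the two predecessors is
      \<open>- n - 2\<close>, out of reach in \<open>n\<close> steps.\<close>
    have z: "line_prob n y = 0" if "\<bar>y\<bar> > int n" for n y
      using that by (induction n arbitrary: y) auto
    show ?thesis
      using Suc[of 0] z[where n = n and y = "- int n - 2"] 0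
      by (simp add: algebra_simps)
  next
    case (Suc k)
    have "2 * int j - int (Suc n) - 1 = 2 * int k - int n" using Suc by simp
    then show ?thesis
      using Suc.IH[of j] Suc.IH[of k] * Suc by (simp add: field_simps)
  qed
qed

lemma line_prob_odd: "odd (int n + y) \<Longrightarrow> line_prob n y = 0"
  by (induction n arbitrary: y) auto

text \<open>The squared form lets the induction close without roots: consecutive ratios are
  \<open>(2 * m + 1) / (2 * m + 2)\<close>, and
  \<open>(2 * m + 1) * (2 * m + 3) \<le> (2 * m + 2)^2\<close>.\<close>

lemma central_binomial_bound: "(real (2 * m choose m) / 4 ^ m)\<^sup>2 * (2 * real m + 1) \<le> 1"
proof (induction m)
  case (Suc m)
  define c where "c = real (2 * m choose m) / 4 ^ m"
  define a where "a = (2 * m + 1) choose Suc m"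
  have 1: "Suc m * a = (2 * m + 1) * (2 * m choose m)"
    unfolding a_def using Suc_times_binomial[of m "2 * m"] by simp
  have "Suc m * (2 * Suc m choose Suc m) = (2 * Suc m) * ((2 * m + 1) choose m)"
    using Suc_times_binomial[of m "2 * m + 1"] by (simp del: binomial_Suc_Suc)
  also have "(2 * m + 1) choose m = a"
    unfolding a_def using binomial_symmetric[of m "2 * m + 1"] by (simp del: binomial_Suc_Suc)
  finally have "Suc m * (2 * Suc m choose Suc m) = 2 * ((2 * m + 1) * (2 * m choose m))"
    using 1 by (metis mult.assoc mult.commute)
  then have "real (Suc m) * real (2 * Suc m choose Suc m) = 2 * ((2 * real m + 1) * real (2 * m choose m))"
    by (metis (mono_tags, opaque_lifting) of_nat_1 of_nat_add of_nat_mult of_nat_numeral)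
  then have 2: "real (2 * Suc m choose Suc m) = 2 * ((2 * real m + 1) * real (2 * m choose m)) / real (Suc m)"
    by (simp add: field_simps del: binomial_Suc_Suc of_nat_Suc)
  define z where "z = (2 * real m + 1) / (2 * real m + 2)"
  have 3: "real (2 * Suc m choose Suc m) / 4 ^ Suc m = c * z"
    unfolding 2 c_def z_def by (simp add: divide_simps)
  have "z\<^sup>2 * (2 * real m + 3) = (2 * real m + 1) * ((2 * real m + 1) * (2 * real m + 3) / (2 * real m + 2)\<^sup>2)"
    by (simp add: z_def power_divide power2_eq_square)
  also have "\<dots> \<le> (2 * real m + 1) * 1"
    by (intro mult_left_mono) (auto simp: power2_eq_square divide_simps, auto simp: algebra_simps)
  finally have "c\<^sup>2 * (z\<^sup>2 * (2 * real m + 3)) \<le> c\<^sup>2 * (2 * real m + 1)"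
    by (intro mult_left_mono) auto
  also have "\<dots> \<le> 1" using Suc by (simp add: c_def)
  also have "c\<^sup>2 * (z\<^sup>2 * (2 * real m + 3)) = (c * z)\<^sup>2 * (2 * real (Suc m) + 1)"
    by (simp add: power_mult_distrib)
  finally show ?case unfolding 3 .
qed simp

lemma line_prob_0_le: "line_prob n 0 \<le> 1 / sqrt (real n + 1)"
proof (cases "even n")
  case True
  then obtain m where m: "n = 2 * m" by auto
  have "line_prob n 0 = real (2 * m choose m) / 4 ^ m"
    using line_prob_eq[of n m] m by (simp add: power_mult)
  then have "(line_prob n 0)\<^sup>2 * (real n + 1) \<le> 1"
    using central_binomial_bound[of m] m by simp
  then have "(line_prob n 0 * sqrt (real n + 1))\<^sup>2 \<le> 1"
    by (simp add: power_mult_distrib)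
  then have "line_prob n 0 * sqrt (real n + 1) \<le> 1"
    unfolding abs_square_le_1 by simp
  then show ?thesis by (simp add: pos_le_divide_eq)
next
  case False
  then show ?thesis using line_prob_odd[of n 0] by simp
qed

text \<open>Each of the \<open>n + 1\<close> letters equals \<open>i\<close> with probability
  \<open>1 / d\<close>, and removing it leaves a uniform word of length \<open>n\<close> whose count
  of \<open>i\<close> is lower by one.\<close>

lemma avg_size_bias:
  fixes \<psi> :: "('d::finite \<Rightarrow> nat) \<Rightarrow> real"
  shows "avg UNIV (Suc n) (\<lambda>w. real (count_list w i) * \<psi> (count_list w))
     = (real n + 1) / real CARD('d) *
       avg UNIV n (\<lambda>w. \<psi> (\<lambda>j. count_list w j + of_bool (j = i)))"
proof (induction n arbitrary: \<psi>)
  case 0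
  have "(\<Sum>u\<in>UNIV. real (count_list [u] i) * \<psi> (count_list [u]))
      = (\<Sum>u\<in>UNIV. if u = i then \<psi> (count_list [i]) else 0)"
    by (intro sum.cong) auto
  moreover have "count_list [i] = (\<lambda>j. of_bool (j = i))" by auto
  ultimately show ?case by (simp add: avg_Suc)
next
  case (Suc n)
  let ?d = "real CARD('d)"
  have eq: "real (count_list (u # w) i) * \<psi> (count_list (u # w))
      = of_bool (u = i) * \<psi> (\<lambda>j. count_list w j + of_bool (j = i))
        + real (count_list w i) * \<psi> (\<lambda>j. count_list w j + of_bool (j = u))" for u w
  proof -
    have "count_list (u # w) = (\<lambda>j. count_list w j + of_bool (j = u))" by auto
    then show ?thesis by (auto simp: algebra_simps)
  qed
  have "avg UNIV (Suc (Suc n)) (\<lambda>w. real (count_list w i) * \<psi> (count_list w))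
     = (\<Sum>u\<in>UNIV. of_bool (u = i) * avg UNIV (Suc n) (\<lambda>w. \<psi> (\<lambda>j. count_list w j + of_bool (j = i)))
         + avg UNIV (Suc n) (\<lambda>w. real (count_list w i) * \<psi> (\<lambda>j. count_list w j + of_bool (j = u)))) / ?d"
    by (subst avg_Suc) (simp add: eq avg_add avg_cmult del: count_list.simps)
  also have "\<dots> = avg UNIV (Suc n) (\<lambda>w. \<psi> (\<lambda>j. count_list w j + of_bool (j = i))) / ?d
       + (\<Sum>u\<in>UNIV. (real n + 1) / ?d * avg UNIV n (\<lambda>w. \<psi> (\<lambda>j. count_list w j + of_bool (j = i) + of_bool (j = u)))) / ?d"
    by (simp add: sum.distrib add_divide_distrib Suc[of "\<lambda>K. \<psi> (\<lambda>j. K j + of_bool (j = _))"]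
        sum.delta' flip: of_bool_def)
  also have "(\<Sum>u\<in>UNIV. (real n + 1) / ?d * avg UNIV n (\<lambda>w. \<psi> (\<lambda>j. count_list w j + of_bool (j = i) + of_bool (j = u)))) / ?d
     = (real n + 1) / ?d * avg UNIV (Suc n) (\<lambda>w. \<psi> (\<lambda>j. count_list w j + of_bool (j = i)))"
  proof -
    have "(\<lambda>j. count_list (u # w) j + of_bool (j = i)) = (\<lambda>j. count_list w j + of_bool (j = i) + of_bool (j = u))" for u :: 'd and w
      by auto
    then show ?thesis
      by (simp add: avg_Suc sum_distrib_left del: count_list.simps)
  qed
  finally show ?case by (simp add: algebra_simps add_divide_distrib)
qed

text \<open>Size biasing read backwards: one factor \<open>1 / (K i + 1)\<close> is traded for
  \<open>d / (n + 1)\<close> and a word longer by one letter, so the induction over \<open>J\<close>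
  needs all lengths at once.\<close>

lemma avg_prod_inverse_count_le:
  "avg UNIV n (\<lambda>w. \<Prod>j\<in>J. 1 / (real (count_list w j) + 1)) \<le> (real CARD('d) / (real n + 1)) ^ card J"
  for J :: "'d::finite set"
proof (induction "card J" arbitrary: J n)
  case 0
  then show ?case by simp
next
  case (Suc k)
  then obtain i where i: "i \<in> J" by fastforce
  let ?d = "real CARD('d)"
  \<comment> \<open>Shifting the count of \<open>i\<close> by one turns \<open>1 / K i\<close> into
    \<open>1 / (K i + 1)\<close>. Where \<open>K i = 0\<close>, division by zero yields 0, so
    multiplying by \<open>K i\<close> never gives more than the remaining product.\<close>
  define \<psi> :: "('d \<Rightarrow> nat) \<Rightarrow> real" where
    "\<psi> K = 1 / real (K i) * (\<Prod>j\<in>J - {i}. 1 / (real (K j) + 1))" for K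
  have k: "card (J - {i}) = k" using Suc i by simp
  have "(\<Prod>j\<in>J. 1 / (real (count_list w j) + 1)) = \<psi> (\<lambda>j. count_list w j + of_bool (j = i))" for w
  proof -
    have "(\<Prod>j\<in>J. 1 / (real (count_list w j) + 1))
        = 1 / (real (count_list w i) + 1) * (\<Prod>j\<in>J - {i}. 1 / (real (count_list w j) + 1))"
      using i by (subst prod.remove[of _ i]) auto
    also have "(\<Prod>j\<in>J - {i}. 1 / (real (count_list w j) + 1))
        = (\<Prod>j\<in>J - {i}. 1 / (real (count_list w j + of_bool (j = i)) + 1))"
      by (intro prod.cong) auto
    finally show ?thesis by (simp add: \<psi>_def add.commute)
  qed
  then have "(real n + 1) / ?d * avg UNIV n (\<lambda>w. \<Prod>j\<in>J. 1 / (real (count_list w j) + 1))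
      = avg UNIV (Suc n) (\<lambda>w. real (count_list w i) * \<psi> (count_list w))"
    by (simp add: avg_size_bias)
  also have "\<dots> \<le> avg UNIV (Suc n) (\<lambda>w. \<Prod>j\<in>J - {i}. 1 / (real (count_list w j) + 1))"
  proof (rule avg_mono)
    fix w :: "'d list"
    have "0 \<le> (\<Prod>j\<in>J - {i}. 1 / (real (count_list w j) + 1))" by (intro prod_nonneg) auto
    then show "real (count_list w i) * \<psi> (count_list w) \<le> (\<Prod>j\<in>J - {i}. 1 / (real (count_list w j) + 1))"
      by (cases "count_list w i = 0") (auto simp: \<psi>_def)
  qed
  also have "\<dots> \<le> (?d / (real (Suc n) + 1)) ^ k"
    using Suc.hyps(1)[of "J - {i}" "Suc n"] k by simp
  also have "\<dots> \<le> (?d / (real n + 1)) ^ k"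
    by (intro power_mono divide_left_mono) auto
  finally have "(real n + 1) / ?d * avg UNIV n (\<lambda>w. \<Prod>j\<in>J. 1 / (real (count_list w j) + 1)) \<le> (?d / (real n + 1)) ^ k" .
  then have "?d / (real n + 1) * ((real n + 1) / ?d * avg UNIV n (\<lambda>w. \<Prod>j\<in>J. 1 / (real (count_list w j) + 1)))
      \<le> ?d / (real n + 1) * (?d / (real n + 1)) ^ k"
    by (rule mult_left_mono) simp
  moreover have "?d / (real n + 1) * ((real n + 1) / ?d * x) = x" for x by (simp add: divide_simps)
  ultimately show ?case unfolding Suc.hyps(2)[symmetric] by simp
qed

section \<open>Symmetries and decay of the heat kernel\<close>

lemma finite_unit_steps: "finite (unit_steps :: (int ^ 'd::finite) set)"
  by (simp add: unit_steps_def)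

lemma sum_unit_steps:
  fixes F :: "int ^ 'd::finite \<Rightarrow> 'c::comm_monoid_add"
  shows "(\<Sum>u\<in>unit_steps. F u) = (\<Sum>i\<in>UNIV. F (axis i 1) + F (axis i (-1)))"
proof -
  have inj: "inj (\<lambda>i::'d. axis i (c::int))" if "c \<noteq> 0" for c
    using that by (auto simp: inj_on_def axis_eq_axis)
  have "(\<Sum>u\<in>unit_steps. F u) = (\<Sum>u\<in>range (\<lambda>i. axis i 1). F u) + (\<Sum>u\<in>range (\<lambda>i. axis i (-1)). F u)"
    unfolding unit_steps_def by (rule sum.union_disjoint) (auto simp: axis_eq_axis)
  then show ?thesis
    using inj by (simp add: sum.reindex sum.distrib)
qed

lemma card_unit_steps: "card (unit_steps :: (int ^ 'd::finite) set) = 2 * CARD('d)"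
  unfolding card_eq_sum sum_unit_steps by simp

lemma uminus_unit_steps: "u \<in> unit_steps \<Longrightarrow> - u \<in> (unit_steps :: (int ^ 'd::finite) set)"
proof -
  have "- axis i c = axis i (- c)" for i :: 'd and c :: int
    by (auto simp: axis_def vec_eq_iff)
  then show "u \<in> unit_steps \<Longrightarrow> - u \<in> unit_steps"
    unfolding unit_steps_def by auto
qed

definition step_prob :: "nat \<Rightarrow> int ^ 'd::finite \<Rightarrow> real" where
  "step_prob t x = avg unit_steps t (\<lambda>w. of_bool (sum_list w = x))"

locale lattice =
  fixes dim :: "'d::finite itself"
  assumes dim: "3 \<le> CARD('d)"
begin

abbreviation U :: "(int ^ 'd) set" where "U \<equiv> unit_steps"

abbreviation p :: "nat \<Rightarrow> int ^ 'd \<Rightarrow> real" where "p \<equiv> step_prob"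

lemma finite_U [simp]: "finite U"
  by (rule finite_unit_steps)

lemma card_U_pos: "0 < real (card U)"
  by (simp add: card_unit_steps)

lemma U_nonempty [simp]: "U \<noteq> {}"
  using card_U_pos by auto

lemma p_nonneg: "0 \<le> p t x"
  by (simp add: step_prob_def avg_nonneg)

lemma p_le_1: "p t x \<le> 1"
proof -
  have "p t x \<le> avg U t (\<lambda>_. 1)"
    unfolding step_prob_def by (rule avg_mono) auto
  then show ?thesis by simp
qed

lemma p_0: "p 0 x = of_bool (x = 0)"
  by (auto simp: step_prob_def)

lemma p_Suc: "p (Suc t) x = (\<Sum>u\<in>U. p t (x - u)) / card U"
proof -
  have "(u + s = x) = (s = x - u)" for u s :: "int ^ 'd" by (auto simp: algebra_simps)
  then show ?thesis by (simp add: step_prob_def avg_Suc)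
qed

lemma bij_uminus_U: "bij_betw uminus U U"
  by (rule bij_betwI[where g = uminus]) (auto simp: uminus_unit_steps)

lemma p_Suc': "p (Suc t) x = (\<Sum>u\<in>U. p t (x + u)) / card U"
  unfolding p_Suc using sum.reindex_bij_betw[OF bij_uminus_U, of "\<lambda>u. p t (x + u)"] by simp

text \<open>An additive bijection that preserves the steps permutes the uniform words and commutes
  with taking their sum.\<close>

lemma p_automorphism:
  assumes add: "\<And>x y. \<phi> (x + y) = \<phi> x + \<phi> y" and inj: "inj \<phi>"
    and bij: "bij_betw \<phi> U U"
  shows "p t (\<phi> x) = p t x"
proof -
  have "\<phi> 0 + \<phi> 0 = \<phi> 0 + 0" using add[of 0 0] by simp
  then have 0: "\<phi> 0 = 0" by (simp only: add_left_cancel)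
  have "sum_list (map \<phi> w) = \<phi> (sum_list w)" for w
    by (induction w) (simp_all add: add 0)
  then have "avg U t (\<lambda>w. of_bool (sum_list (map \<phi> w) = \<phi> x)) = p t x"
    using inj by (simp add: step_prob_def inj_eq)
  then show ?thesis
    by (simp add: step_prob_def avg_map[OF bij, of t "\<lambda>w. of_bool (sum_list w = \<phi> x)"])
qed

lemma p_uminus: "p t (- x) = p t x"
  by (rule p_automorphism) (auto simp: bij_uminus_U)

text \<open>Negation together with the transpositions of coordinates acts transitively on the unit
  steps.\<close>

lemma p_unit:
  assumes "u \<in> U" "v \<in> U"
  shows "p t u = p t v"
proof -
  have "p t (axis j 1) = p t (axis i 1)" for i j :: 'd
  proof -
    define \<phi> :: "int ^ 'd \<Rightarrow> int ^ 'd" where "\<phi> x = (\<chi> k. x $ Transposition.transpose i j k)" for x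
    have inv: "\<phi> (\<phi> x) = x" for x by (simp add: \<phi>_def vec_eq_iff)
    have ax: "\<phi> (axis k c) = axis (Transposition.transpose i j k) c" for k c
      by (auto simp: \<phi>_def vec_eq_iff axis_def Transposition.transpose_def)
    have "\<phi> u \<in> U" if "u \<in> U" for u
      using that by (auto simp: unit_steps_def ax)
    then have "bij_betw \<phi> U U"
      by (intro bij_betwI[where g = \<phi>]) (auto simp: inv)
    moreover have "inj \<phi>" by (metis inv injI)
    moreover have "\<phi> (x + y) = \<phi> x + \<phi> y" for x y
      by (simp add: \<phi>_def vec_eq_iff)
    ultimately have "p t (\<phi> (axis i 1)) = p t (axis i 1)"
      using p_automorphism by blast
    then show ?thesis by (simp add: ax)
  qed
  moreover have "\<exists>i. u = axis i 1 \<or> u = - axis i 1" if "u \<in> U" for u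
  proof -
    have "axis i (-1) = - axis i (1::int)" for i :: 'd by (auto simp: axis_def vec_eq_iff)
    then show ?thesis using that by (auto simp: unit_steps_def)
  qed
  ultimately show ?thesis using assms by (metis p_uminus)
qed

text \<open>A step picks a coordinate and a sign; averaging over the sign is the recursion of
  \<open>line_prob\<close> in that coordinate and leaves the other factors alone.\<close>

lemma p_eq_avg_line_prob:
  "p t x = avg UNIV t (\<lambda>w. \<Prod>i\<in>UNIV. line_prob (count_list w i) (x $ i))"
proof (induction t arbitrary: x)
  case 0
  have "x = 0 \<longleftrightarrow> (\<forall>i. x $ i = 0)" by (simp add: vec_eq_iff)
  then show ?case
    by (cases "x = 0") (auto simp: p_0 vec_eq_iff)
next
  case (Suc t)
  have eq: "(\<Prod>j\<in>UNIV. line_prob (count_list (i # w) j) (x $ j))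
      = ((\<Prod>j\<in>UNIV. line_prob (count_list w j) ((x - axis i 1) $ j))
        + (\<Prod>j\<in>UNIV. line_prob (count_list w j) ((x - axis i (-1)) $ j))) / 2" for i w
  proof -
    have r: "(\<Prod>j\<in>UNIV. h j) = h i * (\<Prod>j\<in>UNIV - {i}. h j)" for h :: "'d \<Rightarrow> real"
      by (rule prod.remove) auto
    have "(\<Prod>j\<in>UNIV - {i}. line_prob (count_list w j) ((x - axis i c) $ j))
        = (\<Prod>j\<in>UNIV - {i}. line_prob (count_list w j) (x $ j))" for c
      by (intro prod.cong) (auto simp: axis_def)
    moreover have "(\<Prod>j\<in>UNIV - {i}. line_prob (count_list (i # w) j) (x $ j))
        = (\<Prod>j\<in>UNIV - {i}. line_prob (count_list w j) (x $ j))"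
      by (intro prod.cong) auto
    ultimately show ?thesis
      by (simp add: r algebra_simps add_divide_distrib)
  qed
  have "p (Suc t) x = (\<Sum>i\<in>UNIV. p t (x - axis i 1) + p t (x - axis i (-1))) / (2 * CARD('d))"
    by (simp add: p_Suc sum_unit_steps card_unit_steps)
  also have "\<dots> = (\<Sum>i\<in>UNIV. (p t (x - axis i 1) + p t (x - axis i (-1))) / 2) / CARD('d)"
    by (simp add: sum_divide_distrib[symmetric])
  also have "\<dots> = avg UNIV (Suc t) (\<lambda>w. \<Prod>i\<in>UNIV. line_prob (count_list w i) (x $ i))"
    by (simp only: avg_Suc eq avg_add avg_divide Suc)
  finally show ?case .
qed

text \<open>By Cauchy-Schwarz the factors \<open>1 / sqrt (K i + 1)\<close> become
  \<open>1 / (K i + 1)\<close>, whose mean is known. The bound is trivial when its base exceeds 1;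
  otherwise dimensions above 3 only decrease the power.\<close>

lemma p_return_le: "p t 0 \<le> (real CARD('d) / (real t + 1)) powr (3 / 2)"
proof (cases "real CARD('d) / (real t + 1) \<le> 1")
  case False
  then have "1 \<le> (real CARD('d) / (real t + 1)) powr (3 / 2)"
    by (intro ge_one_powr_ge_zero) auto
  then show ?thesis using p_le_1[of t 0] by linarith
next
  case True
  let ?b = "real CARD('d) / (real t + 1)"
  have "p t 0 \<le> avg UNIV t (\<lambda>w. \<Prod>i\<in>(UNIV :: 'd set). 1 / sqrt (real (count_list w i) + 1))"
    unfolding p_eq_avg_line_prob
    by (intro avg_mono prod_mono conjI) (auto simp: line_prob_nonneg line_prob_0_le)
  then have "(p t 0)\<^sup>2 \<le> (avg UNIV t (\<lambda>w. \<Prod>i\<in>(UNIV :: 'd set). 1 / sqrt (real (count_list w i) + 1)))\<^sup>2"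
    by (intro power_mono p_nonneg)
  also have "\<dots> \<le> avg UNIV t (\<lambda>w. (\<Prod>i\<in>(UNIV :: 'd set). 1 / sqrt (real (count_list w i) + 1))\<^sup>2)"
    by (rule avg_square_le) auto
  also have "\<dots> = avg UNIV t (\<lambda>w. \<Prod>i\<in>(UNIV :: 'd set). 1 / (real (count_list w i) + 1))"
    by (simp add: prod_power_distrib power_divide)
  also have "\<dots> \<le> ?b ^ CARD('d)"
    by (rule avg_prod_inverse_count_le)
  also have "\<dots> \<le> ?b ^ 3"
    using True dim by (intro power_decreasing) auto
  also have "\<dots> = (?b powr (3 / 2))\<^sup>2"
  proof -
    have "(?b powr (3 / 2))\<^sup>2 = ?b powr (3 / 2 + 3 / 2)"
      by (simp only: power2_eq_square powr_add)
    also have "\<dots> = ?b ^ 3" by (simp add: powr_numeral)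
    finally show ?thesis by simp
  qed
  finally show ?thesis
    by (rule power2_le_imp_le) simp
qed

section \<open>A subadditive weight for late visits\<close>

text \<open>The exponent lies below 1/2, so that the weight is summable against
  \<open>t powr (-3/2)\<close>, and below 1, so that it is subadditive. As a nested square root it
  inherits subadditivity from \<open>sqrt\<close>.\<close>

definition fourth_root :: "nat \<Rightarrow> real" where "fourth_root t = sqrt (sqrt (real t))"

lemma fourth_root_powr: "0 < t \<Longrightarrow> fourth_root t = real t powr (1 / 4)"
  by (simp add: fourth_root_def powr_half_sqrt[symmetric] powr_powr)

lemma fourth_root_nonneg: "0 \<le> fourth_root t"
  by (simp add: fourth_root_def)

lemma fourth_root_mono: "s \<le> t \<Longrightarrow> fourth_root s \<le> fourth_root t"
  by (simp add: fourth_root_def)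

text \<open>The difference is truncated, which matches \<open>drop (s - t)\<close> when an excursion
  of length \<open>t\<close> overshoots the time \<open>s\<close>.\<close>

lemma fourth_root_subadd: "fourth_root s \<le> fourth_root t + fourth_root (s - t)"
proof -
  have "fourth_root s \<le> sqrt (sqrt (real t) + sqrt (real (s - t)))"
    unfolding fourth_root_def
    by (intro real_sqrt_le_mono order_trans[OF _ sqrt_add_le_add_sqrt]) auto
  also have "\<dots> \<le> fourth_root t + fourth_root (s - t)"
    unfolding fourth_root_def by (intro sqrt_add_le_add_sqrt) auto
  finally show ?thesis .
qed

lemma summable_fourth_root_p: "summable (\<lambda>t. fourth_root t * p t 0)"
proof (rule summable_comparison_test)
  let ?d = "real CARD('d) powr (3 / 2)"
  show "\<exists>N. \<forall>t\<ge>N. norm (fourth_root t * p t 0) \<le> ?d * real (Suc t) powr (-5/4)"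
  proof (intro exI allI impI)
    fix t :: nat
    have "fourth_root t * p t 0 \<le> fourth_root (Suc t) * (real CARD('d) / (real t + 1)) powr (3 / 2)"
      by (intro mult_mono p_return_le fourth_root_mono fourth_root_nonneg p_nonneg) auto
    also have "\<dots> = ?d * (real (Suc t) powr (1 / 4) * real (Suc t) powr (- (3 / 2)))"
      by (simp add: fourth_root_powr powr_divide powr_minus_divide add.commute)
    also have "real (Suc t) powr (1 / 4) * real (Suc t) powr (- (3 / 2)) = real (Suc t) powr (1 / 4 + - (3 / 2))"
      by (rule powr_add[symmetric])
    also have "1 / 4 + - (3 / 2) = (-5/4 :: real)" by simp
    finally show "norm (fourth_root t * p t 0) \<le> ?d * real (Suc t) powr (-5/4)"
      by (simp add: fourth_root_nonneg p_nonneg)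
  qed
  show "summable (\<lambda>t. ?d * real (Suc t) powr (-5/4))"
    using summable_real_powr_iff[of "-5/4"] by (intro summable_mult) (subst summable_Suc_iff, simp)
qed

lemma summable_p_return: "summable (\<lambda>t. p t 0)"
proof (rule summable_comparison_test')
  show "summable (\<lambda>t. fourth_root t * p t 0)" by (rule summable_fourth_root_p)
  fix t :: nat assume "1 \<le> t"
  then have "1 \<le> fourth_root t" by (simp add: fourth_root_def)
  then show "norm (p t 0) \<le> fourth_root t * p t 0"
    using mult_right_mono[OF _ p_nonneg, of 1 "fourth_root t" t 0] by (simp add: p_nonneg)
qed

section \<open>The Green function and its gap at the origin\<close>

definition G :: "int ^ 'd \<Rightarrow> real" where "G x = (\<Sum>t. p t x)"

lemma partial_green_Suc:
  "(\<Sum>t<Suc h. p t x) = of_bool (x = 0) + (\<Sum>u\<in>U. \<Sum>t<h. p t (x + u)) / card U"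
  by (subst sum.lessThan_Suc_shift, subst sum.swap)
     (simp add: p_0 p_Suc' sum_divide_distrib del: sum.lessThan_Suc)

text \<open>Maximum principle: a site that is neither the origin nor a neighbour of it averages over
  sites none of which is the origin, so induction over the horizon applies. Horizons are finite
  because summability away from the origin is not yet available.\<close>

lemma partial_green_unit_max:
  assumes "x \<noteq> 0" "e \<in> U"
  shows "(\<Sum>t<h. p t x) \<le> (\<Sum>t<h. p t e)"
  using assms(1)
proof (induction h arbitrary: x)
  case (Suc h)
  show ?case
  proof (cases "x \<in> U")
    case True
    then show ?thesis using p_unit[OF True assms(2)] by simp
  next
    case False
    have "(\<Sum>t<Suc h. p t x) = (\<Sum>u\<in>U. \<Sum>t<h. p t (x + u)) / card U"
      using Suc.prems by (simp add: partial_green_Suc del: sum.lessThan_Suc)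
    also have "\<dots> \<le> (\<Sum>u\<in>U. \<Sum>t<h. p t e) / card U"
    proof (rule divide_right_mono, rule sum_mono)
      fix u assume u: "u \<in> U"
      have "x + u \<noteq> 0"
        using u False uminus_unit_steps[OF u] by (metis add_eq_0_iff2)
      then show "(\<Sum>t<h. p t (x + u)) \<le> (\<Sum>t<h. p t e)" by (rule Suc.IH)
    qed simp
    also have "\<dots> = (\<Sum>t<h. p t e)" using card_U_pos by simp
    also have "\<dots> \<le> (\<Sum>t<Suc h. p t e)" by (simp add: p_nonneg)
    finally show ?thesis .
  qed
qed simp

text \<open>The first step from the origin leads to a neighbour, and by symmetry all neighbours are
  alike.\<close>

lemma partial_green_unit: "e \<in> U \<Longrightarrow> (\<Sum>t<Suc h. p t 0) = 1 + (\<Sum>t<h. p t e)"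
proof -
  assume e: "e \<in> U"
  have "(\<Sum>u\<in>U. \<Sum>t<h. p t (0 + u)) = (\<Sum>u\<in>U. \<Sum>t<h. p t e)"
    using p_unit[OF _ e] by (intro sum.cong) auto
  then show ?thesis using card_U_pos by (simp add: partial_green_Suc del: sum.lessThan_Suc)
qed

text \<open>The gap 1 is the visit at time 0 of a walk started at the origin. Being uniform in
  \<open>h\<close>, the bound also yields the summability of \<open>p t x\<close>.\<close>

lemma partial_green_le: "x \<noteq> 0 \<Longrightarrow> (\<Sum>t<h. p t x) \<le> G 0 - 1"
proof -
  assume x: "x \<noteq> 0"
  obtain e where e: "e \<in> U" using U_nonempty by blast
  have "(\<Sum>t<h. p t x) \<le> (\<Sum>t<Suc h. p t 0) - 1"
    using partial_green_unit_max[OF x e] partial_green_unit[OF e, of h] by simp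
  also have "\<dots> \<le> G 0 - 1"
    unfolding G_def by (intro diff_right_mono sum_le_suminf summable_p_return) (auto simp: p_nonneg)
  finally show ?thesis .
qed

lemma summable_p: "summable (\<lambda>t. p t x)"
proof (cases "x = 0")
  case False
  show ?thesis
    by (rule bounded_imp_summable[where B = "G 0 - 1"])
       (use partial_green_le[OF False] in \<open>auto simp: p_nonneg lessThan_Suc_atMost[symmetric] simp del: sum.lessThan_Suc\<close>)
qed (simp add: summable_p_return)

lemma G_le: "x \<noteq> 0 \<Longrightarrow> G x \<le> G 0 - 1"
  unfolding G_def[of x] by (rule suminf_le_const[OF summable_p]) (rule partial_green_le)

lemma G_nonneg: "0 \<le> G x"
  unfolding G_def by (intro suminf_nonneg summable_p p_nonneg)

lemma G_le_G0: "G x \<le> G 0"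
  using G_le[of x] by (cases "x = 0") auto

lemma G_ge_1: "1 \<le> G 0"
  using G_le[of "axis undefined 1"] G_nonneg[of "axis undefined 1"] 
  by (auto simp: axis_eq_0_iff)

lemma G_harmonic: "G x = of_bool (x = 0) + (\<Sum>u\<in>U. G (x + u)) / card U"
proof -
  have "(\<lambda>t. (\<Sum>u\<in>U. p t (x + u)) / card U) sums ((\<Sum>u\<in>U. G (x + u)) / card U)"
    unfolding G_def by (intro sums_divide sums_sum summable_sums summable_p)
  then have "(\<lambda>t. p (Suc t) x) sums ((\<Sum>u\<in>U. G (x + u)) / card U)"
    by (simp add: p_Suc')
  then have "(\<Sum>t. p (Suc t) x) = (\<Sum>u\<in>U. G (x + u)) / card U"
    by (rule sums_unique[symmetric])
  then show ?thesis
    using suminf_split_head[OF summable_p, of x] by (simp add: G_def p_0)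
qed

end

section \<open>Returns to the origin\<close>

text \<open>The positions at the times \<open>0, \<dots>, length w - 1\<close>: the end point is left out, so that
  concatenation of words becomes concatenation of paths.\<close>

primrec path :: "'b::monoid_add \<Rightarrow> 'b list \<Rightarrow> 'b list" where
  "path x [] = []"
| "path x (u # w) = x # path (x + u) w"

lemma length_path [simp]: "length (path x w) = length w"
  by (induction w arbitrary: x) auto

lemma path_append: "path x (v @ w) = path x v @ path (x + sum_list v) w"
  by (induction v arbitrary: x) (auto simp: add.assoc)

lemma nth_path: "i < length w \<Longrightarrow> path x w ! i = x + sum_list (take i w)"
  by (induction w arbitrary: x i) (auto simp: nth_Cons add.assoc split: nat.splits)

lemma path_shift: "path (x + y) w = map ((+) x) (path y w)"
  by (induction w arbitrary: y) (auto simp: add.assoc)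

lemma take_path: "take i (path x w) = path x (take i w)"
  by (induction w arbitrary: x i) (auto simp: take_Cons split: nat.splits)

lemma in_set_path: "y \<in> set (path x w) \<longleftrightarrow> (\<exists>i<length w. y = x + sum_list (take i w))"
  by (metis (no_types, lifting) in_set_conv_nth length_path nth_path)

lemma count_list_path_shift:
  fixes x :: "'b::group_add"
  shows "count_list (path (x + y) w) (x + z) = count_list (path y w) z"
  unfolding path_shift by (rule count_list_map_conv) (simp add: inj_def)

lemma count_list_path_sub:
  fixes x :: "'b::group_add"
  shows "count_list (path x w) x = count_list (path 0 w) 0"
  using count_list_path_shift[of x 0 w 0] by simp

section \<open>Excursions of words\<close>

definition first_return :: "'b::monoid_add list \<Rightarrow> bool" where
  "first_return w \<longleftrightarrow> w \<noteq> [] \<and> sum_list w = 0 \<and> (\<forall>k\<in>{0<..<length w}. sum_list (take k w) \<noteq> 0)"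

text \<open>At most one prefix of a word is its first excursion, so the sum is the indicator of a
  return. It is the partition behind every first-return decomposition.\<close>

lemma sum_first_return:
  assumes "m \<le> length w"
  shows "(\<Sum>t\<in>{1..m}. of_bool (first_return (take t w))) = (of_bool (\<exists>t\<in>{1..m}. sum_list (take t w) = 0) :: real)"
proof (cases "\<exists>t\<in>{1..m}. sum_list (take t w) = 0")
  case False
  have "(\<Sum>t\<in>{1..m}. of_bool (first_return (take t w))) = (\<Sum>t\<in>{1..m}. 0 :: real)"
    using False by (intro sum.cong) (auto simp: first_return_def)
  then show ?thesis using False by simp
next
  case True
  define P where "P t \<longleftrightarrow> t \<in> {1..m} \<and> sum_list (take t w) = 0" for t
  define s where "s = (LEAST t. P t)"
  have s: "P s" unfolding s_def by (rule LeastI_ex) (use True in \<open>auto simp: P_def\<close>)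
  have least: "s \<le> t" if "P t" for t unfolding s_def using that by (rule Least_le)
  have "first_return (take t w) \<longleftrightarrow> t = s" if t: "t \<in> {1..m}" for t
  proof
    assume fr: "first_return (take t w)"
    then have "P t" using t by (simp add: P_def first_return_def)
    have "\<not> s < t"
    proof
      assume "s < t"
      then have "s \<in> {0<..<length (take t w)}" "take s (take t w) = take s w"
        using s t assms by (auto simp: P_def min_def)
      then show False using fr s by (metis P_def first_return_def)
    qed
    then show "t = s" using least[OF \<open>P t\<close>] by simp
  next
    assume "t = s"
    have "sum_list (take k (take s w)) \<noteq> 0" if "k \<in> {0<..<length (take s w)}" for k
    proof
      assume "sum_list (take k (take s w)) = 0"
      then have "P k" using that s by (auto simp: P_def min_def split: if_splits)
      then show False using least[of k] that by auto
    qed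
    then show "first_return (take t w)"
      unfolding \<open>t = s\<close> using s assms by (auto simp: P_def first_return_def)
  qed
  then have "(\<Sum>t\<in>{1..m}. of_bool (first_return (take t w))) = (\<Sum>t\<in>{1..m}. if t = s then 1 else 0 :: real)"
    by (intro sum.cong) auto
  also have "\<dots> = 1" using s by (auto simp: P_def)
  finally show ?thesis using True by simp
qed

lemma path_0_return:
  assumes "0 \<in> set (drop s (path 0 w))" "0 < s"
  shows "\<exists>t\<in>{1..length w - 1}. sum_list (take t w) = 0"
proof -
  obtain i where "i < length w - s" "drop s (path 0 w) ! i = 0"
    using assms(1) by (auto simp: in_set_conv_nth)
  then show ?thesis
    using assms(2) by (intro bexI[of _ "s + i"]) (auto simp: nth_path)
qed

lemma count_path_0:
  "w \<noteq> [] \<Longrightarrow> count_list (path 0 w) 0 = Suc (count_list (drop 1 (path 0 w)) 0)"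
  by (cases w) auto

lemma count_path_0_return:
  assumes "1 < count_list (path 0 w) 0"
  shows "\<exists>t\<in>{1..length w - 1}. sum_list (take t w) = 0"
proof -
  have "w \<noteq> []" using assms by auto
  then have "count_list (drop 1 (path 0 w)) 0 \<noteq> 0" using assms count_path_0[of w] by simp
  then show ?thesis by (intro path_0_return[of 1]) (auto simp: count_list_0_iff)
qed

lemma first_return_no_zero:
  assumes "first_return w" "0 < s"
  shows "0 \<notin> set (drop s (path 0 w))"
  using path_0_return[of s w] assms by (force simp: first_return_def)

text \<open>The return falls on the end point that \<open>path\<close> omits, so an excursion counts
  only the visit at its start, and prefixing one raises the count by exactly 1.\<close>

lemma count_path_first_return:
  "first_return w \<Longrightarrow> count_list (path 0 w) 0 = 1"
  using first_return_no_zero[of w 1] count_path_0[of w] by (simp add: first_return_def count_list_0_iff)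

context lattice
begin

text \<open>The law of the first return time, defective by transience.\<close>

definition f :: "nat \<Rightarrow> real" where
  "f t = avg U t (\<lambda>w. of_bool (first_return w))"

definition no_return :: "nat \<Rightarrow> real" where
  "no_return n = avg U n (\<lambda>w. of_bool (\<forall>t\<in>{1..n}. sum_list (take t w) \<noteq> 0))"

lemma avg_take: "t \<le> n \<Longrightarrow> avg U n (\<lambda>w. F (take t w)) = avg U t F"
proof -
  assume "t \<le> n"
  then have "avg U n (\<lambda>w. F (take t w)) = avg U (t + (n - t)) (\<lambda>w. F (take t w))" by simp
  also have "\<dots> = avg U t (\<lambda>v. avg U (n - t) (\<lambda>w. F v))"
    unfolding avg_append by (intro avg_cong) (simp add: length_words)
  finally show ?thesis by simp
qed

text \<open>Since \<open>F\<close> vanishes on words without a return up to \<open>m\<close>, the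
  excursion indicators sum to 1 wherever \<open>F\<close> matters; what follows the excursion is
  again a uniform word.\<close>

lemma avg_first_return:
  assumes "m \<le> n"
    and "\<And>w. w \<in> words U n \<Longrightarrow> \<forall>t\<in>{1..m}. sum_list (take t w) \<noteq> 0 \<Longrightarrow> F w = 0"
  shows "avg U n F = (\<Sum>t\<in>{1..m}. avg U t (\<lambda>v. of_bool (first_return v) * avg U (n - t) (\<lambda>w. F (v @ w))))"
proof -
  have "avg U n F = avg U n (\<lambda>w. \<Sum>t\<in>{1..m}. of_bool (first_return (take t w)) * F w)"
  proof (rule avg_cong)
    fix w assume w: "w \<in> words U n"
    have "F w = of_bool (\<exists>t\<in>{1..m}. sum_list (take t w) = 0) * F w"
      using assms(2)[OF w] by auto
    also have "\<dots> = (\<Sum>t\<in>{1..m}. of_bool (first_return (take t w)) * F w)"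
      using sum_first_return[of m w] assms(1) length_words[OF w]
      by (simp add: sum_distrib_right[symmetric])
    finally show "F w = (\<Sum>t\<in>{1..m}. of_bool (first_return (take t w)) * F w)" .
  qed
  also have "\<dots> = (\<Sum>t\<in>{1..m}. avg U n (\<lambda>w. of_bool (first_return (take t w)) * F w))"
    by (rule avg_sum)
  also have "\<dots> = (\<Sum>t\<in>{1..m}. avg U t (\<lambda>v. of_bool (first_return v) * avg U (n - t) (\<lambda>w. F (v @ w))))"
  proof (rule sum.cong)
    fix t assume "t \<in> {1..m}"
    then have "n = t + (n - t)" using assms(1) by auto
    then have "avg U n (\<lambda>w. of_bool (first_return (take t w)) * F w)
        = avg U (t + (n - t)) (\<lambda>w. of_bool (first_return (take t w)) * F w)" by simp
    also have "\<dots> = avg U t (\<lambda>v. of_bool (first_return v) * avg U (n - t) (\<lambda>w. F (v @ w)))"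
      unfolding avg_append by (intro avg_cong) (simp add: length_words avg_cmult)
    finally show "avg U n (\<lambda>w. of_bool (first_return (take t w)) * F w)
        = avg U t (\<lambda>v. of_bool (first_return v) * avg U (n - t) (\<lambda>w. F (v @ w)))" .
  qed simp
  finally show ?thesis .
qed

lemma f_nonneg: "0 \<le> f t"
  by (simp add: f_def avg_nonneg)

lemma f_0 [simp]: "f 0 = 0"
  by (simp add: f_def first_return_def)

lemma f_le_p: "f t \<le> p t 0"
  unfolding f_def step_prob_def by (rule avg_mono) (simp add: first_return_def)

lemma no_return_eq: "no_return n = 1 - (\<Sum>t\<in>{1..n}. f t)"
proof -
  have "no_return n = avg U n (\<lambda>w. 1 - (\<Sum>t\<in>{1..n}. of_bool (first_return (take t w))))"
    unfolding no_return_def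
  proof (rule avg_cong)
    fix w assume "w \<in> words U n"
    then have "(\<Sum>t\<in>{1..n}. of_bool (first_return (take t w))) = (of_bool (\<exists>t\<in>{1..n}. sum_list (take t w) = 0) :: real)"
      by (intro sum_first_return) (simp add: length_words)
    then show "of_bool (\<forall>t\<in>{1..n}. sum_list (take t w) \<noteq> 0) = (1 - (\<Sum>t\<in>{1..n}. of_bool (first_return (take t w))) :: real)"
      unfolding \<open>_ = of_bool _\<close> by auto
  qed
  also have "\<dots> = 1 - (\<Sum>t\<in>{1..n}. avg U n (\<lambda>w. of_bool (first_return (take t w))))"
    by (simp only: avg_diff avg_sum avg_const finite_U U_nonempty not_False_eq_True)
  also have "\<dots> = 1 - (\<Sum>t\<in>{1..n}. f t)"
    by (auto simp: f_def avg_take[of _ n "\<lambda>v. of_bool (first_return v)"] intro!: sum.cong)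
  finally show ?thesis .
qed

lemma summable_f: "summable f"
  by (rule summable_comparison_test'[OF summable_p_return, of 0]) (simp add: f_nonneg f_le_p)

text \<open>The return probability, which \<open>escape_prob_eq\<close> identifies as
  \<open>1 - \<gamma>\<close>. It is the ratio of the geometric tails of the visit counts.\<close>

definition r :: real where "r = (\<Sum>t. f t)"

lemma sum_f_le: "(\<Sum>t\<in>{1..n}. f t) \<le> r"
  unfolding r_def by (rule sum_le_suminf) (auto simp: summable_f f_nonneg)

lemma sum_f_tendsto: "(\<lambda>n. \<Sum>t\<in>{1..n}. f t) \<longlonglongrightarrow> r"
proof -
  have "(\<lambda>n. \<Sum>t<Suc n. f t) \<longlonglongrightarrow> r"
    unfolding r_def by (rule LIMSEQ_Suc[OF summable_LIMSEQ[OF summable_f]])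
  moreover have "(\<Sum>t<Suc n. f t) = (\<Sum>t\<in>{1..n}. f t)" for n
  proof -
    have "{..<Suc n} = insert 0 {1..n}" by auto
    then show ?thesis by (simp del: sum.lessThan_Suc)
  qed
  ultimately show ?thesis by simp
qed

lemma no_return_ge: "1 - r \<le> no_return n"
  using sum_f_le by (simp add: no_return_eq)

lemma no_return_le_1: "no_return n \<le> 1"
  by (simp add: no_return_eq sum_nonneg f_nonneg)

lemma no_return_tendsto: "no_return \<longlonglongrightarrow> 1 - r"
  unfolding no_return_eq[abs_def] by (intro tendsto_diff tendsto_const sum_f_tendsto)

lemma renewal: "0 < n \<Longrightarrow> p n 0 = (\<Sum>t\<in>{1..n}. f t * p (n - t) 0)"
proof -
  assume n: "0 < n"
  have "p n 0 = (\<Sum>t\<in>{1..n}. avg U t (\<lambda>v. of_bool (first_return v) *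
      avg U (n - t) (\<lambda>w. of_bool (sum_list (v @ w) = 0))))"
    unfolding step_prob_def
  proof (rule avg_first_return)
    fix w :: "(int ^ 'd) list" assume "w \<in> words U n" "\<forall>t\<in>{1..n}. sum_list (take t w) \<noteq> 0"
    moreover have "n \<in> {1..n}" using n by simp
    ultimately have "sum_list (take n w) \<noteq> 0" by blast
    moreover have "take n w = w" using \<open>w \<in> words U n\<close> by (simp add: length_words)
    ultimately show "of_bool (sum_list w = 0) = (0 :: real)" by simp
  qed simp
  also have "\<dots> = (\<Sum>t\<in>{1..n}. avg U t (\<lambda>v. of_bool (first_return v) * p (n - t) 0))"
    unfolding step_prob_def by (intro sum.cong avg_cong refl) (simp add: first_return_def)
  finally show ?thesis by (simp add: avg_multc f_def)
qed

text \<open>Summing the renewal equation as a Cauchy product gives \<open>r * G 0 = G 0 - 1\<close>.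
  As \<open>G 0\<close> is a finite number, this forces transience.\<close>

lemma G_eq: "G 0 = 1 / (1 - r)" and r_less_1: "r < 1"
proof -
  have "(\<lambda>n. \<Sum>t\<le>n. f t * p (n - t) 0) sums (r * G 0)"
    unfolding r_def G_def
    by (intro Cauchy_product_sums) (simp_all add: summable_f summable_p f_nonneg p_nonneg)
  moreover have "(\<Sum>t\<le>n. f t * p (n - t) 0) = p n 0 - of_bool (n = 0)" for n
  proof -
    have "{..n} = insert 0 {1..n}" by auto
    then show ?thesis using renewal[of n] by (cases "n = 0") (simp_all add: p_0)
  qed
  moreover have "(\<lambda>n. p n 0 - of_bool (n = 0)) sums (G 0 - 1)"
    unfolding G_def by (intro sums_diff summable_sums summable_p) (use sums_single[of 0 "\<lambda>_. 1 :: real"] in \<open>simp add: of_bool_def\<close>)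
  ultimately have "r * G 0 = G 0 - 1"
    using sums_unique2 by simp
  then have *: "G 0 * (1 - r) = 1" by (simp add: algebra_simps)
  then show "G 0 = 1 / (1 - r)" by (metis mult_zero_right nonzero_eq_divide_eq zero_neq_one)
  show "r < 1" using * G_ge_1 by (smt (verit) mult_nonneg_nonpos)
qed

lemma r_pos: "0 < r"
proof -
  let ?e = "axis undefined 1 :: int ^ 'd"
  have e: "?e \<in> U" by (simp add: unit_steps_def)
  have "first_return [?e, - ?e]"
    by (auto simp: first_return_def take_Cons' axis_eq_0_iff)
  then have "0 < f 2"
    unfolding f_def using e uminus_unit_steps[OF e]
    by (intro avg_pos[of _ "[?e, - ?e]"]) (auto simp: words_def)
  also have "f 2 \<le> (\<Sum>t\<in>{1..2}. f t)" by (rule member_le_sum) (auto simp: f_nonneg)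
  also have "\<dots> \<le> r" by (rule sum_f_le)
  finally show ?thesis .
qed

section \<open>Tails of the number of visits to the origin\<close>

definition count_tail :: "nat \<Rightarrow> nat \<Rightarrow> real" where
  "count_tail h j = avg U h (\<lambda>w. of_bool (j < count_list (path 0 w) 0))"

definition late_tail :: "nat \<Rightarrow> nat \<Rightarrow> nat \<Rightarrow> real" where
  "late_tail h s j = avg U h (\<lambda>w. of_bool (j < count_list (path 0 w) 0 \<and> 0 \<in> set (drop s (path 0 w))))"

lemma late_tail_nonneg: "0 \<le> late_tail h s j"
  by (simp add: late_tail_def avg_nonneg)

lemma count_tail_eq_late_tail: "count_tail h j = late_tail h 0 j"
  unfolding count_tail_def late_tail_def
  by (intro avg_cong) (use count_list_0_iff in \<open>force\<close>)

lemma late_tail_le_count_tail: "late_tail h s j \<le> count_tail h j"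
  unfolding count_tail_def late_tail_def by (intro avg_mono) auto

text \<open>The first excursion uses up one visit and moves the late time from \<open>s\<close> to
  \<open>s - t\<close>. Truncation at 0 agrees with this because a late time 0 is met as soon as the
  origin is visited at all. Returns at time \<open>h\<close> are not recorded, hence the range up to
  \<open>h - 1\<close>.\<close>

lemma late_tail_Suc:
  "late_tail h s (Suc j) = (\<Sum>t\<in>{1..h - 1}. f t * late_tail (h - t) (s - t) j)"
proof -
  let ?F = "\<lambda>s j w. of_bool (j < count_list (path 0 w) 0 \<and> (0::int^'d) \<in> set (drop s (path 0 w))) :: real"
  have *: "?F s (Suc j) (v @ w) = ?F (s - t) j w"
    if "v \<in> words U t" "first_return v" for v w t
  proof -
    have "path 0 (v @ w) = path 0 v @ path 0 w"
      using that by (simp add: path_append first_return_def)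
    then have 1: "drop s (path 0 (v @ w)) = drop s (path 0 v) @ drop (s - t) (path 0 w)"
      using length_words[OF that(1)] by simp
    have 2: "count_list (path 0 (v @ w)) 0 = Suc (count_list (path 0 w) 0)"
      using count_path_first_return[OF that(2)] that by (simp add: path_append first_return_def)
    show ?thesis
    proof (cases "s = 0")
      case True
      then show ?thesis unfolding 1 2 using count_list_0_iff[of "path 0 w" "0::int^'d"]
        by auto
    next
      case False
      then have "0 \<notin> set (drop s (path 0 v))" using first_return_no_zero[OF that(2)] by simp
      then show ?thesis unfolding 1 2 by simp
    qed
  qed
  have "late_tail h s (Suc j) = (\<Sum>t\<in>{1..h - 1}. avg U t (\<lambda>v. of_bool (first_return v) *
      avg U (h - t) (\<lambda>w. ?F s (Suc j) (v @ w))))"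
    unfolding late_tail_def
  proof (rule avg_first_return)
    fix w assume w: "w \<in> words U h" "\<forall>t\<in>{1..h - 1}. sum_list (take t w) \<noteq> 0"
    then have "\<not> 1 < count_list (path 0 w) 0"
      using count_path_0_return[of w] by (auto simp: length_words)
    then show "?F s (Suc j) w = 0" by simp
  qed simp
  also have "\<dots> = (\<Sum>t\<in>{1..h - 1}. avg U t (\<lambda>v. of_bool (first_return v) * late_tail (h - t) (s - t) j))"
  proof (intro sum.cong avg_cong refl)
    fix t v assume "v \<in> words U t"
    then show "of_bool (first_return v) * avg U (h - t) (\<lambda>w. ?F s (Suc j) (v @ w))
        = of_bool (first_return v) * late_tail (h - t) (s - t) j"
      using * by (cases "first_return v") (simp_all add: late_tail_def)
  qed
  finally show ?thesis by (simp add: avg_multc f_def)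
qed

lemma count_tail_Suc: "count_tail h (Suc j) = (\<Sum>t\<in>{1..h - 1}. f t * count_tail (h - t) j)"
  by (simp add: count_tail_eq_late_tail late_tail_Suc)

lemma count_tail_le: "count_tail h j \<le> r ^ j"
proof (induction j arbitrary: h)
  case 0
  have "count_tail h 0 \<le> avg U h (\<lambda>_. 1)" unfolding count_tail_def by (rule avg_mono) auto
  then show ?case by simp
next
  case (Suc j)
  have "count_tail h (Suc j) \<le> (\<Sum>t\<in>{1..h - 1}. f t * r ^ j)"
    unfolding count_tail_Suc by (intro sum_mono mult_left_mono Suc f_nonneg)
  also have "\<dots> \<le> r * r ^ j"
    unfolding sum_distrib_right[symmetric] using r_pos by (intro mult_right_mono sum_f_le) simp
  finally show ?case by simp
qed

lemma count_tail_0: "0 < h \<Longrightarrow> count_tail h 0 = 1"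
proof -
  assume h: "0 < h"
  have "count_tail h 0 = avg U h (\<lambda>_. 1)" unfolding count_tail_def
  proof (rule avg_cong)
    fix w assume "w \<in> words U h"
    then have "w \<noteq> []" using h by (auto simp: words_def)
    then show "of_bool (0 < count_list (path 0 w) 0) = (1 :: real)"
      using count_path_0[of w] by simp
  qed
  then show ?thesis by simp
qed

lemma count_tail_mono: "h \<le> k \<Longrightarrow> count_tail h j \<le> count_tail k j"
proof -
  assume "h \<le> k"
  have "count_tail h j = avg U k (\<lambda>w. of_bool (j < count_list (path 0 (take h w)) 0))"
    unfolding count_tail_def using avg_take[OF \<open>h \<le> k\<close>, of "\<lambda>w. of_bool (j < count_list (path 0 w) 0)"] by simp
  also have "\<dots> \<le> count_tail k j" unfolding count_tail_def
  proof (rule avg_mono)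
    fix w :: "(int ^ 'd) list"
    have "count_list (path 0 (take h w)) 0 \<le> count_list (path 0 (take h w @ drop h w)) 0"
      unfolding path_append by simp
    then show "of_bool (j < count_list (path 0 (take h w)) 0) \<le> (of_bool (j < count_list (path 0 w) 0) :: real)"
      by simp
  qed
  finally show ?thesis .
qed

text \<open>Let each of the first \<open>j\<close> excursions have length at most \<open>m\<close>:
  they end by time \<open>j * m\<close>, and the extra step records the last visit.\<close>

lemma count_tail_lower: "(\<Sum>t\<in>{1..m}. f t) ^ j \<le> count_tail (Suc (j * m)) j"
proof (induction j)
  case 0
  then show ?case by (simp add: count_tail_0)
next
  case (Suc j)
  have "(\<Sum>t\<in>{1..m}. f t) ^ Suc j \<le> (\<Sum>t\<in>{1..m}. f t) * count_tail (Suc (j * m)) j"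
    using Suc by (auto intro!: mult_left_mono sum_nonneg f_nonneg)
  also have "\<dots> \<le> (\<Sum>t\<in>{1..m}. f t * count_tail (Suc (Suc j * m) - t) j)"
    unfolding sum_distrib_right by (intro sum_mono mult_left_mono f_nonneg count_tail_mono) auto
  also have "\<dots> \<le> (\<Sum>t\<in>{1..Suc (Suc j * m) - 1}. f t * count_tail (Suc (Suc j * m) - t) j)"
    by (intro sum_mono2) (auto simp: f_nonneg count_tail_def avg_nonneg)
  also have "\<dots> = count_tail (Suc (Suc j * m)) (Suc j)" by (rule count_tail_Suc[symmetric])
  finally show ?case .
qed

text \<open>Bounds both the fourth-root moment of the return time, through
  \<open>f t \<le> p t 0\<close>, and the weighted mean number of late visits.\<close>

definition \<mu> :: real where "\<mu> = (\<Sum>t. fourth_root t * p t 0)"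

lemma \<mu>_nonneg: "0 \<le> \<mu>"
  unfolding \<mu>_def by (intro suminf_nonneg summable_fourth_root_p mult_nonneg_nonneg fourth_root_nonneg p_nonneg)

lemma sum_le_\<mu>: "finite I \<Longrightarrow> (\<Sum>t\<in>I. fourth_root t * p t 0) \<le> \<mu>"
  unfolding \<mu>_def
  by (intro sum_le_suminf summable_fourth_root_p) (auto intro!: mult_nonneg_nonneg fourth_root_nonneg p_nonneg)

text \<open>Union bound over the time of a late visit; the weight is monotone, so \<open>s\<close>
  may be replaced by that time.\<close>

lemma late_tail_0_le: "fourth_root s * late_tail h s 0 \<le> \<mu>"
proof -
  have "late_tail h s 0 \<le> avg U h (\<lambda>w. \<Sum>t\<in>{s..<h}. of_bool (sum_list (take t w) = 0))"
    unfolding late_tail_def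
  proof (rule avg_mono)
    fix w :: "(int ^ 'd) list" assume w: "w \<in> words U h"
    show "of_bool (0 < count_list (path 0 w) 0 \<and> 0 \<in> set (drop s (path 0 w)))
        \<le> (\<Sum>t\<in>{s..<h}. of_bool (sum_list (take t w) = 0) :: real)"
    proof (cases "0 \<in> set (drop s (path 0 w))")
      case True
      then obtain i where "i < h - s" "drop s (path 0 w) ! i = 0"
        using length_words[OF w] by (auto simp: in_set_conv_nth)
      then have "s + i \<in> {s..<h}" "sum_list (take (s + i) w) = 0"
        using length_words[OF w] by (auto simp: nth_path)
      then have "of_bool (sum_list (take (s + i) w) = 0) \<le> (\<Sum>t\<in>{s..<h}. of_bool (sum_list (take t w) = 0) :: real)"
        by (intro member_le_sum) auto
      then show ?thesis using \<open>sum_list (take (s + i) w) = 0\<close> by (auto simp: of_bool_def split: if_splits)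
    qed (simp add: sum_nonneg)
  qed
  also have "\<dots> = (\<Sum>t\<in>{s..<h}. p t 0)"
    unfolding avg_sum step_prob_def
    by (intro sum.cong refl avg_take[of _ h "\<lambda>v. of_bool (sum_list v = 0)"]) auto
  finally have "fourth_root s * late_tail h s 0 \<le> (\<Sum>t\<in>{s..<h}. fourth_root s * p t 0)"
    unfolding sum_distrib_left[symmetric] by (intro mult_left_mono fourth_root_nonneg)
  also have "\<dots> \<le> (\<Sum>t\<in>{s..<h}. fourth_root t * p t 0)"
    by (intro sum_mono mult_right_mono p_nonneg fourth_root_mono) auto
  also have "\<dots> \<le> \<mu>" by (rule sum_le_\<mu>) simp
  finally show ?thesis .
qed

text \<open>Subadditivity of the weight distributes the time \<open>s\<close> of a late visit over the first \<open>j\<close>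
  excursions and the time after them, so that only one of these has to be long.\<close>

lemma late_tail_le_aux: "fourth_root s * late_tail h s j \<le> \<mu> * (r ^ j * (1 + real j / r))"
proof (induction j arbitrary: h s)
  case 0
  then show ?case using late_tail_0_le by simp
next
  case (Suc j)
  let ?B = "\<mu> * (r ^ j * (1 + real j / r))"
  have B: "0 \<le> ?B" using \<mu>_nonneg r_pos by simp
  have "fourth_root s * late_tail h s (Suc j)
      = (\<Sum>t\<in>{1..h - 1}. f t * (fourth_root s * late_tail (h - t) (s - t) j))"
    by (simp add: late_tail_Suc sum_distrib_left algebra_simps)
  also have "\<dots> \<le> (\<Sum>t\<in>{1..h - 1}. f t * (fourth_root t * r ^ j + ?B))"
  proof (intro sum_mono mult_left_mono f_nonneg)
    fix t
    have "fourth_root s * late_tail (h - t) (s - t) j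
       \<le> (fourth_root t + fourth_root (s - t)) * late_tail (h - t) (s - t) j"
      by (intro mult_right_mono fourth_root_subadd late_tail_nonneg)
    also have "\<dots> = fourth_root t * late_tail (h - t) (s - t) j + fourth_root (s - t) * late_tail (h - t) (s - t) j"
      by (simp add: algebra_simps)
    also have "\<dots> \<le> fourth_root t * r ^ j + ?B"
      by (intro add_mono mult_left_mono Suc order_trans[OF late_tail_le_count_tail count_tail_le] fourth_root_nonneg)
    finally show "fourth_root s * late_tail (h - t) (s - t) j \<le> fourth_root t * r ^ j + ?B" .
  qed
  also have "\<dots> = (\<Sum>t\<in>{1..h - 1}. fourth_root t * f t) * r ^ j + (\<Sum>t\<in>{1..h - 1}. f t) * ?B"
  proof -
    have "(\<Sum>t\<in>I. f t * (fourth_root t * a + b)) = (\<Sum>t\<in>I. fourth_root t * f t) * a + (\<Sum>t\<in>I. f t) * b"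
      for I a b by (simp add: sum_distrib_left sum_distrib_right sum.distrib algebra_simps)
    then show ?thesis .
  qed
  also have "\<dots> \<le> \<mu> * r ^ j + r * ?B"
  proof (intro add_mono mult_right_mono sum_f_le B)
    have "(\<Sum>t\<in>{1..h - 1}. fourth_root t * f t) \<le> (\<Sum>t\<in>{1..h - 1}. fourth_root t * p t 0)"
      by (intro sum_mono mult_left_mono f_le_p fourth_root_nonneg)
    also have "\<dots> \<le> \<mu>" by (rule sum_le_\<mu>) simp
    finally show "(\<Sum>t\<in>{1..h - 1}. fourth_root t * f t) \<le> \<mu>" .
  qed (use r_pos in simp)
  also have "\<dots> = \<mu> * (r ^ Suc j * (1 + real (Suc j) / r))"
    using r_pos by (simp add: field_simps)
  finally show ?case .
qed

definition late_const :: real where "late_const = \<mu> / r"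

lemma late_const_nonneg: "0 \<le> late_const"
  using \<mu>_nonneg r_pos by (simp add: late_const_def)

lemma late_tail_le: "fourth_root s * late_tail h s j \<le> late_const * ((1 + real j) * r ^ j)"
proof -
  have "1 + real j / r \<le> (1 + real j) / r"
    using r_pos r_less_1 by (simp add: field_simps)
  then have "\<mu> * (r ^ j * (1 + real j / r)) \<le> \<mu> * (r ^ j * ((1 + real j) / r))"
    using \<mu>_nonneg r_pos by (intro mult_left_mono) auto
  also have "\<mu> * (r ^ j * ((1 + real j) / r)) = late_const * ((1 + real j) * r ^ j)"
    by (simp add: late_const_def)
  finally show ?thesis
    using late_tail_le_aux[of s h j] by linarith
qed

text \<open>Over a long horizon the tail comes close to \<open>r ^ j\<close> by
  \<open>count_tail_lower\<close>. A walk that reaches more than \<open>j\<close> visits there but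
  not within \<open>g\<close> steps visits the origin at or after time \<open>g\<close>, and the
  bound for this does not depend on the horizon.\<close>

lemma count_tail_ge:
  assumes "0 < g"
  shows "r ^ j - late_const * ((1 + real j) * r ^ j) / fourth_root g \<le> count_tail g j"
proof -
  let ?b = "late_const * ((1 + real j) * r ^ j) / fourth_root g"
  have pos: "0 < fourth_root g" using assms by (simp add: fourth_root_def)
  have "(\<Sum>t\<in>{1..m}. f t) ^ j \<le> count_tail g j + ?b" for m
  proof -
    let ?k = "Suc (j * m)"
    have "(\<Sum>t\<in>{1..m}. f t) ^ j \<le> count_tail (g + ?k) j"
      by (rule order_trans[OF count_tail_lower count_tail_mono]) simp
    also have "\<dots> \<le> avg U (g + ?k) (\<lambda>w. of_bool (j < count_list (path 0 (take g w)) 0)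
        + of_bool (j < count_list (path 0 w) 0 \<and> 0 \<in> set (drop g (path 0 w))))"
      unfolding count_tail_def
    proof (rule avg_mono)
      fix w :: "(int ^ 'd) list"
      have "path 0 w = take g (path 0 w) @ drop g (path 0 w)" by simp
      then have "count_list (path 0 w) 0 = count_list (path 0 (take g w)) 0 + count_list (drop g (path 0 w)) 0"
        by (metis count_list_append take_path)
      then show "of_bool (j < count_list (path 0 w) 0) \<le> of_bool (j < count_list (path 0 (take g w)) 0)
        + (of_bool (j < count_list (path 0 w) 0 \<and> 0 \<in> set (drop g (path 0 w))) :: real)"
        by (cases "0 \<in> set (drop g (path 0 w))") (auto simp: count_list_0_iff[symmetric])
    qed
    also have "\<dots> = count_tail g j + late_tail (g + ?k) g j"
      unfolding avg_add late_tail_def count_tail_def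
      using avg_take[of g "g + ?k" "\<lambda>w. of_bool (j < count_list (path 0 w) 0)"] by simp
    also have "\<dots> \<le> count_tail g j + ?b"
      using late_tail_le[of g "g + ?k" j] pos by (simp add: field_simps)
    finally show ?thesis .
  qed
  then have "r ^ j \<le> count_tail g j + ?b"
    by (intro LIMSEQ_le_const2[OF tendsto_power[OF sum_f_tendsto]]) auto
  then show ?thesis by simp
qed

section \<open>Exponential moments of the visits to two sites\<close>

text \<open>The function \<open>\<psi> z = 1 + c * (G (z - x) + G (z - y))\<close> loses exactly
  \<open>c\<close> under averaging at \<open>x\<close> and at \<open>y\<close>, which pays for the
  factor \<open>l\<close> there. The value of \<open>c\<close> gives equality in the worst case
  \<open>G (x - y) = G 0 - 1\<close>; the upper bound on \<open>l\<close> makes its denominator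
  positive.\<close>

lemma two_point_bound:
  fixes x y :: "int ^ 'd"
  assumes "x \<noteq> y" and l: "1 \<le> l" "2 * r * l < 1 + r"
  defines "c \<equiv> (l - 1) / (l - (l - 1) * (2 * G 0 - 1))"
  shows "avg U h (\<lambda>w. l ^ (count_list (path z w) x + count_list (path z w) y)) \<le> 1 + c * (G (z - x) + G (z - y))"
    and "0 \<le> c"
proof -
  define D where "D = l - (l - 1) * (2 * G 0 - 1)"
  have "G 0 * (1 - r) = 1" using r_less_1 by (simp add: G_eq)
  then have g: "(2 * G 0 - 1) * (1 - r) = 1 + r" by (simp add: algebra_simps)
  have "D * (1 - r) = l * (1 - r) - (l - 1) * ((2 * G 0 - 1) * (1 - r))"
    by (simp add: D_def algebra_simps)
  also have "\<dots> = l * (1 - r) - (l - 1) * (1 + r)" unfolding g ..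
  also have "\<dots> = 1 + r - 2 * r * l" by (simp add: algebra_simps)
  finally have "0 < D * (1 - r)" using l by simp
  then have D: "0 < D" using r_less_1 by (simp add: zero_less_mult_iff)
  have c: "c * D = l - 1" "0 \<le> c" using D l by (auto simp: c_def D_def)
  show "0 \<le> c" by (rule c)
  have one: "l * (1 + c * (G 0 - 1 + g)) \<le> 1 + c * (G 0 + g)" if "g \<le> G 0 - 1" for g
  proof -
    have "(l - 1) * (G 0 + g) \<le> (l - 1) * (2 * G 0 - 1)"
      using l that by (intro mult_left_mono) auto
    then have "(l - 1) * (G 0 + g) - l \<le> - D" by (simp add: D_def)
    then have "c * ((l - 1) * (G 0 + g) - l) \<le> c * (- D)" using c by (intro mult_left_mono)
    then show ?thesis using c by (simp add: algebra_simps)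
  qed
  define \<psi> where "\<psi> z = 1 + c * (G (z - x) + G (z - y))" for z
  have mean: "(\<Sum>u\<in>U. \<psi> (z + u)) / card U = 1 + c * (G (z - x) - of_bool (z = x) + G (z - y) - of_bool (z = y))" for z
  proof -
    have m: "(\<Sum>u\<in>U. G (z + u - a)) / card U = G (z - a) - of_bool (z = a)" for a
      using G_harmonic[of "z - a"] by (simp add: diff_add_eq)
    have "(\<Sum>u\<in>U. \<psi> (z + u)) / card U
        = 1 + c * ((\<Sum>u\<in>U. G (z + u - x)) / card U + (\<Sum>u\<in>U. G (z + u - y)) / card U)"
      using card_U_pos by (simp add: \<psi>_def sum.distrib sum_distrib_left[symmetric] add_divide_distrib distrib_left)
    then show ?thesis by (simp add: m)
  qed
  \<comment> \<open>The supermartingale inequality: the multiplier \<open>l\<close> at the two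
    marked sites is absorbed by the drop of the mean of \<open>\<psi>\<close>.\<close>
  have super: "l ^ (of_bool (z = x) + of_bool (z = y)) * ((\<Sum>u\<in>U. \<psi> (z + u)) / card U) \<le> \<psi> z" for z
  proof -
    consider "z = x" | "z = y" "z \<noteq> x" | "z \<noteq> x" "z \<noteq> y" by blast
    then show ?thesis
    proof cases
      case 1
      then show ?thesis using one[OF G_le[of "x - y"]] assms(1) unfolding mean by (simp add: \<psi>_def)
    next
      case 2
      then show ?thesis using one[OF G_le[of "y - x"]] assms(1) unfolding mean by (simp add: \<psi>_def algebra_simps)
    next
      case 3
      then show ?thesis unfolding mean by (simp add: \<psi>_def)
    qed
  qed
  have "avg U h (\<lambda>w. l ^ (count_list (path z w) x + count_list (path z w) y)) \<le> \<psi> z"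
  proof (induction h arbitrary: z)
    case 0
    then show ?case using c by (simp add: \<psi>_def G_nonneg)
  next
    case (Suc h)
    let ?K = "\<lambda>z w. l ^ (count_list (path z w) x + count_list (path z w) y)"
    have "?K z (u # w) = l ^ (of_bool (z = x) + of_bool (z = y)) * ?K (z + u) w" for u w
      by (simp add: power_add[symmetric])
    then have "avg U (Suc h) (?K z) = l ^ (of_bool (z = x) + of_bool (z = y)) * ((\<Sum>u\<in>U. avg U h (?K (z + u))) / card U)"
      by (simp add: avg_Suc avg_cmult sum_distrib_left del: path.simps)
    also have "\<dots> \<le> l ^ (of_bool (z = x) + of_bool (z = y)) * ((\<Sum>u\<in>U. \<psi> (z + u)) / card U)"
      using l by (intro mult_left_mono divide_right_mono sum_mono Suc) auto
    also have "\<dots> \<le> \<psi> z" by (rule super)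
    finally show ?case .
  qed
  then show "avg U h (\<lambda>w. l ^ (count_list (path z w) x + count_list (path z w) y)) \<le> 1 + c * (G (z - x) + G (z - y))"
    by (simp add: \<psi>_def)
qed

definition two_point_const :: "real \<Rightarrow> real" where
  "two_point_const l = 1 + 2 * G 0 * ((l - 1) / (l - (l - 1) * (2 * G 0 - 1)))"

lemma two_point_const_nonneg:
  assumes "1 \<le> l" "2 * r * l < 1 + r"
  shows "0 \<le> two_point_const l"
  unfolding two_point_const_def
  using two_point_bound(2)[of "axis undefined 1" 0 l] assms G_nonneg[of 0]
  by (intro add_nonneg_nonneg mult_nonneg_nonneg) (auto simp: axis_eq_0_iff)

lemma two_point_le:
  assumes "x \<noteq> y" "1 \<le> l" "2 * r * l < 1 + r"
  shows "avg U h (\<lambda>w. l ^ (count_list (path z w) x + count_list (path z w) y)) \<le> two_point_const l"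
proof -
  define c where "c = (l - 1) / (l - (l - 1) * (2 * G 0 - 1))"
  have "c * (G (z - x) + G (z - y)) \<le> c * (2 * G 0)"
    using two_point_bound(2)[OF assms] G_le_G0[of "z - x"] G_le_G0[of "z - y"]
    by (intro mult_left_mono) (auto simp: c_def)
  then show ?thesis
    using two_point_bound(1)[OF assms, of h z] by (simp add: two_point_const_def c_def algebra_simps)
qed

end

section \<open>Block estimates\<close>

text \<open>The first two Bonferroni inequalities in product form, proved together because the upper
  bound for an added factor uses the lower bound for the others. The pairs are ordered, which
  doubles the sharp term.\<close>

lemma prod_one_minus_bounds:
  fixes b :: "'b \<Rightarrow> real"
  assumes "finite A" "\<And>x. x \<in> A \<Longrightarrow> 0 \<le> b x \<and> b x \<le> 1"
  shows "1 - sum b A \<le> (\<Prod>x\<in>A. 1 - b x)"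
    and "(\<Prod>x\<in>A. 1 - b x) \<le> 1 - sum b A + (\<Sum>x\<in>A. \<Sum>y\<in>A - {x}. b x * b y)"
proof -
  let ?C = "\<lambda>A. 1 - sum b A \<le> (\<Prod>x\<in>A. 1 - b x)
    \<and> (\<Prod>x\<in>A. 1 - b x) \<le> 1 - sum b A + (\<Sum>x\<in>A. \<Sum>y\<in>A - {x}. b x * b y)"
  have "?C A"
    using assms
  proof (induction A rule: finite_induct)
  case empty
  show ?case by simp
next
  case (insert z A)
  let ?P = "\<Prod>x\<in>A. 1 - b x" and ?S = "sum b A" and ?T = "\<Sum>x\<in>A. \<Sum>y\<in>A - {x}. b x * b y"
  have z: "0 \<le> b z" "b z \<le> 1" using insert.prems by auto
  have A: "\<And>x. x \<in> A \<Longrightarrow> 0 \<le> b x \<and> b x \<le> 1" using insert.prems by auto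
  have S: "0 \<le> ?S" using A by (auto intro: sum_nonneg)
  have T: "0 \<le> ?T" using A by (auto intro!: sum_nonneg mult_nonneg_nonneg)
  have P: "?P \<le> 1" using A by (intro prod_le_1) auto
  have eq: "(\<Prod>x\<in>insert z A. 1 - b x) = ?P - b z * ?P"
    using insert.hyps by (simp add: algebra_simps)
  have "b z * ?P \<le> b z * 1" using z P by (intro mult_left_mono) auto
  then have lower: "1 - sum b (insert z A) \<le> (\<Prod>x\<in>insert z A. 1 - b x)"
    unfolding eq using insert.IH[OF A] insert.hyps by simp
  have "b z * (1 - ?S) \<le> b z * ?P" using z insert.IH[OF A] by (intro mult_left_mono) auto
  then have "(\<Prod>x\<in>insert z A. 1 - b x) \<le> 1 - sum b (insert z A) + (?T + b z * ?S)"
    unfolding eq using insert.IH[OF A] insert.hyps by (simp add: algebra_simps)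
  also have "?T + b z * ?S \<le> (\<Sum>x\<in>insert z A. \<Sum>y\<in>insert z A - {x}. b x * b y)"
  proof -
    have "?T \<le> (\<Sum>x\<in>A. \<Sum>y\<in>insert z A - {x}. b x * b y)"
      using A z insert.hyps by (intro sum_mono sum_mono2) (auto intro!: mult_nonneg_nonneg)
    moreover have "insert z A - {z} = A" using insert.hyps by auto
    ultimately show ?thesis using insert.hyps by (simp add: sum_distrib_left)
  qed
  finally show ?case using lower by simp
qed
  then show "1 - sum b A \<le> (\<Prod>x\<in>A. 1 - b x)"
    and "(\<Prod>x\<in>A. 1 - b x) \<le> 1 - sum b A + (\<Sum>x\<in>A. \<Sum>y\<in>A - {x}. b x * b y)"
    by auto
qed

section \<open>Products and sums over the visited sites\<close>

text \<open>With \<open>g\<close> the indicator of \<open>i \<le> k\<close> this says that the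
  maximal local time is at most \<open>k\<close>; with \<open>g i\<close> the distribution function
  of a Gamma variable of shape \<open>i\<close> it is the corresponding probability given the
  walk.\<close>

definition occ_prod :: "(nat \<Rightarrow> real) \<Rightarrow> 'b list \<Rightarrow> real" where
  "occ_prod g l = (\<Prod>x\<in>set l. g (count_list l x))"

lemma occ_prod_map: "inj \<phi> \<Longrightarrow> occ_prod g (map \<phi> l) = occ_prod g l"
  unfolding occ_prod_def
  by (simp add: prod.reindex inj_on_subset[of \<phi> UNIV] count_list_map_conv)

lemma occ_prod_path:
  fixes z :: "'b::group_add"
  shows "occ_prod g (path z w) = occ_prod g (path 0 w)"
  using path_shift[of z 0 w] by (simp add: occ_prod_map inj_def)

lemma occ_prod_superset:
  assumes "g 0 = 1" "finite A" "set l \<subseteq> A"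
  shows "occ_prod g l = (\<Prod>x\<in>A. g (count_list l x))"
  unfolding occ_prod_def using assms
  by (intro prod.mono_neutral_left) (auto simp: count_list_0_iff[THEN iffD2])

text \<open>\<open>X\<close> collects the sites already met, so a letter counts only when it is new.
  Each site is thus charged to its first occurrence, from which on all its visits lie in the
  remaining list.\<close>

lemma sum_set_first_index_aux:
  "(\<Sum>y\<in>set l - X. F y (count_list l y))
   = (\<Sum>i<length l. of_bool (l ! i \<notin> X \<union> set (take i l)) * F (l ! i) (count_list (drop i l) (l ! i)) :: real)"
proof (induction l arbitrary: X)
  case (Cons x l)
  have c: "(\<Sum>y\<in>set l - insert x X. F y (count_list (x # l) y)) = (\<Sum>y\<in>set l - insert x X. F y (count_list l y))"
    by (intro sum.cong) auto
  have e: "(\<Sum>i<length (x # l). of_bool ((x # l) ! i \<notin> X \<union> set (take i (x # l))) * F ((x # l) ! i) (count_list (drop i (x # l)) ((x # l) ! i)))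
    = of_bool (x \<notin> X) * F x (count_list (x # l) x)
      + (\<Sum>y\<in>set l - insert x X. F y (count_list l y))"
    unfolding length_Cons sum.lessThan_Suc_shift Cons.IH[of "insert x X"] by simp
  show ?case
  proof (cases "x \<in> X")
    case True
    then have "set (x # l) - X = set l - insert x X" by auto
    then show ?thesis unfolding e \<open>_ = set l - insert x X\<close> c using True by (simp del: count_list.simps)
  next
    case False
    then have "set (x # l) - X = insert x (set l - insert x X)" by auto
    moreover have "(\<Sum>y\<in>insert x (set l - insert x X). F y (count_list (x # l) y))
        = F x (count_list (x # l) x) + (\<Sum>y\<in>set l - insert x X. F y (count_list (x # l) y))"
      by (rule sum.insert) auto
    ultimately show ?thesis unfolding e c using False by (simp del: count_list.simps)
  qed
qed simp

lemma sum_set_first_index: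
  "(\<Sum>y\<in>set l. F y (count_list l y))
   = (\<Sum>i<length l. of_bool (l ! i \<notin> set (take i l)) * F (l ! i) (count_list (drop i l) (l ! i)) :: real)"
  using sum_set_first_index_aux[where X = "{}" and l = l and F = F] by simp

text \<open>A crude container for the paths of \<open>n\<close> steps: only its polynomial size
  enters.\<close>

definition cube :: "nat \<Rightarrow> (int ^ 'd::finite) set" where
  "cube n = {x. \<forall>i. \<bar>x $ i\<bar> \<le> int n}"

lemma finite_cube: "finite (cube n :: (int ^ 'd::finite) set)"
  and card_cube: "card (cube n :: (int ^ 'd) set) \<le> (2 * n + 1) ^ CARD('d)"
proof -
  let ?P = "PiE UNIV (\<lambda>_::'d. {- int n..int n})"
  have inj: "inj_on (\<lambda>x::int ^ 'd. \<lambda>i. x $ i) (cube n)"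
    by (auto simp: inj_on_def vec_eq_iff fun_eq_iff)
  have sub: "(\<lambda>x i. x $ i) ` (cube n :: (int ^ 'd) set) \<subseteq> ?P"
  proof (rule image_subsetI)
    fix x :: "int ^ 'd" assume x: "x \<in> cube n"
    show "(\<lambda>i. x $ i) \<in> ?P"
      using x by (auto simp: cube_def abs_le_iff minus_le_iff)
  qed
  have fin: "finite ?P" by (intro finite_PiE) auto
  show "finite (cube n :: (int ^ 'd) set)"
    using finite_imageD[OF finite_subset[OF sub fin] inj] .
  have "card (cube n :: (int ^ 'd) set) \<le> card ?P"
    using card_inj_on_le[OF inj sub fin] .
  also have "card ?P = (2 * n + 1) ^ CARD('d)"
    by (simp add: card_PiE nat_add_distrib nat_mult_distrib)
  finally show "card (cube n :: (int ^ 'd) set) \<le> (2 * n + 1) ^ CARD('d)" .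
qed

context lattice
begin

lemma sum_list_in_cube: "set w \<subseteq> U \<Longrightarrow> sum_list w \<in> cube (length w)"
proof (induction w)
  case Nil
  then show ?case by (simp add: cube_def)
next
  case (Cons u w)
  have "\<bar>u $ i\<bar> \<le> 1" for i
    using Cons.prems by (auto simp: unit_steps_def axis_def)
  moreover have "\<bar>sum_list w $ i\<bar> \<le> int (length w)" for i
    using Cons by (simp add: cube_def)
  ultimately have "\<bar>u $ i + sum_list w $ i\<bar> \<le> 1 + int (length w)" for i
    by (meson abs_triangle_ineq add_mono order_trans)
  then show ?case by (simp add: cube_def)
qed

lemma set_path_cube: "w \<in> words U n \<Longrightarrow> set (path 0 w) \<subseteq> cube n"
proof
  fix y assume w: "w \<in> words U n" and "y \<in> set (path 0 w)"
  then obtain i where i: "i < n" "y = sum_list (take i w)"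
    by (auto simp: in_set_path length_words)
  have "set (take i w) \<subseteq> U" using w set_take_subset by (fastforce simp: words_def)
  from sum_list_in_cube[OF this] have "y \<in> cube (length (take i w))" using i by simp
  then have "\<bar>y $ k\<bar> \<le> int i" for k
    using i length_words[OF w] by (simp add: cube_def)
  moreover have "int i \<le> int n" using i by simp
  ultimately show "y \<in> cube n" unfolding cube_def using order_trans by blast
qed

text \<open>The end point is new exactly when no nonempty suffix of the word sums to 0, and these
  suffixes are the reversed prefixes of the reversed word.\<close>

lemma no_return_eq_new_site:
  "avg U n (\<lambda>v. of_bool (sum_list v \<notin> set (path 0 v))) = no_return n"
proof -
  have "no_return n = avg U n (\<lambda>w. of_bool (\<forall>t\<in>{1..n}. sum_list (take t (rev w)) \<noteq> 0))"
    unfolding no_return_def using avg_rev[of U n "\<lambda>w. of_bool (\<forall>t\<in>{1..n}. sum_list (take t w) \<noteq> 0)"] by simp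
  also have "\<dots> = avg U n (\<lambda>v. of_bool (sum_list v \<notin> set (path 0 v)))"
  proof (rule avg_cong)
    fix w assume w: "w \<in> words U n"
    have eq: "sum_list w = sum_list (take k w) + sum_list (drop k w)" for k
      by (metis append_take_drop_id sum_list_append)
    have "(\<forall>t\<in>{1..n}. sum_list (take t (rev w)) \<noteq> 0) \<longleftrightarrow> (\<forall>t\<in>{1..n}. sum_list (drop (n - t) w) \<noteq> 0)"
      using length_words[OF w] by (simp add: take_rev)
    also have "\<dots> \<longleftrightarrow> (\<forall>k<n. sum_list (drop k w) \<noteq> 0)"
    proof safe
      fix k assume "\<forall>t\<in>{1..n}. sum_list (drop (n - t) w) \<noteq> 0" "k < n" "sum_list (drop k w) = 0"
      then show False by (auto dest!: bspec[of _ _ "n - k"])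
    qed (auto dest!: spec)
    also have "\<dots> \<longleftrightarrow> (\<forall>k<n. sum_list w \<noteq> sum_list (take k w))"
      by (metis add_cancel_right_right eq)
    also have "\<dots> \<longleftrightarrow> sum_list w \<notin> set (path 0 w)"
      using length_words[OF w] by (auto simp: in_set_path)
    finally show "of_bool (\<forall>t\<in>{1..n}. sum_list (take t (rev w)) \<noteq> 0) = (of_bool (sum_list w \<notin> set (path 0 w)) :: real)"
      by simp
  qed
  finally show ?thesis by simp
qed

end

text \<open>\<open>1 - (\<Sum>j<k. a j)\<close> is the probability that the local time of a site visited \<open>k\<close> times
  stays below the level, so \<open>q\<close> is the probability that the origin exceeds the level.\<close>

locale level = lattice dim for dim :: "'d::finite itself" +
  fixes a :: "nat \<Rightarrow> real" and q \<kappa> :: real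
  assumes a_nonneg: "0 \<le> a j"
    and a_le_1: "(\<Sum>j<k. a j) \<le> 1"
    and a_submult: "1 - (\<Sum>j<i+k. a j) \<le> (1 - (\<Sum>j<i. a j)) * (1 - (\<Sum>j<k. a j))"
    and q_sums: "(\<lambda>j. a j * r ^ j) sums q"
    and \<kappa>: "(\<Sum>j<k. a j * ((1 + real j) * r ^ j)) \<le> \<kappa> * q"
begin

section \<open>Survival probabilities and concatenation\<close>

definition exceed :: "nat \<Rightarrow> real" where "exceed k = (\<Sum>j<k. a j)"

definition below :: "nat \<Rightarrow> real" where "below k = 1 - exceed k"

text \<open>The survival probability of a block, in which no site exceeds the level.\<close>

definition F :: "nat \<Rightarrow> real" where "F h = avg U h (\<lambda>w. occ_prod below (path 0 w))"

lemma exceed_nonneg: "0 \<le> exceed k"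
  by (simp add: exceed_def sum_nonneg a_nonneg)

lemma exceed_le_1: "exceed k \<le> 1"
  by (simp add: exceed_def a_le_1)

lemma exceed_0 [simp]: "exceed 0 = 0"
  by (simp add: exceed_def)

lemma below_0 [simp]: "below 0 = 1"
  by (simp add: below_def)

lemma below_nonneg: "0 \<le> below k"
  by (simp add: below_def exceed_le_1)

lemma below_le_1: "below k \<le> 1"
  by (simp add: below_def exceed_nonneg)

lemma below_add: "below (i + k) \<le> below i * below k"
  using a_submult by (simp add: below_def exceed_def)

lemma q_nonneg: "0 \<le> q"
  using sums_le[OF _ sums_zero q_sums] a_nonneg r_pos by simp

lemma sum_a_le_q: "(\<Sum>j<h. a j * r ^ j) \<le> q"
  using sum_le_suminf[OF sums_summable[OF q_sums], of "{..<h}"] sums_unique[OF q_sums] a_nonneg r_pos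
  by simp

lemma occ_prod_nonneg: "0 \<le> occ_prod below l"
  unfolding occ_prod_def by (intro prod_nonneg) (simp add: below_nonneg)

lemma occ_prod_le_1: "occ_prod below l \<le> 1"
  unfolding occ_prod_def by (intro prod_le_1) (simp add: below_nonneg below_le_1)

lemma F_nonneg: "0 \<le> F h"
  unfolding F_def by (intro avg_nonneg occ_prod_nonneg)

lemma F_le_1: "F h \<le> 1"
  using avg_mono[of U h "\<lambda>w. occ_prod below (path 0 w)" "\<lambda>_. 1"] by (simp add: F_def occ_prod_le_1)

lemma occ_prod_append_le: "occ_prod below (l @ m) \<le> occ_prod below l * occ_prod below m"
proof -
  let ?A = "set (l @ m)"
  have "occ_prod below (l @ m) \<le> (\<Prod>x\<in>?A. below (count_list l x) * below (count_list m x))"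
    unfolding occ_prod_def by (intro prod_mono) (simp add: below_nonneg below_add)
  also have "\<dots> = occ_prod below l * occ_prod below m"
    unfolding prod.distrib
    by (subst (1 2) occ_prod_superset[where A = ?A]) auto
  finally show ?thesis .
qed

text \<open>The two products differ only in the factors of shared sites, and for factors in
  \<open>[0, 1]\<close> the difference of products is at most the sum of the differences. At a
  shared site it is at most \<open>1 - below\<close> of the joint count.\<close>

lemma occ_prod_append_ge:
  "occ_prod below l * occ_prod below m - (\<Sum>x\<in>set l \<inter> set m. exceed (count_list (l @ m) x)) \<le> occ_prod below (l @ m)"
proof -
  let ?A = "set (l @ m)"
  let ?P = "\<lambda>x. below (count_list l x) * below (count_list m x)" and ?Q = "\<lambda>x. below (count_list (l @ m) x)"
  have "occ_prod below l * occ_prod below m = (\<Prod>x\<in>?A. ?P x)"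
    unfolding prod.distrib
    by (subst (1 2) occ_prod_superset[where A = ?A]) auto
  moreover have "\<bar>(\<Prod>x\<in>?A. ?P x) - (\<Prod>x\<in>?A. ?Q x)\<bar> \<le> (\<Sum>x\<in>?A. \<bar>?P x - ?Q x\<bar>)"
    using norm_prod_diff[of ?A ?P ?Q] by (simp add: below_nonneg below_le_1 mult_le_one)
  moreover have "(\<Sum>x\<in>?A. \<bar>?P x - ?Q x\<bar>) \<le> (\<Sum>x\<in>?A. if x \<in> set l \<inter> set m then exceed (count_list (l @ m) x) else 0)"
  proof (rule sum_mono)
    fix x
    show "\<bar>?P x - ?Q x\<bar> \<le> (if x \<in> set l \<inter> set m then exceed (count_list (l @ m) x) else 0)"
    proof (cases "x \<in> set l \<inter> set m")
      case True
      have "?P x \<le> 1" by (intro mult_le_one below_nonneg below_le_1)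
      then show ?thesis using True below_add[of "count_list l x" "count_list m x"]
        by (simp add: below_def[of "count_list l x + count_list m x"])
    next
      case False
      then have "count_list l x = 0 \<or> count_list m x = 0" by (auto simp: count_list_0_iff)
      then show ?thesis using False by auto
    qed
  qed
  moreover have "(\<Sum>x\<in>?A. if x \<in> set l \<inter> set m then exceed (count_list (l @ m) x) else 0)
     = (\<Sum>x\<in>set l \<inter> set m. exceed (count_list (l @ m) x))"
    by (subst sum.inter_filter[symmetric]) (auto intro!: sum.cong)
  ultimately show ?thesis by (simp add: occ_prod_def)
qed

lemma F_append_le: "F (b + h) \<le> F b * F h"
proof -
  have "F (b + h) \<le> avg U (b + h) (\<lambda>w. occ_prod below (take b (path 0 w)) * occ_prod below (drop b (path 0 w)))"
    unfolding F_def by (intro avg_mono) (metis append_take_drop_id occ_prod_append_le)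
  also have "\<dots> = avg U b (\<lambda>v. occ_prod below (path 0 v) * F h)"
    unfolding avg_append F_def
    by (intro avg_cong) (simp add: path_append length_words avg_cmult occ_prod_path[of _ "sum_list _"])
  finally show ?thesis by (simp add: avg_multc F_def)
qed

lemma F_antimono: "h \<le> k \<Longrightarrow> F k \<le> F h"
proof -
  assume "h \<le> k"
  then have "F k \<le> F h * F (k - h)" using F_append_le[of h "k - h"] by simp
  also have "\<dots> \<le> F h * 1" by (intro mult_left_mono F_le_1 F_nonneg)
  finally show ?thesis by simp
qed

lemma F_mult_le: "F (m * b) \<le> F b ^ m"
proof (induction m)
  case (Suc m)
  have "F (Suc m * b) \<le> F b * F (m * b)" using F_append_le[of b "m * b"] by simp
  also have "\<dots> \<le> F b * F b ^ m" by (intro mult_left_mono Suc F_nonneg)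
  finally show ?case by simp
qed (simp add: F_le_1)

section \<open>Exceedance at the origin\<close>

definition mean_exceed :: "nat \<Rightarrow> real" where
  "mean_exceed h = avg U h (\<lambda>w. exceed (count_list (path 0 w) 0))"

definition late_exceed :: "nat \<Rightarrow> nat \<Rightarrow> real" where
  "late_exceed h s = avg U h (\<lambda>w. exceed (count_list (path 0 w) 0) * of_bool (0 \<in> set (drop s (path 0 w))))"

text \<open>Layer-cake form, which turns the mean of \<open>exceed\<close> at a random count into an
  \<open>a\<close>-weighted sum of the tails of that count.\<close>

lemma exceed_eq: "c \<le> h \<Longrightarrow> exceed c = (\<Sum>j<h. a j * of_bool (j < c))"
proof -
  assume "c \<le> h"
  then have "exceed c = sum a ({..<h} \<inter> {..<c})"
    by (simp add: exceed_def Int_absorb1)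
  also have "\<dots> = (\<Sum>j<h. if j \<in> {..<c} then a j else 0)"
    by (rule sum.inter_restrict) simp
  also have "\<dots> = (\<Sum>j<h. a j * of_bool (j < c))"
    by (intro sum.cong) auto
  finally show ?thesis .
qed

lemma late_exceed_eq: "h \<le> k \<Longrightarrow> late_exceed h s = (\<Sum>j<k. a j * late_tail h s j)"
proof -
  assume hk: "h \<le> k"
  have "late_exceed h s = avg U h (\<lambda>w. \<Sum>j<k. a j * of_bool (j < count_list (path 0 w) 0 \<and> 0 \<in> set (drop s (path 0 w))))"
    unfolding late_exceed_def
  proof (rule avg_cong)
    fix w assume "w \<in> words U h"
    then have "count_list (path 0 w) 0 \<le> k"
      using count_le_length[of "path 0 w" 0] hk by (simp add: length_words)
    from exceed_eq[OF this]
    show "exceed (count_list (path 0 w) 0) * of_bool (0 \<in> set (drop s (path 0 w)))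
       = (\<Sum>j<k. a j * of_bool (j < count_list (path 0 w) 0 \<and> 0 \<in> set (drop s (path 0 w))))"
      by (cases "0 \<in> set (drop s (path 0 w))") simp_all
  qed
  then show ?thesis by (simp only: avg_sum avg_cmult late_tail_def)
qed

lemma mean_exceed_eq_late: "mean_exceed h = late_exceed h 0"
  unfolding mean_exceed_def late_exceed_def
  by (intro avg_cong) (use count_list_0_iff in force)

lemma mean_exceed_eq: "h \<le> k \<Longrightarrow> mean_exceed h = (\<Sum>j<k. a j * count_tail h j)"
  by (simp add: mean_exceed_eq_late late_exceed_eq count_tail_eq_late_tail)

lemma mean_exceed_nonneg: "0 \<le> mean_exceed h"
  by (simp add: mean_exceed_def avg_nonneg exceed_nonneg)

lemma mean_exceed_le: "mean_exceed h \<le> q"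
  using sum_mono[of "{..<h}" "\<lambda>j. a j * count_tail h j" "\<lambda>j. a j * r ^ j"] sum_a_le_q[of h]
  by (simp add: mean_exceed_eq[of h h] mult_left_mono count_tail_le a_nonneg)

lemma mean_exceed_mono: "h \<le> k \<Longrightarrow> mean_exceed h \<le> mean_exceed k"
  by (simp add: mean_exceed_eq[of h k] mean_exceed_eq[of k k])
     (intro sum_mono mult_left_mono count_tail_mono a_nonneg)

text \<open>The factor \<open>1 + real j\<close> in the tail bound counts the places where a long
  stretch can sit, \<open>j\<close> excursions and the time after them; \<open>\<kappa>\<close>
  bounds its weighted mean relative to \<open>q\<close>.\<close>

definition late_error :: "nat \<Rightarrow> real" where
  "late_error s = late_const * \<kappa> * q / fourth_root s"

lemma \<kappa>q_nonneg: "0 \<le> \<kappa> * q"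
  using \<kappa>[of 0] by simp

lemma late_error_nonneg: "0 \<le> late_error s"
  using late_const_nonneg \<kappa>q_nonneg fourth_root_nonneg by (simp add: late_error_def mult.assoc)

lemma late_error_antimono: "0 < s \<Longrightarrow> s \<le> t \<Longrightarrow> late_error t \<le> late_error s"
  unfolding late_error_def using late_const_nonneg \<kappa>q_nonneg fourth_root_mono[of s t]
  by (intro divide_left_mono) (auto simp: mult.assoc fourth_root_def)

lemma late_exceed_le_q: "late_exceed h s \<le> q"
proof -
  have "late_exceed h s \<le> mean_exceed h"
    unfolding late_exceed_def mean_exceed_def by (rule avg_mono) (auto simp: exceed_nonneg)
  then show ?thesis using mean_exceed_le[of h] by simp
qed

lemma late_exceed_le: "0 < s \<Longrightarrow> late_exceed h s \<le> late_error s"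
proof -
  assume s: "0 < s"
  have "fourth_root s * late_exceed h s = (\<Sum>j<h. a j * (fourth_root s * late_tail h s j))"
    by (simp add: late_exceed_eq[of h h] sum_distrib_left algebra_simps)
  also have "\<dots> \<le> (\<Sum>j<h. a j * (late_const * ((1 + real j) * r ^ j)))"
    by (intro sum_mono mult_left_mono late_tail_le a_nonneg)
  also have "\<dots> = late_const * (\<Sum>j<h. a j * ((1 + real j) * r ^ j))"
    by (simp add: sum_distrib_left algebra_simps)
  also have "\<dots> \<le> late_const * (\<kappa> * q)"
    by (intro mult_left_mono \<kappa> late_const_nonneg)
  finally show ?thesis
    using s by (simp add: late_error_def fourth_root_def field_simps)
qed

lemma mean_exceed_ge: "0 < g \<Longrightarrow> q - late_error g \<le> mean_exceed g"
proof -
  assume g: "0 < g"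
  have "(\<Sum>j<k. a j * r ^ j) \<le> mean_exceed g + late_error g" if k: "g \<le> k" for k
  proof -
    have "(\<Sum>j<k. a j * r ^ j) - late_const * (\<Sum>j<k. a j * ((1 + real j) * r ^ j)) / fourth_root g
       = (\<Sum>j<k. a j * (r ^ j - late_const * ((1 + real j) * r ^ j) / fourth_root g))"
      by (simp add: sum_distrib_left sum_divide_distrib sum_subtractf algebra_simps)
    also have "\<dots> \<le> (\<Sum>j<k. a j * count_tail g j)"
      by (intro sum_mono mult_left_mono count_tail_ge g a_nonneg)
    also have "\<dots> = mean_exceed g" using mean_exceed_eq[OF k] by simp
    finally have "(\<Sum>j<k. a j * r ^ j) \<le> mean_exceed g + late_const * (\<Sum>j<k. a j * ((1 + real j) * r ^ j)) / fourth_root g"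
      by simp
    also have "\<dots> \<le> mean_exceed g + late_const * (\<kappa> * q) / fourth_root g"
      by (intro add_left_mono divide_right_mono mult_left_mono \<kappa> late_const_nonneg fourth_root_nonneg)
    finally show ?thesis by (simp add: late_error_def mult.assoc)
  qed
  then have "q \<le> mean_exceed g + late_error g"
    using q_sums by (intro LIMSEQ_le_const2[of "\<lambda>k. \<Sum>j<k. a j * r ^ j"]) (auto simp: sums_def)
  then show ?thesis by simp
qed

text \<open>At time \<open>i\<close> the past decides whether the present site is new, the future
  how often it is visited from now on, and the two are independent.\<close>

lemma avg_sum_exceed:
  "avg U h (\<lambda>w. \<Sum>x\<in>set (path 0 w). exceed (count_list (path 0 w) x))
   = (\<Sum>i<h. no_return i * mean_exceed (h - i))"
proof -
  have "avg U h (\<lambda>w. \<Sum>x\<in>set (path 0 w). exceed (count_list (path 0 w) x))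
     = avg U h (\<lambda>w. \<Sum>i<h. of_bool (path 0 w ! i \<notin> set (take i (path 0 w))) * exceed (count_list (drop i (path 0 w)) (path 0 w ! i)))"
    by (intro avg_cong) (simp add: sum_set_first_index[where F = "\<lambda>_. exceed"] length_words)
  also have "\<dots> = (\<Sum>i<h. no_return i * mean_exceed (h - i))"
    unfolding avg_sum
  proof (rule sum.cong)
    fix i assume "i \<in> {..<h}"
    then have i: "h = i + (h - i)" "i < h" by auto
    let ?E = "\<lambda>w. of_bool (path 0 w ! i \<notin> set (take i (path 0 w))) * exceed (count_list (drop i (path 0 w)) (path 0 w ! i))"
    have "avg U h ?E = avg U (i + (h - i)) ?E" using i by simp
    also have "\<dots> = avg U i (\<lambda>v. of_bool (sum_list v \<notin> set (path 0 v)) * mean_exceed (h - i))"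
      unfolding avg_append
    proof (rule avg_cong)
      fix v assume v: "v \<in> words U i"
      have "avg U (h - i) (\<lambda>w. ?E (v @ w)) = avg U (h - i) (\<lambda>w. of_bool (sum_list v \<notin> set (path 0 v)) * exceed (count_list (path 0 w) 0))"
      proof (rule avg_cong)
        fix w assume w: "w \<in> words U (h - i)"
        have "path 0 (v @ w) ! i = sum_list v"
          using i length_words[OF v] length_words[OF w] by (simp add: nth_path)
        moreover have "take i (path 0 (v @ w)) = path 0 v" "drop i (path 0 (v @ w)) = path (sum_list v) w"
          using length_words[OF v] by (simp_all add: path_append)
        ultimately show "?E (v @ w) = of_bool (sum_list v \<notin> set (path 0 v)) * exceed (count_list (path 0 w) 0)"
          by (simp add: count_list_path_sub[of "sum_list v"])
      qed
      then show "avg U (h - i) (\<lambda>w. ?E (v @ w)) = of_bool (sum_list v \<notin> set (path 0 v)) * mean_exceed (h - i)"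
        by (simp add: avg_cmult mean_exceed_def)
    qed
    finally show "avg U h ?E = no_return i * mean_exceed (h - i)"
      by (simp add: avg_multc no_return_eq_new_site)
  qed simp
  finally show ?thesis .
qed

section \<open>Survival of one block and gluing of blocks\<close>

lemma F_ge: "1 - q * (\<Sum>i<b. no_return i) \<le> F b"
proof -
  have "(\<Sum>i<b. no_return i * mean_exceed (b - i)) \<le> (\<Sum>i<b. no_return i * q)"
    using no_return_ge r_less_1
    by (intro sum_mono mult_left_mono mean_exceed_le) (smt (verit))
  then have "1 - q * (\<Sum>i<b. no_return i) \<le> 1 - (\<Sum>i<b. no_return i * mean_exceed (b - i))"
    by (simp add: sum_distrib_left mult.commute)
  also have "\<dots> = avg U b (\<lambda>w. 1 - (\<Sum>x\<in>set (path 0 w). exceed (count_list (path 0 w) x)))"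
    by (simp add: avg_diff avg_sum_exceed)
  also have "\<dots> \<le> F b"
    unfolding F_def occ_prod_def below_def
    by (intro avg_mono prod_one_minus_bounds) (auto simp: exceed_nonneg exceed_le_1)
  finally show ?thesis .
qed

text \<open>Exponential Chebyshev bound: \<open>A * l ^ k\<close> dominates \<open>exceed k\<close>,
  so two exceedances are controlled by the two-point moment. Extending the sum to the cube makes the
  sites deterministic.\<close>

lemma avg_pairs_le:
  assumes "1 \<le> l" "2 * r * l < 1 + r" "\<And>k. exceed k \<le> A * l ^ k" "0 \<le> A"
  shows "avg U b (\<lambda>w. \<Sum>x\<in>set (path 0 w). \<Sum>y\<in>set (path 0 w) - {x}.
           exceed (count_list (path 0 w) x) * exceed (count_list (path 0 w) y))
     \<le> (real (2 * b + 1) ^ CARD('d))\<^sup>2 * (A\<^sup>2 * two_point_const l)" (is "avg U b ?S \<le> _")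
proof -
  let ?B = "cube b :: (int ^ 'd) set"
  let ?K = "A\<^sup>2 * two_point_const l"
  have K: "0 \<le> ?K" using two_point_const_nonneg[OF assms(1,2)] by simp
  have "avg U b ?S \<le> avg U b (\<lambda>w. \<Sum>x\<in>?B. \<Sum>y\<in>?B - {x}. A\<^sup>2 * l ^ (count_list (path 0 w) x + count_list (path 0 w) y))"
  proof (rule avg_mono)
    fix w assume w: "w \<in> words U b"
    let ?c = "count_list (path 0 w)"
    have "?S w \<le> (\<Sum>x\<in>?B. \<Sum>y\<in>set (path 0 w) - {x}. exceed (?c x) * exceed (?c y))"
      using set_path_cube[OF w] by (intro sum_mono2 finite_cube) (auto intro!: sum_nonneg mult_nonneg_nonneg exceed_nonneg)
    also have "\<dots> \<le> (\<Sum>x\<in>?B. \<Sum>y\<in>?B - {x}. exceed (?c x) * exceed (?c y))"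
      using set_path_cube[OF w]
      by (intro sum_mono sum_mono2 finite_Diff finite_cube) (auto intro!: mult_nonneg_nonneg exceed_nonneg)
    also have "\<dots> \<le> (\<Sum>x\<in>?B. \<Sum>y\<in>?B - {x}. A\<^sup>2 * l ^ (?c x + ?c y))"
    proof (intro sum_mono)
      fix x y
      have "exceed (?c x) * exceed (?c y) \<le> (A * l ^ ?c x) * (A * l ^ ?c y)"
        using assms by (intro mult_mono exceed_nonneg) auto
      then show "exceed (?c x) * exceed (?c y) \<le> A\<^sup>2 * l ^ (?c x + ?c y)"
        by (simp add: power_add power2_eq_square mult_ac)
    qed
    finally show "?S w \<le> (\<Sum>x\<in>?B. \<Sum>y\<in>?B - {x}. A\<^sup>2 * l ^ (?c x + ?c y))" .
  qed
  also have "\<dots> = (\<Sum>x\<in>?B. \<Sum>y\<in>?B - {x}. A\<^sup>2 * avg U b (\<lambda>w. l ^ (count_list (path 0 w) x + count_list (path 0 w) y)))"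
    by (simp add: avg_sum avg_cmult)
  also have "\<dots> \<le> (\<Sum>x\<in>?B. \<Sum>y\<in>?B - {x}. ?K)"
    using assms by (intro sum_mono mult_left_mono two_point_le) auto
  also have "\<dots> \<le> (\<Sum>x\<in>?B. \<Sum>y\<in>?B. ?K)"
    using K by (intro sum_mono sum_mono2 finite_cube) auto
  also have "\<dots> = (real (card ?B))\<^sup>2 * ?K" by (simp add: power2_eq_square)
  also have "\<dots> \<le> (real (2 * b + 1) ^ CARD('d))\<^sup>2 * ?K"
  proof -
    have "real (card ?B) \<le> real (2 * b + 1) ^ CARD('d)"
      using card_cube[where n = b and ?'d = 'd] by (metis of_nat_le_iff of_nat_power)
    then show ?thesis using K by (intro mult_right_mono power_mono) auto
  qed
  finally show ?thesis .
qed

text \<open>Second Bonferroni inequality. First visits in the last \<open>g\<close> steps are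
  discarded, so that every other new site has at least \<open>g\<close> steps left to exceed the
  level.\<close>

lemma F_le:
  assumes "1 \<le> l" "2 * r * l < 1 + r" "\<And>k. exceed k \<le> A * l ^ k" "0 \<le> A" "0 < g" "g \<le> b"
  shows "F b \<le> 1 - (1 - r) * real (b - g) * (q - late_error g) + (real (2 * b + 1) ^ CARD('d))\<^sup>2 * (A\<^sup>2 * two_point_const l)"
proof -
  have "(1 - r) * real (b - g) * (q - late_error g) \<le> (1 - r) * real (b - g) * mean_exceed g"
    using r_less_1 assms by (intro mult_left_mono mean_exceed_ge) auto
  also have "\<dots> = (\<Sum>i<b - g. (1 - r) * mean_exceed g)" by simp
  also have "\<dots> \<le> (\<Sum>i<b - g. no_return i * mean_exceed (b - i))"
    using r_less_1 no_return_ge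
    by (intro sum_mono mult_mono mean_exceed_mono mean_exceed_nonneg) (auto intro: order_trans[of 0 "1 - r"])
  also have "\<dots> \<le> (\<Sum>i<b. no_return i * mean_exceed (b - i))"
    using r_less_1 no_return_ge
    by (intro sum_mono2) (auto intro!: mult_nonneg_nonneg mean_exceed_nonneg intro: order_trans[of 0 "1 - r"])
  finally have *: "(1 - r) * real (b - g) * (q - late_error g) \<le> (\<Sum>i<b. no_return i * mean_exceed (b - i))" .
  let ?T = "\<lambda>w. \<Sum>x\<in>set (path 0 w). \<Sum>y\<in>set (path 0 w) - {x}.
           exceed (count_list (path 0 w) x) * exceed (count_list (path 0 w) y)"
  have "F b \<le> avg U b (\<lambda>w. 1 - (\<Sum>x\<in>set (path 0 w). exceed (count_list (path 0 w) x)) + ?T w)"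
    unfolding F_def occ_prod_def below_def
    by (intro avg_mono prod_one_minus_bounds) (auto simp: exceed_nonneg exceed_le_1)
  also have "\<dots> = 1 - (\<Sum>i<b. no_return i * mean_exceed (b - i)) + avg U b ?T"
    by (simp add: avg_add avg_diff avg_sum_exceed)
  finally show ?thesis using * avg_pairs_le[OF assms(1-4), of b] by linarith
qed

text \<open>Only sites visited on both sides of time \<open>b\<close> spoil independence. Each is
  charged to its first visit \<open>i < b\<close>, after which a visit with delay at least
  \<open>b - i\<close> must follow. Delays of at least \<open>g\<close> cost
  \<open>late_error g\<close>; at most \<open>g\<close> times \<open>i\<close> are closer to
  \<open>b\<close>, and each costs at most \<open>q\<close>.\<close>

lemma F_append_ge:
  assumes "0 < g"
  shows "F b * F h - (real g * q + real b * late_error g) \<le> F (b + h)"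
proof -
  let ?l = "\<lambda>w. take b (path 0 w)" and ?m = "\<lambda>w. drop b (path 0 w)"
  let ?S = "\<lambda>w. \<Sum>x\<in>set (?l w) \<inter> set (?m w). exceed (count_list (path 0 w) x)"
  let ?R = "\<lambda>i w. exceed (count_list (drop i (path 0 w)) (path 0 w ! i)) * of_bool (path 0 w ! i \<in> set (?m w))"
  have S: "?S w \<le> (\<Sum>i<b. ?R i w)" if w: "w \<in> words U (b + h)" for w
  proof -
    let ?p = "path 0 w"
    let ?F = "\<lambda>x c. of_bool (x \<in> set (?l w) \<inter> set (?m w)) * exceed c"
    have "set ?p = set (?l w) \<union> set (?m w)" by (metis append_take_drop_id set_append)
    then have "?S w = (\<Sum>x\<in>set ?p. ?F x (count_list ?p x))"
      by (intro sum.mono_neutral_cong_left) auto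
    also have "\<dots> = (\<Sum>i<b + h. of_bool (?p ! i \<notin> set (take i ?p)) * ?F (?p ! i) (count_list (drop i ?p) (?p ! i)))"
      using sum_set_first_index[where l = ?p and F = ?F] length_words[OF w] by simp
    also have "\<dots> = (\<Sum>i<b. of_bool (?p ! i \<notin> set (take i ?p)) * ?F (?p ! i) (count_list (drop i ?p) (?p ! i)))"
    proof (rule sum.mono_neutral_right)
      show "\<forall>i\<in>{..<b + h} - {..<b}. of_bool (?p ! i \<notin> set (take i ?p)) * ?F (?p ! i) (count_list (drop i ?p) (?p ! i)) = 0"
      proof
        fix i assume "i \<in> {..<b + h} - {..<b}"
        then have "set (?l w) \<subseteq> set (take i ?p)" by (intro set_take_subset_set_take) auto
        then show "of_bool (?p ! i \<notin> set (take i ?p)) * ?F (?p ! i) (count_list (drop i ?p) (?p ! i)) = 0"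
          by auto
      qed
    qed auto
    also have "\<dots> \<le> (\<Sum>i<b. ?R i w)"
      by (intro sum_mono) (auto simp: exceed_nonneg)
    finally show ?thesis .
  qed
  have R: "avg U (b + h) (?R i) = late_exceed (b + h - i) (b - i)" if i: "i < b" for i
  proof -
    have "avg U (b + h) (?R i) = avg U (i + (b + h - i)) (?R i)" using i by simp
    also have "\<dots> = avg U i (\<lambda>v. late_exceed (b + h - i) (b - i))"
      unfolding avg_append late_exceed_def
    proof (intro avg_cong)
      fix v w assume v: "v \<in> words U i" and w: "w \<in> words U (b + h - i)"
      have 1: "path 0 (v @ w) ! i = sum_list v"
        using i length_words[OF v] length_words[OF w] by (simp add: nth_path)
      have 2: "drop i (path 0 (v @ w)) = path (sum_list v) w"
        using length_words[OF v] by (simp add: path_append)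
      have "drop b (path 0 (v @ w)) = drop (b - i) (path (sum_list v + 0) w)"
        using i length_words[OF v] by (simp add: path_append)
      also have "\<dots> = map ((+) (sum_list v)) (drop (b - i) (path 0 w))"
        unfolding path_shift drop_map ..
      finally have "sum_list v \<in> set (drop b (path 0 (v @ w))) \<longleftrightarrow> 0 \<in> set (drop (b - i) (path 0 w))"
        by auto
      then show "?R i (v @ w) = exceed (count_list (path 0 w) 0) * of_bool (0 \<in> set (drop (b - i) (path 0 w)))"
        unfolding 1 2 by (simp add: count_list_path_sub[of "sum_list v"])
    qed
    finally show ?thesis by simp
  qed
  have "(\<Sum>i<b. late_exceed (b + h - i) (b - i)) \<le> (\<Sum>i<b. of_bool (b - i < g) * q + late_error g)"
  proof (rule sum_mono)
    fix i assume "i \<in> {..<b}"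
    then have "late_exceed (b + h - i) (b - i) \<le> late_error g" if "g \<le> b - i"
      using late_exceed_le[of "b - i" "b + h - i"] late_error_antimono[OF assms that] by simp
    then show "late_exceed (b + h - i) (b - i) \<le> of_bool (b - i < g) * q + late_error g"
      using late_exceed_le_q[of "b + h - i" "b - i"] late_error_nonneg[of g]
      by (cases "g \<le> b - i") auto
  qed
  also have "\<dots> = real (card {i\<in>{..<b}. b - i < g}) * q + real b * late_error g"
    by (simp add: sum.distrib sum_distrib_right[symmetric] Int_def)
  also have "\<dots> \<le> real g * q + real b * late_error g"
  proof -
    have "{i\<in>{..<b}. b - i < g} \<subseteq> {b - g..<b}" by auto
    then have "card {i\<in>{..<b}. b - i < g} \<le> card {b - g..<b}" by (intro card_mono) auto
    then have "card {i\<in>{..<b}. b - i < g} \<le> g" by simp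
    then show ?thesis using q_nonneg by (simp add: mult_right_mono)
  qed
  finally have err: "(\<Sum>i<b. late_exceed (b + h - i) (b - i)) \<le> real g * q + real b * late_error g" .
  have "F b * F h = avg U (b + h) (\<lambda>w. occ_prod below (?l w) * occ_prod below (?m w))"
    unfolding avg_append F_def avg_multc[symmetric]
    by (intro avg_cong) (simp add: path_append length_words avg_cmult occ_prod_path[of _ "sum_list _"])
  also have "\<dots> \<le> avg U (b + h) (\<lambda>w. occ_prod below (path 0 w) + (\<Sum>i<b. ?R i w))"
  proof (rule avg_mono)
    fix w assume w: "w \<in> words U (b + h)"
    show "occ_prod below (?l w) * occ_prod below (?m w) \<le> occ_prod below (path 0 w) + (\<Sum>i<b. ?R i w)"
      using occ_prod_append_ge[of "?l w" "?m w"] S[OF w] by simp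
  qed
  also have "\<dots> = F (b + h) + (\<Sum>i<b. late_exceed (b + h - i) (b - i))"
    unfolding avg_add avg_sum F_def using R by (intro arg_cong2[where f = "(+)"] sum.cong) auto
  finally show ?thesis using err by linarith
qed

lemma F_mult_ge:
  assumes "0 < g"
  shows "F b ^ m - real m * (real g * q + real b * late_error g) \<le> F (m * b)"
proof (induction m)
  case 0
  have "F 0 = 1" by (simp add: F_def occ_prod_def)
  then show ?case by simp
next
  case (Suc m)
  let ?e = "real g * q + real b * late_error g"
  have e: "0 \<le> ?e" using q_nonneg late_error_nonneg by simp
  have "F b * (F b ^ m - real m * ?e) \<le> F b * F (m * b)"
    by (intro mult_left_mono Suc F_nonneg)
  moreover have "F b * (real m * ?e) \<le> 1 * (real m * ?e)"
    using e by (intro mult_right_mono F_le_1) auto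
  ultimately show ?case using F_append_ge[OF assms, of b "m * b"]
    by (simp add: algebra_simps)
qed

end

section \<open>Asymptotics of the survival probability\<close>

context lattice
begin

text \<open>The quantity \<open>F\<close> freed from the locale of a fixed level, so that the level
  can vary along a sequence.\<close>

definition survival :: "(nat \<Rightarrow> real) \<Rightarrow> nat \<Rightarrow> real" where
  "survival g h = avg U h (\<lambda>w. occ_prod g (path 0 w))"

lemma no_return_antimono: "i \<le> k \<Longrightarrow> no_return k \<le> no_return i"
  unfolding no_return_eq by (intro diff_left_mono sum_mono2) (auto simp: f_nonneg)

lemma sum_no_return_le: "(\<Sum>i<b. no_return i) \<le> real g + real b * no_return g"
proof -
  have "(\<Sum>i<b. no_return i) \<le> (\<Sum>i<b. of_bool (i < g) + no_return g)"
  proof (rule sum_mono)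
    fix i
    show "no_return i \<le> of_bool (i < g) + no_return g"
      using no_return_antimono[of g i] no_return_le_1[of i] no_return_ge[of g] r_less_1
      by (cases "i < g") auto
  qed
  also have "\<dots> = real (card {i\<in>{..<b}. i < g}) + real b * no_return g"
    by (simp add: sum.distrib Int_def)
  also have "card {i\<in>{..<b}. i < g} \<le> card {..<g}" by (intro card_mono) auto
  finally show ?thesis by simp
qed

end

context level
begin

lemma F_eq_survival: "F h = survival (\<lambda>k. 1 - (\<Sum>j<k. a j)) h"
proof -
  have "below = (\<lambda>k. 1 - (\<Sum>j<k. a j))" by (simp add: below_def exceed_def fun_eq_iff)
  then show ?thesis by (simp add: F_def survival_def)
qed

text \<open>\<open>m\<close> blocks of length \<open>b\<close> fit into \<open>h\<close> and
  \<open>Suc m\<close> cover it, which gives the two directions. The relative errors are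
  \<open>\<beta>\<close> for the incomplete block, \<open>\<eta>\<close> for the gaps and
  \<open>\<zeta>\<close> for late revisits; \<open>\<omega>\<close> bounds the total pair
  error.\<close>

lemma F_bounds:
  fixes b g m h :: nat and C l A \<omega> \<beta> \<eta> \<zeta> :: real
  assumes g: "0 < g" "g \<le> b" and m: "m * b \<le> h" "h \<le> Suc m * b" and h: "0 < h"
    and C: "real h * q \<le> C"
    and \<beta>: "\<beta> = real b / real h" "\<beta> \<le> 1" "\<beta> * C \<le> 1 / 2"
    and \<eta>: "\<eta> = real g / real b"
    and \<zeta>: "\<zeta> = late_const * \<kappa> / fourth_root g" "0 \<le> \<kappa>" "\<zeta> \<le> 1"
    and l: "1 \<le> l" "2 * r * l < 1 + r" and A: "\<And>k. exceed k \<le> A * l ^ k" "0 \<le> A"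
    and \<omega>: "real m * ((real (2 * b + 1) ^ CARD('d))\<^sup>2 * (A\<^sup>2 * two_point_const l)) \<le> \<omega>"
  shows "F h - exp (- (1 - r) * real h * q) \<le> exp (C * (1 - r) * (1 - (1 - \<beta>) * (1 - \<eta>) * (1 - \<zeta>)) + \<omega>) - 1"
    and "- (C * ((1 + \<beta>) * (\<eta> + no_return g) - (1 - r)) + 2 * (1 + \<beta>) * C * (\<beta> * C)) - C * (1 + \<beta>) * (\<eta> + \<zeta>)
       \<le> F h - exp (- (1 - r) * real h * q)"
proof -
  define Y where "Y = real h * q"
  define y where "y = (1 - r) * Y"
  have Y: "0 \<le> Y" "Y \<le> C" using q_nonneg C by (auto simp: Y_def)
  have y: "0 \<le> y" "- (1 - r) * real h * q = - y"
    using Y r_less_1 by (simp add: y_def, simp add: y_def Y_def algebra_simps)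
  have b: "0 < b" using g by simp
  have \<beta>0: "0 \<le> \<beta>" and \<eta>0: "0 \<le> \<eta>" "\<eta> \<le> 1" using \<beta> \<eta> g b by auto
  have \<zeta>0: "0 \<le> \<zeta>" using \<zeta> late_const_nonneg fourth_root_nonneg by auto
  have late: "late_error g = \<zeta> * q" by (simp add: late_error_def \<zeta>)
  have hb: "real h * \<beta> = real b" using \<beta> h by simp
  have bg: "real b * \<eta> = real g" using \<eta> b by simp
  have m1: "real h * (1 - \<beta>) \<le> real m * real b"
    using m(2) hb by (simp add: algebra_simps) (metis of_nat_add of_nat_le_iff of_nat_mult)
  have m2: "real (Suc m) * real b \<le> real h * (1 + \<beta>)"
    using m(1) hb by (simp add: algebra_simps) (metis of_nat_le_iff of_nat_mult)
  let ?P = "(real (2 * b + 1) ^ CARD('d))\<^sup>2 * (A\<^sup>2 * two_point_const l)"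
  define X where "X = (1 - r) * real (b - g) * (q - late_error g) - ?P"
  define D where "D = C * (1 - r) * (1 - (1 - \<beta>) * (1 - \<eta>) * (1 - \<zeta>)) + \<omega>"
  have "F h \<le> F (m * b)" by (rule F_antimono[OF m(1)])
  also have "\<dots> \<le> F b ^ m" by (rule F_mult_le)
  also have "\<dots> \<le> exp (- X) ^ m"
  proof (rule power_mono[OF _ F_nonneg])
    have "F b \<le> 1 + (- X)" using F_le[OF l A g] by (simp add: X_def)
    also have "\<dots> \<le> exp (- X)" by (rule exp_ge_add_one_self)
    finally show "F b \<le> exp (- X)" .
  qed
  also have "\<dots> = exp (- (real m * X))" by (simp add: exp_of_nat_mult[symmetric])
  also have "\<dots> \<le> exp (- y + D)"
  proof (rule exp_le_cancel_iff[THEN iffD2])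
    let ?z = "(1 - \<beta>) * (1 - \<eta>) * (1 - \<zeta>)"
    have z: "0 \<le> ?z" "?z \<le> 1"
      using \<beta> \<beta>0 \<eta>0 \<zeta> \<zeta>0 by (auto intro!: mult_nonneg_nonneg mult_le_one)
    have "real h * (1 - \<beta>) * ((1 - \<eta>) * (1 - \<zeta>)) \<le> real m * real b * ((1 - \<eta>) * (1 - \<zeta>))"
      using m1 \<eta>0 \<zeta> by (intro mult_right_mono) auto
    then have "(1 - r) * q * (real h * (1 - \<beta>) * ((1 - \<eta>) * (1 - \<zeta>))) \<le> (1 - r) * q * (real m * real b * ((1 - \<eta>) * (1 - \<zeta>)))"
      using r_less_1 q_nonneg by (intro mult_left_mono) auto
    also have "\<dots> = real m * ((1 - r) * (real b * (1 - \<eta>)) * (q - \<zeta> * q))"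
      by (simp add: algebra_simps)
    also have "real b * (1 - \<eta>) = real (b - g)" using bg g by (simp add: algebra_simps of_nat_diff)
    finally have 1: "(1 - r) * Y * ?z \<le> real m * X + real m * ?P"
      by (simp add: X_def late Y_def algebra_simps)
    have "y - (1 - r) * Y * ?z = Y * ((1 - r) * (1 - ?z))" by (simp add: y_def algebra_simps)
    also have "\<dots> \<le> C * ((1 - r) * (1 - ?z))"
      using Y z r_less_1 by (intro mult_right_mono) auto
    finally show "- (real m * X) \<le> - y + D" using 1 \<omega> by (simp add: D_def mult.assoc)
  qed
  also have "\<dots> = exp (- y) + exp (- y) * (exp D - 1)" by (simp only: exp_add) (simp add: algebra_simps)
  also have "\<dots> \<le> exp (- y) + 1 * (exp D - 1)"
  proof -
    have "0 \<le> \<omega>"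
      using two_point_const_nonneg[OF l] by (intro order_trans[OF _ \<omega>] mult_nonneg_nonneg) auto
    moreover have "(1 - \<beta>) * (1 - \<eta>) * (1 - \<zeta>) \<le> 1"
      using \<beta> \<beta>0 \<eta>0 \<zeta> \<zeta>0 by (auto intro!: mult_nonneg_nonneg mult_le_one)
    ultimately have "0 \<le> D" using Y r_less_1 by (simp add: D_def)
    then show ?thesis using y by (intro add_left_mono mult_right_mono) auto
  qed
  finally show "F h - exp (- (1 - r) * real h * q) \<le> exp (C * (1 - r) * (1 - (1 - \<beta>) * (1 - \<eta>) * (1 - \<zeta>)) + \<omega>) - 1"
    unfolding y(2) D_def by simp
  define x where "x = q * (\<Sum>i<b. no_return i)"
  have nr: "0 \<le> no_return i" for i using no_return_ge[of i] r_less_1 by linarith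
  have x0: "0 \<le> x" unfolding x_def using q_nonneg nr by (intro mult_nonneg_nonneg sum_nonneg) auto
  have "(\<Sum>i<b. no_return i) \<le> (\<Sum>i<b. 1)" by (intro sum_mono no_return_le_1)
  then have "x \<le> q * real b" unfolding x_def using q_nonneg by (intro mult_left_mono) auto
  also have "\<dots> = \<beta> * Y" unfolding hb[symmetric] Y_def by simp
  finally have x1: "x \<le> \<beta> * Y" .
  also have "\<dots> \<le> \<beta> * C" using Y \<beta>0 by (intro mult_left_mono)
  finally have x2: "x \<le> \<beta> * C" "x \<le> 1 / 2" using \<beta>(3) by linarith+
  define M where "M = real (Suc m)"
  have M: "0 \<le> M" "M * real b * q \<le> (1 + \<beta>) * Y"
    using mult_right_mono[OF m2 q_nonneg] by (auto simp: M_def Y_def algebra_simps)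
  have Mx: "M * x \<le> Y * ((1 + \<beta>) * (\<eta> + no_return g))"
  proof -
    have "x \<le> q * (real g + real b * no_return g)"
      unfolding x_def by (intro mult_left_mono sum_no_return_le q_nonneg)
    also have "\<dots> = real b * q * (\<eta> + no_return g)" unfolding bg[symmetric] by (simp add: algebra_simps)
    finally have "M * x \<le> M * real b * q * (\<eta> + no_return g)"
      using M(1) by (simp add: mult_left_mono mult.assoc)
    also have "\<dots> \<le> (1 + \<beta>) * Y * (\<eta> + no_return g)"
      using M(2) nr \<eta>0 by (intro mult_right_mono) auto
    finally show ?thesis by (simp add: algebra_simps)
  qed
  \<comment> \<open>Second-order term of the logarithm: one factor \<open>x\<close> is used up by
    the sum over the blocks, the other is small.\<close>
  have Mxx: "M * x\<^sup>2 \<le> (1 + \<beta>) * C * (\<beta> * C)"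
  proof -
    have "M * x \<le> M * (q * real b)" using \<open>x \<le> q * real b\<close> M(1) by (intro mult_left_mono)
    also have "\<dots> \<le> (1 + \<beta>) * Y" using M(2) by (simp add: algebra_simps)
    also have "\<dots> \<le> (1 + \<beta>) * C" using Y \<beta>0 by (intro mult_left_mono) auto
    finally have "(M * x) * x \<le> ((1 + \<beta>) * C) * (\<beta> * C)"
      by (rule mult_mono[OF _ x2(1)]) (use x0 Y \<beta>0 in auto)
    then show ?thesis by (simp add: power2_eq_square mult.assoc)
  qed
  define e where "e = real g * q + real b * late_error g"
  have Me: "M * e \<le> C * (1 + \<beta>) * (\<eta> + \<zeta>)"
  proof -
    have "e = real b * q * (\<eta> + \<zeta>)" unfolding e_def late bg[symmetric] by (simp add: algebra_simps)
    then have "M * e = M * real b * q * (\<eta> + \<zeta>)" by simp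
    also have "\<dots> \<le> (1 + \<beta>) * Y * (\<eta> + \<zeta>)" using M \<eta>0 \<zeta>0 by (intro mult_right_mono) auto
    also have "\<dots> \<le> (1 + \<beta>) * C * (\<eta> + \<zeta>)" using Y \<beta>0 \<eta>0 \<zeta>0 by (intro mult_right_mono mult_left_mono) auto
    finally show ?thesis by (simp add: algebra_simps)
  qed
  \<comment> \<open>The loss in the exponent: the excess of the new-site probabilities over their
    limit \<open>1 - r\<close>, and the second-order term.\<close>
  define E where "E = C * ((1 + \<beta>) * (\<eta> + no_return g) - (1 - r)) + 2 * (1 + \<beta>) * C * (\<beta> * C)"
  have grow: "1 - r \<le> (1 + \<beta>) * (\<eta> + no_return g)"
  proof -
    have "1 * (0 + (1 - r)) \<le> (1 + \<beta>) * (\<eta> + no_return g)"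
      using \<beta>0 \<eta>0 no_return_ge[of g] r_less_1 by (intro mult_mono add_mono) auto
    then show ?thesis by simp
  qed
  have E0: "0 \<le> E"
    unfolding E_def using Y \<beta>0 grow by (intro add_nonneg_nonneg mult_nonneg_nonneg) auto
  have E: "M * (x + 2 * x\<^sup>2) \<le> y + E"
  proof -
    have "Y * ((1 + \<beta>) * (\<eta> + no_return g) - (1 - r)) \<le> C * ((1 + \<beta>) * (\<eta> + no_return g) - (1 - r))"
      using Y grow by (intro mult_right_mono) auto
    then show ?thesis using Mx Mxx by (simp add: E_def y_def algebra_simps)
  qed
  have "exp (- y) - E \<le> exp (- y) * exp (- E)"
  proof -
    have "exp (- y) * (1 + - E) \<le> exp (- y) * exp (- E)"
      by (intro mult_left_mono exp_ge_add_one_self) auto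
    moreover have "exp (- y) * E \<le> 1 * E" using E0 y by (intro mult_right_mono) auto
    ultimately show ?thesis by (simp add: algebra_simps)
  qed
  also have "\<dots> = exp (- (y + E))" by (simp add: exp_add[symmetric])
  also have "\<dots> \<le> exp (M * (- x - 2 * x\<^sup>2))" using E by (simp add: algebra_simps)
  also have "\<dots> = exp (- x - 2 * x\<^sup>2) ^ Suc m" unfolding M_def by (rule exp_of_nat_mult)
  also have "\<dots> \<le> F b ^ Suc m"
  proof (rule power_mono)
    \<comment> \<open>The hypothesis \<open>\<beta> * C \<le> 1 / 2\<close> puts \<open>x\<close>
      into the range where this logarithm bound holds.\<close>
    have "- x - 2 * x\<^sup>2 \<le> ln (1 - x)" using x0 x2 by (intro ln_one_minus_pos_lower_bound)
    then have "exp (- x - 2 * x\<^sup>2) \<le> 1 - x" using x2 by (simp add: ln_ge_iff)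
    also have "\<dots> \<le> F b" using F_ge[of b] by (simp add: x_def)
    finally show "exp (- x - 2 * x\<^sup>2) \<le> F b" .
  qed simp
  also have "\<dots> \<le> F (Suc m * b) + M * e"
    using F_mult_ge[OF g(1), of b "Suc m"] unfolding M_def e_def by linarith
  also have "\<dots> \<le> F h + C * (1 + \<beta>) * (\<eta> + \<zeta>)"
    using F_antimono[OF m(2)] Me by (rule add_mono)
  finally show "- (C * ((1 + \<beta>) * (\<eta> + no_return g) - (1 - r)) + 2 * (1 + \<beta>) * C * (\<beta> * C)) - C * (1 + \<beta>) * (\<eta> + \<zeta>)
       \<le> F h - exp (- (1 - r) * real h * q)"
    unfolding y(2) E_def by simp
qed

end

section \<open>Choice of block length and gap\<close>

lemma floor_powr_bounds:
  fixes k :: nat and e :: real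
  assumes "2 \<le> real k powr e"
  shows "real k powr e / 2 \<le> real (nat \<lfloor>real k powr e\<rfloor>)" "real (nat \<lfloor>real k powr e\<rfloor>) \<le> real k powr e"
    "0 < nat \<lfloor>real k powr e\<rfloor>"
  using assms by linarith+

lemma filterlim_nat_powr:
  "0 < e \<Longrightarrow> filterlim (\<lambda>k::nat. real k powr e) at_top sequentially"
  by real_asymp

text \<open>The condition with \<open>c\<close> says that two exceedances cost more than one by a
  power of the horizon. \<open>\<kappa>\<close> may grow logarithmically because the late error
  decays like a power of the gap.\<close>

lemma (in lattice) survival_tendsto:
  fixes a :: "nat \<Rightarrow> nat \<Rightarrow> real" and q \<kappa> A :: "nat \<Rightarrow> real" and h :: "nat \<Rightarrow> nat"
  assumes lev: "\<forall>\<^sub>F n in sequentially. level TYPE('d) (a n) (q n) (\<kappa> n) \<and> 0 \<le> \<kappa> n \<and> \<kappa> n \<le> B * ln (real (h n))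
      \<and> real (h n) * q n \<le> C \<and> 0 \<le> A n \<and> (\<forall>k. (\<Sum>j<k. a n j) \<le> A n * l ^ k)
      \<and> (A n)\<^sup>2 \<le> C' * (q n * real (h n) powr (- c))"
    and h: "filterlim h at_top sequentially"
    and l: "1 \<le> l" "2 * r * l < 1 + r" and c: "0 < c"
  shows "(\<lambda>n. survival (\<lambda>k. 1 - (\<Sum>j<k. a n j)) (h n) - exp (- (1 - r) * real (h n) * q n)) \<longlonglongrightarrow> 0"
proof -
  let ?d = "real CARD('d)"
  \<comment> \<open>A block contributes at most about \<open>b ^ (2 * d)\<close> pairs of sites;
    this choice lets them use up at most half of the gain \<open>k powr (- c)\<close>.\<close>
  define e where "e = min (1/2) (c / (4 * ?d))"
  have e: "0 < e" "e \<le> 1 / 2" "2 * ?d * e \<le> c / 2"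
    using c dim by (auto simp: e_def min_def field_simps)
  define b where "b k = nat \<lfloor>real k powr e\<rfloor>" for k :: nat
  define g where "g k = nat \<lfloor>real k powr (e / 2)\<rfloor>" for k :: nat
  define \<beta> where "\<beta> k = real (b k) / real k" for k
  define \<eta> where "\<eta> k = real (g k) / real (b k)" for k
  \<comment> \<open>Dominates \<open>\<zeta>\<close>: \<open>\<kappa>\<close> is at most
    \<open>B * ln k\<close>, and the fourth root of the gap is at least
    \<open>k powr (e / 8) / 2\<close>.\<close>
  define Z where "Z k = late_const * B * (2 * (ln (real k) / real k powr (e / 8)))" for k :: nat
  define K where "K = two_point_const l"
  \<comment> \<open>\<open>9 ^ d\<close> is the square of \<open>3 ^ d\<close>, from
    \<open>2 * b + 1 \<le> 3 * k powr e\<close>. Absolute values keep the product monotone without a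
    discussion of signs.\<close>
  define W where "W k = 9 ^ CARD('d) * \<bar>C'\<bar> * \<bar>K\<bar> * \<bar>C\<bar> * real k powr (- (c / 2))" for k :: nat
  have big: "\<forall>\<^sub>F k in sequentially. 2 \<le> real k powr e \<and> 2 \<le> real k powr (e / 2) \<and> 1 \<le> k"
    using filterlim_nat_powr[of e] filterlim_nat_powr[of "e / 2"] e
    by (auto simp: filterlim_at_top eventually_conj_iff eventually_ge_at_top)
  have \<beta>_lim: "\<beta> \<longlonglongrightarrow> 0"
  proof (rule tendsto_sandwich[of "\<lambda>_. 0" _ _ "\<lambda>k. real k powr (e - 1)"])
    show "\<forall>\<^sub>F k in sequentially. \<beta> k \<le> real k powr (e - 1)"
      using big
    proof eventually_elim
      case (elim k)
      then have "\<beta> k \<le> real k powr e / real k"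
        unfolding \<beta>_def b_def by (intro divide_right_mono floor_powr_bounds) auto
      then show ?case using elim by (simp add: powr_diff)
    qed
    show "(\<lambda>k. real k powr (e - 1)) \<longlonglongrightarrow> 0"
      using e by (intro tendsto_neg_powr filterlim_real_sequentially) auto
  qed (auto simp: \<beta>_def)
  have \<eta>_lim: "\<eta> \<longlonglongrightarrow> 0"
  proof (rule tendsto_sandwich[of "\<lambda>_. 0" _ _ "\<lambda>k. 2 * real k powr (- (e / 2))"])
    show "\<forall>\<^sub>F k in sequentially. \<eta> k \<le> 2 * real k powr (- (e / 2))"
      using big
    proof eventually_elim
      case (elim k)
      then have "\<eta> k \<le> real k powr (e / 2) / (real k powr e / 2)"
        unfolding \<eta>_def b_def g_def by (intro frac_le floor_powr_bounds) auto
      also have "\<dots> = 2 * real k powr (e / 2 - e)" unfolding powr_diff by simp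
      also have "e / 2 - e = - (e / 2)" by simp
      finally show ?case .
    qed
    show "(\<lambda>k. 2 * real k powr (- (e / 2))) \<longlonglongrightarrow> 0"
      using e by (intro tendsto_mult_right_zero tendsto_neg_powr filterlim_real_sequentially) auto
  qed (auto simp: \<eta>_def)
  have Z_lim: "Z \<longlonglongrightarrow> 0"
    unfolding Z_def using e by (intro tendsto_mult_right_zero lim_ln_over_power) auto
  have W_lim: "W \<longlonglongrightarrow> 0"
    unfolding W_def using c by (intro tendsto_mult_right_zero tendsto_neg_powr filterlim_real_sequentially) auto
  have g_top: "filterlim g at_top sequentially"
    unfolding g_def using e
    by (intro filterlim_compose[OF filterlim_nat_sequentially] filterlim_compose[OF filterlim_floor_sequentially] filterlim_nat_powr) auto
  have nr_lim: "(\<lambda>k. no_return (g k)) \<longlonglongrightarrow> 1 - r"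
    by (rule filterlim_compose[OF no_return_tendsto g_top])
  have small: "\<forall>\<^sub>F k in sequentially. \<beta> k \<le> 1 \<and> \<beta> k * C \<le> 1 / 2 \<and> Z k \<le> 1 \<and> \<eta> k \<le> 1"
  proof (intro eventually_conj)
    have "(\<lambda>k. \<beta> k * C) \<longlonglongrightarrow> 0" by (intro tendsto_mult_left_zero \<beta>_lim)
    from order_tendstoD(2)[OF this, of "1 / 2"] show "\<forall>\<^sub>F k in sequentially. \<beta> k * C \<le> 1 / 2"
      by (auto elim: eventually_mono)
  qed (auto intro: eventually_mono[OF order_tendstoD(2)[OF \<beta>_lim, of 1]]
        eventually_mono[OF order_tendstoD(2)[OF \<eta>_lim, of 1]] eventually_mono[OF order_tendstoD(2)[OF Z_lim, of 1]])
  define Up where "Up k = exp (C * (1 - r) * (1 - (1 - \<beta> k) * (1 - \<eta> k) * (1 - Z k)) + W k) - 1" for k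
  define Lo where "Lo k = - (C * ((1 + \<beta> k) * (\<eta> k + no_return (g k)) - (1 - r)) + 2 * (1 + \<beta> k) * C * (\<beta> k * C))
     - C * (1 + \<beta> k) * (\<eta> k + Z k)" for k
  have Up_lim: "Up \<longlonglongrightarrow> 0"
  proof -
    have "Up \<longlonglongrightarrow> exp (C * (1 - r) * (1 - (1 - 0) * (1 - 0) * (1 - 0)) + 0) - 1"
      unfolding Up_def by (intro tendsto_intros \<beta>_lim \<eta>_lim Z_lim W_lim)
    then show ?thesis by simp
  qed
  have Lo_lim: "Lo \<longlonglongrightarrow> 0"
  proof -
    have "Lo \<longlonglongrightarrow> - (C * ((1 + 0) * (0 + (1 - r)) - (1 - r)) + 2 * (1 + 0) * C * (0 * C)) - C * (1 + 0) * (0 + 0)"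
      unfolding Lo_def by (intro tendsto_intros \<beta>_lim \<eta>_lim Z_lim nr_lim)
    then show ?thesis by simp
  qed
  \<comment> \<open>Stated for one horizon and an arbitrary level, so that both can then run along
    the sequence.\<close>
  have main: "Lo k \<le> survival (\<lambda>k. 1 - (\<Sum>j<k. a' j)) k - exp (- (1 - r) * real k * q')
      \<and> survival (\<lambda>k. 1 - (\<Sum>j<k. a' j)) k - exp (- (1 - r) * real k * q') \<le> Up k"
    if lv: "level TYPE('d) a' q' \<kappa>'" and \<kappa>': "0 \<le> \<kappa>'" "\<kappa>' \<le> B * ln (real k)" and C: "real k * q' \<le> C"
      and A': "0 \<le> A'" "\<forall>i. (\<Sum>j<i. a' j) \<le> A' * l ^ i" "A'\<^sup>2 \<le> C' * (q' * real k powr (- c))"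
      and k: "2 \<le> real k powr e" "2 \<le> real k powr (e / 2)" "1 \<le> k"
      and sm: "\<beta> k \<le> 1" "\<beta> k * C \<le> 1 / 2" "Z k \<le> 1" "\<eta> k \<le> 1"
    for k a' q' \<kappa>' A'
  proof -
    interpret L: level "TYPE('d)" a' q' \<kappa>' by (rule lv)
    let ?m = "k div b k" and ?g = "g k" and ?b = "b k"
    have b: "real k powr e / 2 \<le> real ?b" "real ?b \<le> real k powr e" "0 < ?b"
      unfolding b_def using floor_powr_bounds[OF k(1)] by auto
    have g: "real k powr (e / 2) / 2 \<le> real ?g" "0 < ?g"
      unfolding g_def using floor_powr_bounds[OF k(2)] by auto
    have gb: "?g \<le> ?b" using sm(4) b(3) by (simp add: \<eta>_def)
    define \<zeta> where "\<zeta> = late_const * \<kappa>' / fourth_root ?g"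
    have \<zeta>Z: "\<zeta> \<le> Z k"
    proof -
      have "real k powr (e / 8) / 2 \<le> fourth_root ?g"
      proof -
        have "real k powr (e / 8) / 2 \<le> real k powr (e / 8) / 2 powr (1 / 4)"
          using powr_mono[of "1/4" 1 2] by (intro divide_left_mono) auto
        also have "\<dots> = (real k powr (e / 2) / 2) powr (1 / 4)"
          using k by (simp add: powr_divide powr_powr)
        also have "\<dots> \<le> real ?g powr (1 / 4)" using g by (intro powr_mono2) auto
        finally show ?thesis using g fourth_root_powr by simp
      qed
      moreover have "late_const * \<kappa>' \<le> late_const * (B * ln (real k))"
        by (intro mult_left_mono \<kappa>' late_const_nonneg)
      ultimately have "\<zeta> \<le> late_const * (B * ln (real k)) / (real k powr (e / 8) / 2)"
        unfolding \<zeta>_def using k \<kappa>' late_const_nonneg by (intro frac_le) auto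
      then show ?thesis by (simp add: Z_def mult_ac)
    qed
    have "?m * ?b \<le> k" by simp
    moreover have "k \<le> Suc ?m * ?b"
      using div_mult_mod_eq[of k ?b] mod_less_divisor[OF b(3), of k] unfolding mult_Suc by linarith
    moreover have "real ?m * ((real (2 * ?b + 1) ^ CARD('d))\<^sup>2 * (A'\<^sup>2 * two_point_const l)) \<le> W k"
    proof -
      have kk: "1 \<le> real k powr e" using k by simp
      have "(real (2 * ?b + 1) ^ CARD('d))\<^sup>2 \<le> ((3 * real k powr e) ^ CARD('d))\<^sup>2"
        using b(2) kk by (intro power_mono) auto
      also have "\<dots> = 9 ^ CARD('d) * ((real k powr e) ^ CARD('d))\<^sup>2"
        by (simp add: power_mult_distrib power2_eq_square flip: power_mult_distrib[of 3 3])
      also have "((real k powr e) ^ CARD('d))\<^sup>2 = real k powr (2 * ?d * e)"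
        using k by (simp add: powr_realpow[symmetric] powr_powr power_mult[symmetric] mult_ac)
      finally have 1: "(real (2 * ?b + 1) ^ CARD('d))\<^sup>2 \<le> 9 ^ CARD('d) * real k powr (2 * ?d * e)" .
      have q0: "0 \<le> q' * real k powr (- c)" using L.q_nonneg by simp
      have "A'\<^sup>2 * K \<le> A'\<^sup>2 * \<bar>K\<bar>" by (intro mult_left_mono) auto
      also have "\<dots> \<le> \<bar>C'\<bar> * (q' * real k powr (- c)) * \<bar>K\<bar>"
        using A'(3) mult_right_mono[OF abs_ge_self[of C'] q0] by (intro mult_right_mono) linarith+
      finally have 2: "A'\<^sup>2 * K \<le> \<bar>C'\<bar> * (q' * real k powr (- c)) * \<bar>K\<bar>" .
      have "real ?m \<le> real k" by simp
      then have "real ?m * ((real (2 * ?b + 1) ^ CARD('d))\<^sup>2 * (A'\<^sup>2 * K))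
         \<le> real k * ((9 ^ CARD('d) * real k powr (2 * ?d * e)) * (\<bar>C'\<bar> * (q' * real k powr (- c)) * \<bar>K\<bar>))"
      proof -
        have "(real (2 * ?b + 1) ^ CARD('d))\<^sup>2 * (A'\<^sup>2 * K)
          \<le> (real (2 * ?b + 1) ^ CARD('d))\<^sup>2 * (\<bar>C'\<bar> * (q' * real k powr (- c)) * \<bar>K\<bar>)"
          by (intro mult_left_mono 2) auto
        also have "\<dots> \<le> (9 ^ CARD('d) * real k powr (2 * ?d * e)) * (\<bar>C'\<bar> * (q' * real k powr (- c)) * \<bar>K\<bar>)"
          using q0 by (intro mult_right_mono 1) auto
        finally have "(real (2 * ?b + 1) ^ CARD('d))\<^sup>2 * (A'\<^sup>2 * K)
          \<le> (9 ^ CARD('d) * real k powr (2 * ?d * e)) * (\<bar>C'\<bar> * (q' * real k powr (- c)) * \<bar>K\<bar>)" .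
        then have "real ?m * ((real (2 * ?b + 1) ^ CARD('d))\<^sup>2 * (A'\<^sup>2 * K))
          \<le> real ?m * ((9 ^ CARD('d) * real k powr (2 * ?d * e)) * (\<bar>C'\<bar> * (q' * real k powr (- c)) * \<bar>K\<bar>))"
          by (intro mult_left_mono) auto
        also have "\<dots> \<le> real k * ((9 ^ CARD('d) * real k powr (2 * ?d * e)) * (\<bar>C'\<bar> * (q' * real k powr (- c)) * \<bar>K\<bar>))"
          using q0 by (intro mult_right_mono) auto
        finally show ?thesis .
      qed
      also have "\<dots> = 9 ^ CARD('d) * \<bar>C'\<bar> * \<bar>K\<bar> * (real k * q') * (real k powr (2 * ?d * e) * real k powr (- c))"
        by (simp add: mult_ac)
      also have "\<dots> \<le> 9 ^ CARD('d) * \<bar>C'\<bar> * \<bar>K\<bar> * \<bar>C\<bar> * real k powr (- (c / 2))"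
      proof (intro mult_mono)
        have "real k powr (2 * ?d * e) * real k powr (- c) = real k powr (2 * ?d * e + - c)"
          by (rule powr_add[symmetric])
        also have "\<dots> \<le> real k powr (- (c / 2))" using e(3) k by (intro powr_mono) auto
        finally show "real k powr (2 * ?d * e) * real k powr (- c) \<le> real k powr (- (c / 2))" .
      qed (use C L.q_nonneg in auto)
      finally show ?thesis by (simp add: K_def W_def)
    qed
    ultimately have B: "L.F k - exp (- (1 - r) * real k * q') \<le> exp (C * (1 - r) * (1 - (1 - \<beta> k) * (1 - \<eta> k) * (1 - \<zeta>)) + W k) - 1"
      "- (C * ((1 + \<beta> k) * (\<eta> k + no_return ?g) - (1 - r)) + 2 * (1 + \<beta> k) * C * (\<beta> k * C)) - C * (1 + \<beta> k) * (\<eta> k + \<zeta>)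
       \<le> L.F k - exp (- (1 - r) * real k * q')"
      using L.F_bounds[of ?g ?b ?m k C "\<beta> k" "\<eta> k" \<zeta> l A' "W k"] g gb k C sm \<zeta>Z A' l \<kappa>'
      by (auto simp: \<beta>_def \<eta>_def \<zeta>_def L.exceed_def)
    have C0: "0 \<le> C" using C L.q_nonneg by (meson mult_nonneg_nonneg of_nat_0_le_iff order_trans)
    have \<beta>\<eta>: "0 \<le> \<beta> k" "0 \<le> \<eta> k" by (auto simp: \<beta>_def \<eta>_def)
    have "(1 - \<beta> k) * (1 - \<eta> k) * (1 - Z k) \<le> (1 - \<beta> k) * (1 - \<eta> k) * (1 - \<zeta>)"
      using sm \<zeta>Z by (intro mult_left_mono) auto
    then have "C * (1 - r) * (1 - (1 - \<beta> k) * (1 - \<eta> k) * (1 - \<zeta>)) \<le> C * (1 - r) * (1 - (1 - \<beta> k) * (1 - \<eta> k) * (1 - Z k))"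
      using C0 r_less_1 by (intro mult_left_mono) auto
    then have "L.F k - exp (- (1 - r) * real k * q') \<le> Up k"
      using B(1) unfolding Up_def by (smt (verit) exp_le_cancel_iff)
    moreover have "C * (1 + \<beta> k) * (\<eta> k + \<zeta>) \<le> C * (1 + \<beta> k) * (\<eta> k + Z k)"
      using C0 \<beta>\<eta> \<zeta>Z by (intro mult_left_mono) auto
    then have "Lo k \<le> L.F k - exp (- (1 - r) * real k * q')"
      using B(2) unfolding Lo_def by linarith
    ultimately show ?thesis by (simp add: L.F_eq_survival)
  qed
  have ev: "\<forall>\<^sub>F n in sequentially.
      Lo (h n) \<le> survival (\<lambda>k. 1 - (\<Sum>j<k. a n j)) (h n) - exp (- (1 - r) * real (h n) * q n)
      \<and> survival (\<lambda>k. 1 - (\<Sum>j<k. a n j)) (h n) - exp (- (1 - r) * real (h n) * q n) \<le> Up (h n)"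
    using lev eventually_compose_filterlim[OF big h] eventually_compose_filterlim[OF small h]
  proof eventually_elim
    case (elim n)
    show ?case by (rule main[of "a n" "q n" "\<kappa> n" "h n" "A n"]) (use elim in auto)
  qed
  show ?thesis
  proof (rule tendsto_sandwich[OF _ _ filterlim_compose[OF Lo_lim h] filterlim_compose[OF Up_lim h]])
  qed (use ev in \<open>auto elim: eventually_mono\<close>)
qed

subsection \<open>The two families of levels\<close>

text \<open>Poisson masses: their sum over \<open>j < k\<close> is the probability that
  \<open>k\<close> independent unit exponential times add up to more than \<open>v\<close>.\<close>

definition poisson_weight :: "real \<Rightarrow> nat \<Rightarrow> real" where
  "poisson_weight v j = exp (- v) * v ^ j / fact j"

lemma sum_poisson_weight_le: "0 \<le> v \<Longrightarrow> 0 \<le> z \<Longrightarrow> (\<Sum>j<k. exp (- v) * z ^ j / fact j) \<le> exp (- v) * exp z"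
  for v z :: real
proof -
  assume z: "0 \<le> z"
  have "(\<lambda>j. z ^ j / fact j) sums exp z"
    using exp_converges[of z] unfolding real_scaleR_def by (simp add: divide_inverse mult.commute)
  then have "(\<Sum>j<k. z ^ j / fact j) \<le> exp z"
    using sum_le_suminf[of "\<lambda>j. z ^ j / fact j" "{..<k}"] z by (simp add: sums_iff)
  then show ?thesis by (simp add: sum_distrib_left[symmetric] times_divide_eq_right[symmetric] del: times_divide_eq_right)
qed

context lattice
begin

text \<open>\<open>\<rho>\<close> lies strictly between \<open>2 * r / (1 + r)\<close> and
  \<open>sqrt r\<close>, an interval that is nonempty by \<open>2 * sqrt r < 1 + r\<close>. The
  lower end admits \<open>l = 1 / \<rho>\<close> in the two-point bound; \<open>\<rho>^2 < r\<close>
  and \<open>2 * \<rho> < 1 + r\<close> are the gains for pairs in discrete and in continuous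
  time.\<close>

lemma decay_rate: "\<exists>\<rho>. 0 < \<rho> \<and> \<rho> < 1 \<and> 2 * r * (1 / \<rho>) < 1 + r \<and> \<rho>\<^sup>2 < r \<and> 2 * \<rho> < 1 + r"
proof -
  have r: "0 < r" "r < 1" using r_pos r_less_1 .
  define s where "s = sqrt r"
  have s: "0 < s" "s < 1" "s\<^sup>2 = r" using r by (auto simp: s_def)
  have "0 < (1 - s)\<^sup>2" using s by simp
  then have "2 * s < 1 + r" using s(3) by (simp add: power2_eq_square algebra_simps)
  then have "s * (2 * s) < s * (1 + r)" using s(1) by (rule mult_strict_left_mono)
  then have "2 * r < s * (1 + r)" using s(3) by (simp add: power2_eq_square)
  then have "2 * r / (1 + r) < s" using r by (simp add: field_simps)
  then obtain \<rho> where \<rho>: "2 * r / (1 + r) < \<rho>" "\<rho> < s" using dense by blast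
  have "0 < 2 * r / (1 + r)" using r by simp
  then have \<rho>0: "0 < \<rho>" using \<rho> by linarith
  have "\<rho>\<^sup>2 < s\<^sup>2" using \<rho> \<rho>0 by (intro power_strict_mono) auto
  then have *: "\<rho>\<^sup>2 < r" using s by simp
  have "0 \<le> (1 - \<rho>)\<^sup>2" by simp
  then have "2 * \<rho> \<le> 1 + \<rho>\<^sup>2" by (simp add: power2_eq_square algebra_simps)
  moreover have "2 * r * (1 / \<rho>) < 1 + r" using \<rho>(1) \<rho>0 r by (simp add: field_simps)
  ultimately show ?thesis using \<rho> \<rho>0 s * by (intro exI[of _ \<rho>]) auto
qed

text \<open>In discrete time the level \<open>k\<close> is exceeded at the visit number
  \<open>k + 1\<close>, so all the weight sits at \<open>j = k\<close>, and \<open>r ^ k\<close> is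
  the probability of at least \<open>k\<close> returns.\<close>

lemma level_indicator: "level TYPE('d) (\<lambda>j. of_bool (j = k)) (r ^ k) (1 + real k)"
proof
  have sum: "(\<Sum>j<i. of_bool (j = k)) = (of_bool (k < i) :: real)" for i
    by (induction i) auto
  show "(\<Sum>j<i. of_bool (j = k)) \<le> (1 :: real)" for i
    unfolding sum by simp
  show "1 - (\<Sum>j<i + i'. of_bool (j = k)) \<le> (1 - (\<Sum>j<i. of_bool (j = k))) * (1 - (\<Sum>j<i'. of_bool (j = k)) :: real)" for i i'
    unfolding sum by auto
  have "(\<lambda>j. of_bool (j = k) * r ^ j) = (\<lambda>j. if j = k then r ^ j else 0)" by auto
  then show "(\<lambda>j. of_bool (j = k) * r ^ j) sums r ^ k"
    using sums_single[of k "\<lambda>j. r ^ j"] by simp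
  show "(\<Sum>j<i. of_bool (j = k) * ((1 + real j) * r ^ j)) \<le> (1 + real k) * r ^ k" for i
  proof -
    have "(\<Sum>j<i. of_bool (j = k) * ((1 + real j) * r ^ j)) = (\<Sum>j<i. of_bool (j = k) * ((1 + real k) * r ^ k))"
      by (intro sum.cong) auto
    also have "\<dots> = of_bool (k < i) * ((1 + real k) * r ^ k)"
      unfolding sum_distrib_right[symmetric] sum ..
    finally show ?thesis using r_pos by simp
  qed
qed simp

text \<open>The horizon is \<open>Suc n\<close> because the local time counts the times 0 to
  \<open>n\<close>. Rounding the level makes \<open>n * r ^ k0 n\<close> oscillate, so only its
  boundedness is claimed.\<close>

lemma discrete_survival_tendsto:
  fixes u :: real
  defines "\<alpha> \<equiv> - 1 / ln r"
  defines "k0 \<equiv> (\<lambda>n::nat. nat \<lfloor>\<alpha> * ln (real n) + u\<rfloor>)"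
  shows "(\<lambda>n. survival (\<lambda>k. of_bool (k \<le> k0 n)) (Suc n) - exp (- (1 - r) * real (Suc n) * r ^ k0 n)) \<longlonglongrightarrow> 0"
    and "\<exists>C. \<forall>\<^sub>F n in sequentially. real (Suc n) * r ^ k0 n \<le> C"
proof -
  have r: "0 < r" "r < 1" using r_pos r_less_1 .
  obtain \<rho> where \<rho>: "0 < \<rho>" "\<rho> < 1" "2 * r * (1 / \<rho>) < 1 + r" "\<rho>\<^sup>2 < r"
    using decay_rate by blast
  have ln_r: "ln r < 0" using r by simp
  then have \<alpha>: "0 < \<alpha>" "\<alpha> * ln r = - 1" by (auto simp: \<alpha>_def field_simps)
  \<comment> \<open>The square of \<open>\<rho> ^ k0 n\<close> is
    \<open>r ^ k0 n * \<theta> ^ k0 n\<close>; the second factor, of order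
    \<open>n powr (- c)\<close>, is the gain of pairs over single sites.\<close>
  define \<theta> where "\<theta> = \<rho>\<^sup>2 / r"
  have \<theta>: "0 < \<theta>" "\<theta> < 1" using \<rho> r by (auto simp: \<theta>_def)
  define c where "c = - \<alpha> * ln \<theta>"
  have c: "0 < c" using \<alpha> \<theta> by (simp add: c_def mult_pos_neg)
  have "filterlim (\<lambda>n::nat. \<alpha> * ln (real n) + u) at_top sequentially"
    using \<alpha>(1) by real_asymp
  then have ev0: "\<forall>\<^sub>F n in sequentially. 0 \<le> \<alpha> * ln (real n) + u"
    by (simp add: filterlim_at_top)
  have ev: "\<forall>\<^sub>F n in sequentially. 0 \<le> \<alpha> * ln (real n) + u \<and> 3 \<le> n"
    using ev0 eventually_ge_at_top by (rule eventually_conj)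
  \<comment> \<open>Rounding down lowers the exponent by at most 1, hence
    \<open>u - 1\<close>.\<close>
  have pow_le: "x ^ k0 n \<le> x powr (u - 1) * real n powr (\<alpha> * ln x)"
    if "0 < x" "x < 1" "0 \<le> \<alpha> * ln (real n) + u" "3 \<le> n" for x n
  proof -
    have "\<alpha> * ln (real n) + (u - 1) \<le> real (k0 n)" using that unfolding k0_def by linarith
    then have "x powr real (k0 n) \<le> x powr (\<alpha> * ln (real n) + (u - 1))"
      using that by (intro powr_mono') auto
    also have "\<dots> = x powr (u - 1) * x powr (\<alpha> * ln (real n))"
      by (simp add: powr_add)
    also have "x powr (\<alpha> * ln (real n)) = real n powr (\<alpha> * ln x)"
      using that by (simp add: powr_def mult_ac)
    finally show ?thesis using that by (simp add: powr_realpow)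
  qed
  have hq: "real (Suc n) * r ^ k0 n \<le> 2 * r powr (u - 1)"
    if "0 \<le> \<alpha> * ln (real n) + u" "3 \<le> n" for n
  proof -
    have "r ^ k0 n \<le> r powr (u - 1) * real n powr (- 1)"
      using pow_le[OF r that] \<alpha> by simp
    then have "real (Suc n) * r ^ k0 n \<le> (2 * real n) * (r powr (u - 1) * real n powr (- 1))"
      using that r by (intro mult_mono) auto
    also have "\<dots> = 2 * r powr (u - 1)" using that by (simp add: powr_minus field_simps)
    finally show ?thesis .
  qed
  show "\<exists>C. \<forall>\<^sub>F n in sequentially. real (Suc n) * r ^ k0 n \<le> C"
    using ev hq by (intro exI[of _ "2 * r powr (u - 1)"]) (auto elim: eventually_mono)
  have sum: "1 - (\<Sum>j<i. of_bool (j = k)) = (of_bool (i \<le> k) :: real)" for i k :: nat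
    by (induction i) auto
  have "(\<lambda>n. survival (\<lambda>i. 1 - (\<Sum>j<i. of_bool (j = k0 n))) (Suc n) - exp (- (1 - r) * real (Suc n) * r ^ k0 n)) \<longlonglongrightarrow> 0"
  proof (rule survival_tendsto[where \<kappa> = "\<lambda>n. 1 + real (k0 n)" and A = "\<lambda>n. \<rho> ^ k0 n" and l = "1 / \<rho>"
        and B = "\<alpha> + 1 + \<bar>u\<bar>" and C = "2 * r powr (u - 1)" and C' = "\<theta> powr (u - 1) * 2 powr c" and c = c])
    show "\<forall>\<^sub>F n in sequentially. level TYPE('d) (\<lambda>j. of_bool (j = k0 n)) (r ^ k0 n) (1 + real (k0 n)) \<and> 0 \<le> 1 + real (k0 n) \<and>
          1 + real (k0 n) \<le> (\<alpha> + 1 + \<bar>u\<bar>) * ln (real (Suc n)) \<and> real (Suc n) * r ^ k0 n \<le> 2 * r powr (u - 1) \<and> 0 \<le> \<rho> ^ k0 n \<and>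
          (\<forall>k. (\<Sum>j<k. of_bool (j = k0 n)) \<le> \<rho> ^ k0 n * (1 / \<rho>) ^ k) \<and>
          (\<rho> ^ k0 n)\<^sup>2 \<le> \<theta> powr (u - 1) * 2 powr c * (r ^ k0 n * real (Suc n) powr (- c))"
      using ev
    proof eventually_elim
      case (elim n)
      have "exp 1 \<le> (3 :: real)" using exp_le by simp
      then have "exp 1 \<le> real (Suc n)" using elim by linarith
      then have ln1: "1 \<le> ln (real (Suc n))" by (simp add: ln_ge_iff)
      have "ln (real n) \<le> ln (real (Suc n))" using elim by simp
      then have "\<alpha> * ln (real n) \<le> \<alpha> * ln (real (Suc n))" using \<alpha> by (intro mult_left_mono) auto
      moreover have "real (k0 n) \<le> \<alpha> * ln (real n) + u" using elim unfolding k0_def by linarith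
      moreover have "\<bar>u\<bar> * 1 \<le> \<bar>u\<bar> * ln (real (Suc n))" using ln1 by (intro mult_left_mono) auto
      ultimately have k: "1 + real (k0 n) \<le> (\<alpha> + 1 + \<bar>u\<bar>) * ln (real (Suc n))"
        using ln1 unfolding distrib_right by linarith
      \<comment> \<open>If the level is exceeded, then \<open>k0 n < k\<close> and the right side is
        \<open>(1 / \<rho>) ^ (k - k0 n)\<close>, at least 1.\<close>
      have A: "(\<Sum>j<k. of_bool (j = k0 n)) \<le> \<rho> ^ k0 n * (1 / \<rho>) ^ k" for k
      proof (cases "k0 n < k")
        case True
        have "\<rho> ^ k \<le> \<rho> ^ k0 n" using True \<rho> by (intro power_decreasing) auto
        then show ?thesis using sum[of k "k0 n"] True \<rho> by (simp add: power_divide field_simps)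
      next
        case False
        then show ?thesis using sum[of k "k0 n"] \<rho> by simp
      qed
      have "\<theta> ^ k0 n \<le> \<theta> powr (u - 1) * real n powr (- c)"
        using pow_le[OF \<theta>] elim by (simp add: c_def)
      also have "real n powr (- c) \<le> (real (Suc n) / 2) powr (- c)"
        using elim c by (intro powr_mono2') auto
      also have "\<dots> = 2 powr c * real (Suc n) powr (- c)"
        by (simp add: powr_divide powr_minus field_simps)
      finally have "\<theta> ^ k0 n \<le> \<theta> powr (u - 1) * (2 powr c * real (Suc n) powr (- c))"
        using \<theta> by simp
      then have "r ^ k0 n * \<theta> ^ k0 n \<le> r ^ k0 n * (\<theta> powr (u - 1) * (2 powr c * real (Suc n) powr (- c)))"
        using r by (intro mult_left_mono) auto
      moreover have "r ^ k0 n * \<theta> ^ k0 n = (\<rho> ^ k0 n)\<^sup>2"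
        unfolding power_mult_distrib[symmetric] using r by (simp add: \<theta>_def power_mult[symmetric] mult.commute)
      ultimately have "(\<rho> ^ k0 n)\<^sup>2 \<le> \<theta> powr (u - 1) * 2 powr c * (r ^ k0 n * real (Suc n) powr (- c))"
        by (simp add: mult_ac)
      then show ?case using level_indicator k hq[of n] elim A \<rho> by auto
    qed
    show "filterlim Suc at_top sequentially" by (rule filterlim_Suc)
  qed (use \<rho> c in auto)
  then show "(\<lambda>n. survival (\<lambda>k. of_bool (k \<le> k0 n)) (Suc n) - exp (- (1 - r) * real (Suc n) * r ^ k0 n)) \<longlonglongrightarrow> 0"
    by (simp only: sum)
qed

text \<open>A geometric number of unit exponential times is exponential with rate
  \<open>1 - r\<close>, which gives \<open>q\<close>. Submultiplicativity enters as a hypothesis and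
  is supplied by \<open>poisson_weight_submult\<close> from independent holding times.\<close>

lemma level_poisson:
  assumes v: "0 \<le> v"
    and submult: "\<And>i k. 1 - (\<Sum>j<i+k. poisson_weight v j)
      \<le> (1 - (\<Sum>j<i. poisson_weight v j)) * (1 - (\<Sum>j<k. poisson_weight v j))"
  shows "level TYPE('d) (poisson_weight v) (exp (- (1 - r) * v)) (1 + v)"
proof
  show "0 \<le> poisson_weight v j" for j using v by (simp add: poisson_weight_def)
  show "(\<Sum>j<k. poisson_weight v j) \<le> 1" for k
    using sum_poisson_weight_le[OF v v, of k] by (simp add: poisson_weight_def exp_add[symmetric])
  have eq: "poisson_weight v j * r ^ j = exp (- v) * (v * r) ^ j / fact j" for j
    by (simp add: poisson_weight_def power_mult_distrib)
  have ex: "exp (- v) * exp (v * r) = exp (- (1 - r) * v)"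
    by (simp add: exp_add[symmetric] algebra_simps)
  have "(\<lambda>j. (v * r) ^ j / fact j) sums exp (v * r)"
    using exp_converges[of "v * r"] unfolding real_scaleR_def by (simp add: divide_inverse mult.commute)
  from sums_mult[OF this, of "exp (- v)"]
  show "(\<lambda>j. poisson_weight v j * r ^ j) sums exp (- (1 - r) * v)"
    unfolding eq ex by simp
  show "(\<Sum>j<k. poisson_weight v j * ((1 + real j) * r ^ j)) \<le> (1 + v) * exp (- (1 - r) * v)" for k
  proof -
    let ?z = "v * r"
    have z: "0 \<le> ?z" "?z \<le> v" using v r_pos r_less_1 mult_left_mono[of r 1 v] by auto
    have "(\<Sum>j<k. real j * (exp (- v) * ?z ^ j / fact j)) \<le> ?z * (exp (- v) * exp ?z)"
    proof (cases k)
      case (Suc i)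
      have "(\<Sum>j<k. real j * (exp (- v) * ?z ^ j / fact j)) = (\<Sum>j<i. ?z * (exp (- v) * ?z ^ j / fact j))"
        unfolding Suc sum.lessThan_Suc_shift
        by (simp add: field_simps del: of_nat_Suc)
      also have "\<dots> \<le> ?z * (exp (- v) * exp ?z)"
        unfolding sum_distrib_left[symmetric] by (intro mult_left_mono sum_poisson_weight_le v z)
      finally show ?thesis .
    qed (use z in simp)
    also have "\<dots> \<le> v * (exp (- v) * exp ?z)" using z by (intro mult_right_mono) auto
    finally have "(\<Sum>j<k. exp (- v) * ?z ^ j / fact j) + (\<Sum>j<k. real j * (exp (- v) * ?z ^ j / fact j))
        \<le> (1 + v) * (exp (- v) * exp ?z)"
      using sum_poisson_weight_le[OF v z(1), of k] by (simp add: algebra_simps)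
    moreover have "poisson_weight v j * ((1 + real j) * r ^ j)
        = exp (- v) * ?z ^ j / fact j + real j * (exp (- v) * ?z ^ j / fact j)" for j
      unfolding eq[symmetric] by (simp add: algebra_simps)
    ultimately show ?thesis by (simp add: sum.distrib ex)
  qed
qed (rule submult)

lemma filterlim_log_level:
  fixes c u :: real
  assumes "filterlim t at_top F" "0 < c"
  shows "filterlim (\<lambda>n. ln (t n) / c + u) at_top F"
proof -
  have "filterlim (\<lambda>n. u + 1 / c * ln (t n)) at_top F"
    using assms(2)
    by (intro filterlim_tendsto_add_at_top[OF tendsto_const] filterlim_tendsto_pos_mult_at_top[OF tendsto_const]
        filterlim_compose[OF ln_at_top assms(1)]) auto
  then show ?thesis by (simp add: add.commute)
qed

text \<open>At this level \<open>t * q = exp (- (1 - r) * u)\<close>. The number of steps is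
  \<open>s * t\<close> with \<open>s\<close> free, because the number of jumps up to time
  \<open>t\<close> will only be known to be close to \<open>t\<close>.\<close>

lemma continuous_survival_tendsto:
  fixes u s :: real and t :: "nat \<Rightarrow> real"
  assumes submult: "\<And>v i k. 0 \<le> v \<Longrightarrow> 1 - (\<Sum>j<i+k. poisson_weight v j)
      \<le> (1 - (\<Sum>j<i. poisson_weight v j)) * (1 - (\<Sum>j<k. poisson_weight v j))"
    and t: "filterlim t at_top sequentially" and s: "0 < s"
  shows "(\<lambda>n. survival (\<lambda>k. 1 - (\<Sum>j<k. poisson_weight (ln (t n) / (1 - r) + u) j)) (nat \<lfloor>s * t n\<rfloor>))
     \<longlonglongrightarrow> exp (- (1 - r) * (s * exp (- (1 - r) * u)))"
proof -
  have r: "0 < r" "r < 1" using r_pos r_less_1 .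
  obtain \<rho> where \<rho>: "0 < \<rho>" "\<rho> < 1" "2 * r * (1 / \<rho>) < 1 + r" "2 * \<rho> < 1 + r"
    using decay_rate by blast
  let ?\<gamma> = "1 - r"
  define v where "v n = ln (t n) / ?\<gamma> + u" for n
  define h where "h n = nat \<lfloor>s * t n\<rfloor>" for n
  define q where "q n = exp (- ?\<gamma> * v n)" for n
  \<comment> \<open>\<open>\<delta> = 2 * (1 - \<rho>) - (1 - r)\<close>: the square of
    \<open>A\<close> is \<open>q\<close> times \<open>exp (- \<delta> * v)\<close>.\<close>
  define \<delta> where "\<delta> = 1 + r - 2 * \<rho>"
  have \<delta>: "0 < \<delta>" using \<rho> by (simp add: \<delta>_def)
  define c where "c = \<delta> / ?\<gamma>"
  have c: "0 < c" using \<delta> r by (simp add: c_def)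
  have st: "filterlim (\<lambda>n. s * t n) at_top sequentially"
    by (rule filterlim_tendsto_pos_mult_at_top[OF tendsto_const s t])
  have h_top: "filterlim h at_top sequentially"
    unfolding h_def by (intro filterlim_compose[OF filterlim_nat_sequentially] filterlim_compose[OF filterlim_floor_sequentially] st)
  have v_top: "filterlim v at_top sequentially"
    unfolding v_def[abs_def] using r by (intro filterlim_log_level t) auto
  have exp_v: "exp (- x * v n) = exp (- x * u) * t n powr (- (x / ?\<gamma>))" if "0 < t n" for x n
    using that by (simp add: v_def powr_def exp_add[symmetric] algebra_simps)
  have q_eq: "q n = exp (- ?\<gamma> * u) / t n" if "0 < t n" for n
    using exp_v[OF that, of ?\<gamma>] r that by (simp add: q_def powr_minus divide_inverse)
  have ratio: "(\<lambda>n. real (h n) / t n) \<longlonglongrightarrow> s"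
  proof (rule tendsto_sandwich[of "\<lambda>n. s - 1 / t n" _ _ "\<lambda>_. s"])
    have ev: "\<forall>\<^sub>F n in sequentially. 1 \<le> t n \<and> 0 \<le> s * t n"
      using t st by (auto simp: filterlim_at_top eventually_conj_iff)
    show "\<forall>\<^sub>F n in sequentially. s - 1 / t n \<le> real (h n) / t n"
      using ev
    proof eventually_elim
      case (elim n)
      then have "s * t n - 1 \<le> real (h n)" unfolding h_def by linarith
      then have "(s * t n - 1) / t n \<le> real (h n) / t n" using elim by (intro divide_right_mono) auto
      then show ?case using elim by (simp add: diff_divide_distrib)
    qed
    show "\<forall>\<^sub>F n in sequentially. real (h n) / t n \<le> s"
      using ev
    proof eventually_elim
      case (elim n)
      then have "real (h n) \<le> s * t n" unfolding h_def by linarith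
      then show ?case using elim by (simp add: field_simps)
    qed
    have "(\<lambda>n. s - 1 / t n) \<longlonglongrightarrow> s - 0"
      by (intro tendsto_intros tendsto_divide_0[OF tendsto_const] filterlim_at_top_imp_at_infinity t)
    then show "(\<lambda>n. s - 1 / t n) \<longlonglongrightarrow> s" by simp
  qed simp
  \<comment> \<open>The last condition gives \<open>t n \<le> h n * h n\<close>, hence
    \<open>ln (t n) \<le> 2 * ln (h n)\<close>; this is the origin of \<open>2 / ?\<gamma>\<close>
    in the constant \<open>B\<close>.\<close>
  have big: "\<forall>\<^sub>F n in sequentially. 1 \<le> t n \<and> 0 \<le> v n \<and> real (h n) / t n \<le> 2 * s \<and> s / 2 \<le> real (h n) / t n \<and> 1 \<le> ln (real (h n))
     \<and> (2 / s)\<^sup>2 \<le> real (h n)"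
  proof -
    have h': "filterlim (\<lambda>n. real (h n)) at_top sequentially"
      by (rule filterlim_compose[OF filterlim_real_sequentially h_top])
    have "\<forall>\<^sub>F n in sequentially. real (h n) / t n < 2 * s" "\<forall>\<^sub>F n in sequentially. s / 2 < real (h n) / t n"
      using order_tendstoD(2)[OF ratio, of "2 * s"] order_tendstoD(1)[OF ratio, of "s / 2"] s by simp_all
    then have "\<forall>\<^sub>F n in sequentially. real (h n) / t n \<le> 2 * s" "\<forall>\<^sub>F n in sequentially. s / 2 \<le> real (h n) / t n"
      by (auto elim: eventually_mono)
    moreover have "\<forall>\<^sub>F n in sequentially. 1 \<le> ln (real (h n))"
      using filterlim_compose[OF ln_at_top h'] by (simp add: filterlim_at_top)
    ultimately show ?thesis
      using t v_top h' by (simp add: filterlim_at_top eventually_conj_iff)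
  qed
  define C where "C = 2 * s * exp (- ?\<gamma> * u)"
  have "(\<lambda>n. survival (\<lambda>k. 1 - (\<Sum>j<k. poisson_weight (v n) j)) (h n) - exp (- (1 - r) * real (h n) * q n)) \<longlonglongrightarrow> 0"
  proof (rule survival_tendsto[where \<kappa> = "\<lambda>n. 1 + v n" and A = "\<lambda>n. exp (- (1 - \<rho>) * v n)" and l = "1 / \<rho>"
        and B = "1 + \<bar>u\<bar> + 2 / ?\<gamma>" and C = C and C' = "exp (- \<delta> * u) * (2 * s) powr c" and c = c])
    show "\<forall>\<^sub>F n in sequentially. level TYPE('d) (poisson_weight (v n)) (q n) (1 + v n) \<and> 0 \<le> 1 + v n \<and>
          1 + v n \<le> (1 + \<bar>u\<bar> + 2 / ?\<gamma>) * ln (real (h n)) \<and> real (h n) * q n \<le> C \<and> 0 \<le> exp (- (1 - \<rho>) * v n) \<and>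
          (\<forall>k. (\<Sum>j<k. poisson_weight (v n) j) \<le> exp (- (1 - \<rho>) * v n) * (1 / \<rho>) ^ k) \<and>
          (exp (- (1 - \<rho>) * v n))\<^sup>2 \<le> exp (- \<delta> * u) * (2 * s) powr c * (q n * real (h n) powr (- c))"
      using big
    proof eventually_elim
      case (elim n)
      then have t0: "0 < t n" and v0: "0 \<le> v n" by auto
      have ln1: "1 \<le> ln (real (h n))" using elim by simp
      have h0: "0 < real (h n)" using ln1 by (cases "h n = 0") auto
      have lev: "level TYPE('d) (poisson_weight (v n)) (q n) (1 + v n)"
        unfolding q_def by (rule level_poisson[OF v0 submult[OF v0]])
      have "t n \<le> real (h n) * (2 / s)"
        using elim t0 s by (simp add: field_simps)
      also have "\<dots> \<le> real (h n) * real (h n)"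
      proof (rule mult_left_mono)
        have "2 / s \<le> sqrt (real (h n))" using elim s by (intro real_le_rsqrt) auto
        also have "\<dots> \<le> real (h n)" using h0 by (intro real_le_lsqrt self_le_power) auto
        finally show "2 / s \<le> real (h n)" .
      qed simp
      finally have "ln (t n) \<le> ln (real (h n) * real (h n))" using t0 h0 by simp
      then have "ln (t n) \<le> 2 * ln (real (h n))" using h0 by (simp add: ln_mult)
      then have "ln (t n) / ?\<gamma> \<le> 2 * ln (real (h n)) / ?\<gamma>" using r by (intro divide_right_mono) auto
      moreover have "\<bar>u\<bar> * 1 \<le> \<bar>u\<bar> * ln (real (h n))" using ln1 by (intro mult_left_mono) auto
      ultimately have \<kappa>: "1 + v n \<le> (1 + \<bar>u\<bar> + 2 / ?\<gamma>) * ln (real (h n))"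
        using ln1 unfolding v_def distrib_right by simp
      have "real (h n) * q n = real (h n) / t n * exp (- ?\<gamma> * u)" using q_eq[OF t0] by simp
      also have "\<dots> \<le> C" unfolding C_def using elim by (intro mult_right_mono) auto
      finally have hq: "real (h n) * q n \<le> C" .
      \<comment> \<open>Chernoff bound: \<open>\<rho> ^ k \<le> \<rho> ^ j\<close> for
        \<open>j < k\<close>, and the Poisson generating function at \<open>\<rho>\<close> is
        \<open>exp (- (1 - \<rho>) * v)\<close>.\<close>
      have A: "(\<Sum>j<k. poisson_weight (v n) j) \<le> exp (- (1 - \<rho>) * v n) * (1 / \<rho>) ^ k" for k
      proof -
        have "(\<Sum>j<k. poisson_weight (v n) j) \<le> (\<Sum>j<k. (1 / \<rho>) ^ k * (exp (- v n) * (\<rho> * v n) ^ j / fact j))"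
        proof (rule sum_mono)
          fix j assume "j \<in> {..<k}"
          then have "\<rho> ^ k \<le> \<rho> ^ j" using \<rho> by (intro power_decreasing) auto
          then have "1 \<le> (1 / \<rho>) ^ k * \<rho> ^ j" using \<rho> by (simp add: power_divide field_simps)
          then have "1 * poisson_weight (v n) j \<le> ((1 / \<rho>) ^ k * \<rho> ^ j) * poisson_weight (v n) j"
            using v0 by (intro mult_right_mono) (auto simp: poisson_weight_def)
          then show "poisson_weight (v n) j \<le> (1 / \<rho>) ^ k * (exp (- v n) * (\<rho> * v n) ^ j / fact j)"
            by (simp add: poisson_weight_def power_mult_distrib mult_ac)
        qed
        also have "\<dots> = (1 / \<rho>) ^ k * (\<Sum>j<k. exp (- v n) * (\<rho> * v n) ^ j / fact j)"
          by (rule sum_distrib_left[symmetric])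
        also have "\<dots> \<le> (1 / \<rho>) ^ k * (exp (- v n) * exp (\<rho> * v n))"
          using \<rho> v0 by (intro mult_left_mono sum_poisson_weight_le) auto
        also have "exp (- v n) * exp (\<rho> * v n) = exp (- (1 - \<rho>) * v n)"
          by (simp add: exp_add[symmetric] algebra_simps)
        finally show ?thesis by (simp add: mult.commute)
      qed
      have "(exp (- (1 - \<rho>) * v n))\<^sup>2 = q n * exp (- \<delta> * v n)"
        by (simp add: q_def power2_eq_square exp_add[symmetric] \<delta>_def algebra_simps)
      also have "exp (- \<delta> * v n) = exp (- \<delta> * u) * t n powr (- c)"
        using exp_v[OF t0, of \<delta>] by (simp add: c_def)
      also have "t n powr (- c) \<le> (real (h n) / (2 * s)) powr (- c)"
        using elim t0 s c h0 by (intro powr_mono2') (auto simp: field_simps)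
      also have "\<dots> = (2 * s) powr c * real (h n) powr (- c)"
        using s h0 by (simp add: powr_divide powr_minus field_simps)
      finally have "(exp (- (1 - \<rho>) * v n))\<^sup>2 \<le> q n * (exp (- \<delta> * u) * ((2 * s) powr c * real (h n) powr (- c)))"
        by (simp add: q_def)
      then have "(exp (- (1 - \<rho>) * v n))\<^sup>2 \<le> exp (- \<delta> * u) * (2 * s) powr c * (q n * real (h n) powr (- c))"
        by (simp add: mult_ac)
      then show ?case using lev \<kappa> hq A v0 by simp
    qed
  qed (use \<rho> c h_top in auto)
  moreover have "(\<lambda>n. exp (- (1 - r) * real (h n) * q n)) \<longlonglongrightarrow> exp (- (1 - r) * (s * exp (- ?\<gamma> * u)))"
  proof -
    have "(\<lambda>n. exp (- (1 - r) * (real (h n) / t n * exp (- ?\<gamma> * u)))) \<longlonglongrightarrow> exp (- (1 - r) * (s * exp (- ?\<gamma> * u)))"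
      by (intro tendsto_intros ratio)
    moreover have "\<forall>\<^sub>F n in sequentially. exp (- (1 - r) * (real (h n) / t n * exp (- ?\<gamma> * u))) = exp (- (1 - r) * real (h n) * q n)"
      using big by eventually_elim (simp add: q_eq)
    ultimately show ?thesis by (rule Lim_transform_eventually)
  qed
  ultimately have "(\<lambda>n. survival (\<lambda>k. 1 - (\<Sum>j<k. poisson_weight (v n) j)) (h n) - exp (- (1 - r) * real (h n) * q n)
      + exp (- (1 - r) * real (h n) * q n)) \<longlonglongrightarrow> 0 + exp (- (1 - r) * (s * exp (- ?\<gamma> * u)))"
    by (rule tendsto_add)
  then show ?thesis by (simp add: v_def h_def)
qed

end

section \<open>Transfer to the random walk\<close>

context simple_random_walk
begin

lemma measurable_step [measurable]:
  "(\<lambda>\<omega>. S (Suc n) \<omega> - S n \<omega>) \<in> measurable M (count_space UNIV)"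
  using indep_steps by (simp add: indep_vars_def)

lemma measurable_S [measurable]: "S n \<in> measurable M (count_space UNIV)"
proof (induction n)
  case 0
  have "(\<lambda>_. 0) \<in> measurable M (count_space UNIV)" by simp
  then show ?case by (rule measurable_cong[THEN iffD2, rotated]) (simp add: start)
next
  case (Suc n)
  have "(\<lambda>\<omega>. S (Suc n) \<omega> - S n \<omega> + z) \<in> measurable M (count_space UNIV)" for z
    by (rule measurable_compose[OF measurable_step]) simp
  then have "(\<lambda>\<omega>. S (Suc n) \<omega> - S n \<omega> + S n \<omega>) \<in> measurable M (count_space UNIV)"
    by (rule measurable_compose_countable[where f = "\<lambda>z \<omega>. S (Suc n) \<omega> - S n \<omega> + z", OF _ Suc])
  then show ?case by simp
qed

definition steps :: "nat \<Rightarrow> 'a \<Rightarrow> (int ^ 'd) list" where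
  "steps n \<omega> = map (\<lambda>k. S (Suc k) \<omega> - S k \<omega>) [0..<n]"

lemma length_steps [simp]: "length (steps n \<omega>) = n"
  by (simp add: steps_def)

lemma sum_take_steps: "\<omega> \<in> space M \<Longrightarrow> k \<le> n \<Longrightarrow> sum_list (take k (steps n \<omega>)) = S k \<omega>"
proof (induction k)
  case 0
  then show ?case by (simp add: start)
next
  case (Suc k)
  then have "take (Suc k) (steps n \<omega>) = take k (steps n \<omega>) @ [S (Suc k) \<omega> - S k \<omega>]"
    by (simp add: take_Suc_conv_app_nth) (simp add: steps_def)
  then show ?case using Suc by simp
qed

lemma path_steps: "\<omega> \<in> space M \<Longrightarrow> path 0 (steps n \<omega>) = map (\<lambda>k. S k \<omega>) [0..<n]"
  by (rule nth_equalityI) (auto simp: nth_path sum_take_steps)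

lemma steps_eq_iff: "length w = n \<Longrightarrow> steps n \<omega> = w \<longleftrightarrow> (\<forall>i<n. S (Suc i) \<omega> - S i \<omega> = w ! i)"
  by (auto simp: steps_def list_eq_iff_nth_eq)

lemma measurable_steps [measurable]: "steps n \<in> measurable M (count_space UNIV)"
proof (rule measurable_count_space_eq2_countable[THEN iffD2, OF _ ])
  show "steps n \<in> space M \<rightarrow> UNIV \<and> (\<forall>w\<in>UNIV. steps n -` {w} \<inter> space M \<in> events)"
  proof (intro conjI ballI)
    fix w
    show "steps n -` {w} \<inter> space M \<in> events"
    proof (cases "length w = n")
      case True
      then have "steps n -` {w} \<inter> space M = {\<omega> \<in> space M. \<forall>i\<in>{..<n}. S (Suc i) \<omega> - S i \<omega> = w ! i}"
        by (auto simp: steps_eq_iff)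
      also have "\<dots> \<in> events" by measurable
      finally show ?thesis .
    next
      case False
      then have "steps n -` {w} \<inter> space M = {}" by auto
      then show ?thesis by simp
    qed
  qed auto
qed

lemma prob_steps:
  assumes w: "w \<in> words unit_steps n"
  shows "prob {\<omega> \<in> space M. steps n \<omega> = w} = 1 / real (card (unit_steps :: (int ^ 'd) set)) ^ n"
proof (cases "n = 0")
  case True
  have "{\<omega> \<in> space M. steps n \<omega> = w} = space M" using True w by (auto simp: steps_def)
  then show ?thesis using True by (simp add: prob_space)
next
  case False
  let ?X = "\<lambda>i \<omega>. S (Suc i) \<omega> - S i \<omega>"
  have "{\<omega> \<in> space M. steps n \<omega> = w} = (\<Inter>i\<in>{..<n}. ?X i -` {w ! i} \<inter> space M)"
    using w False by (auto simp: steps_eq_iff length_words)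
  then have "prob {\<omega> \<in> space M. steps n \<omega> = w} = (\<Prod>i<n. prob (?X i -` {w ! i} \<inter> space M))"
    using indep_varsD[OF indep_steps, of "{..<n}" "\<lambda>i. {w ! i}"] False by auto
  also have "\<dots> = (\<Prod>i<n. 1 / real (card (unit_steps :: (int ^ 'd) set)))"
  proof (rule prod.cong)
    fix i assume "i \<in> {..<n}"
    then have "w ! i \<in> unit_steps" using w by (auto simp: words_def)
    moreover have "prob (?X i -` {w ! i} \<inter> space M) = measure (distr M (count_space UNIV) (?X i)) {w ! i}"
      by (rule measure_distr[symmetric]) auto
    moreover have "\<dots> = pmf (pmf_of_set unit_steps) (w ! i)"
      unfolding distr_steps by (rule measure_pmf_single)
    ultimately show "prob (?X i -` {w ! i} \<inter> space M) = 1 / real (card (unit_steps :: (int ^ 'd) set))"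
      using finite_unit_steps[where ?'d = 'd] by (subst (asm) pmf_of_set) auto
  qed simp
  finally show ?thesis by (simp add: power_one_over)
qed

text \<open>Conditioning on the first \<open>n\<close> steps: given the word \<open>w\<close> the
  event \<open>E\<close> becomes \<open>B w\<close>, which is independent of the steps. For events
  of the walk \<open>B w\<close> is trivial; in continuous time it concerns the holding
  times.\<close>

lemma prob_by_steps:
  assumes E: "E \<in> events" and B: "\<And>w. w \<in> words unit_steps n \<Longrightarrow> B w \<in> events"
    and EB: "\<And>w \<omega>. w \<in> words unit_steps n \<Longrightarrow> \<omega> \<in> space M \<Longrightarrow> steps n \<omega> = w \<Longrightarrow> \<omega> \<in> E \<longleftrightarrow> \<omega> \<in> B w"
    and indep: "\<And>w. w \<in> words unit_steps n \<Longrightarrow>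
      prob ({\<omega> \<in> space M. steps n \<omega> = w} \<inter> B w) = prob {\<omega> \<in> space M. steps n \<omega> = w} * prob (B w)"
  shows "prob E = avg unit_steps n (\<lambda>w. prob (B w))"
proof -
  let ?U = "unit_steps :: (int ^ 'd) set"
  let ?T = "\<lambda>w. {\<omega> \<in> space M. steps n \<omega> = w}"
  let ?W = "words ?U n"
  have T: "?T w \<in> events" for w by measurable
  have fin: "finite ?W" by (rule finite_words[OF finite_unit_steps])
  have cU: "0 < card ?U" by (simp add: card_unit_steps)
  have "prob (\<Union>w\<in>?W. ?T w) = (\<Sum>w\<in>?W. prob (?T w))"
    using T by (intro finite_measure_finite_Union fin) (auto simp: disjoint_family_on_def)
  also have "\<dots> = 1" using cU by (simp add: prob_steps card_words[OF finite_unit_steps])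
  finally have "AE \<omega> in M. \<omega> \<in> (\<Union>w\<in>?W. ?T w)" by (rule AE_prob_1)
  then have "AE \<omega> in M. \<omega> \<in> E \<longleftrightarrow> \<omega> \<in> (\<Union>w\<in>?W. ?T w \<inter> B w)"
    using AE_space by eventually_elim (use EB in auto)
  then have "prob E = prob (\<Union>w\<in>?W. ?T w \<inter> B w)"
    using E B T fin by (intro finite_measure_eq_AE sets.finite_UN sets.Int) auto
  also have "\<dots> = (\<Sum>w\<in>?W. prob (?T w \<inter> B w))"
    using T B by (intro finite_measure_finite_Union fin) (auto simp: disjoint_family_on_def)
  also have "\<dots> = (\<Sum>w\<in>?W. 1 / real (card ?U) ^ n * prob (B w))"
    by (intro sum.cong) (simp_all add: indep prob_steps)
  finally show ?thesis by (simp add: avg_def sum_divide_distrib)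
qed

lemma prob_steps_pred:
  "prob {\<omega> \<in> space M. Q (steps n \<omega>)} = avg unit_steps n (\<lambda>w. of_bool (Q w))"
proof -
  have "prob {\<omega> \<in> space M. Q (steps n \<omega>)} = avg unit_steps n (\<lambda>w. prob (if Q w then space M else {}))"
  proof (rule prob_by_steps)
    show "{\<omega> \<in> space M. Q (steps n \<omega>)} \<in> events" by measurable
  qed (auto simp: prob_space)
  also have "(\<lambda>w. prob (if Q w then space M else {})) = (\<lambda>w. of_bool (Q w))"
    by (auto simp: prob_space)
  finally show ?thesis .
qed

text \<open>\<open>Suc n\<close> steps are needed because \<open>path\<close> omits the end
  point.\<close>

lemma discrete_local_time_eq:
  assumes "\<omega> \<in> space M"
  shows "discrete_local_time S n x \<omega> = count_list (path 0 (steps (Suc n) \<omega>)) x"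
proof -
  have "count_list (map (\<lambda>k. S k \<omega>) [0..<m]) x = (\<Sum>k<m. indicator {x} (S k \<omega>))" for m
    by (induction m) (auto simp: indicator_def)
  then show ?thesis
    using assms by (simp only: discrete_local_time_def path_steps lessThan_Suc_atMost)
qed

lemma max_discrete_local_time_le_iff:
  assumes "\<omega> \<in> space M"
  shows "max_discrete_local_time S n \<omega> \<le> k \<longleftrightarrow> (\<forall>x. count_list (path 0 (steps (Suc n) \<omega>)) x \<le> k)"
proof -
  let ?R = "range (\<lambda>x. discrete_local_time S n x \<omega>)"
  have "?R \<subseteq> {..Suc n}"
    using count_le_length[of "path 0 (steps (Suc n) \<omega>)"] by (auto simp: discrete_local_time_eq[OF assms])
  then have "finite ?R" by (rule finite_subset) simp
  then show ?thesis
    unfolding max_discrete_local_time_def by (subst Max_le_iff) (auto simp: discrete_local_time_eq[OF assms])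
qed

lemma prob_max_discrete_local_time:
  "prob {\<omega> \<in> space M. max_discrete_local_time S n \<omega> \<le> k}
   = avg (unit_steps :: (int ^ 'd) set) (Suc n) (\<lambda>w. occ_prod (\<lambda>i. of_bool (i \<le> k)) (path 0 w))"
proof -
  have "{\<omega> \<in> space M. max_discrete_local_time S n \<omega> \<le> k}
      = {\<omega> \<in> space M. \<forall>x. count_list (path 0 (steps (Suc n) \<omega>)) x \<le> k}"
    by (auto simp: max_discrete_local_time_le_iff)
  also have "prob \<dots> = avg (unit_steps :: (int ^ 'd) set) (Suc n) (\<lambda>w. of_bool (\<forall>x. count_list (path 0 w) x \<le> k))"
    by (rule prob_steps_pred[where Q = "\<lambda>w. \<forall>x. count_list (path 0 w) x \<le> k"])
  also have "(\<lambda>w. of_bool (\<forall>x. count_list (path 0 w) x \<le> k)) = (\<lambda>w. occ_prod (\<lambda>i. of_bool (i \<le> k)) (path (0 :: int ^ 'd) w))"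
  proof
    fix w :: "(int ^ 'd) list"
    have "(\<forall>x. count_list (path 0 w) x \<le> k) \<longleftrightarrow> (\<forall>x\<in>set (path 0 w). count_list (path 0 w) x \<le> k)"
      using count_list_0_iff[of "path 0 w"] by (metis zero_le)
    then show "of_bool (\<forall>x. count_list (path 0 w) x \<le> k) = occ_prod (\<lambda>i. of_bool (i \<le> k)) (path (0 :: int ^ 'd) w)"
      by (auto simp: occ_prod_def prod_zero_iff intro!: prod.neutral[symmetric])
  qed
  finally show ?thesis .
qed

lemma escape_prob_eq:
  assumes "3 \<le> CARD('d)"
  shows "escape_prob M S = 1 - lattice.r TYPE('d)"
proof -
  interpret lattice "TYPE('d)" by standard (rule assms)
  let ?A = "\<lambda>m. {\<omega> \<in> space M. \<forall>t\<in>{1..m}. sum_list (take t (steps m \<omega>)) \<noteq> 0}"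
  have A: "?A m = {\<omega> \<in> space M. \<forall>t\<in>{1..m}. S t \<omega> \<noteq> 0}" for m
    by (auto simp: sum_take_steps)
  have "(\<lambda>m. prob (?A m)) \<longlonglongrightarrow> prob (\<Inter>m. ?A m)"
  proof (rule finite_Lim_measure_decseq)
    show "range ?A \<subseteq> events" by auto
    show "decseq ?A" unfolding A by (auto simp: decseq_def)
  qed
  moreover have "(\<Inter>m. ?A m) = {\<omega> \<in> space M. \<forall>n\<ge>1. S n \<omega> \<noteq> 0}"
  proof -
    have "(\<forall>m. \<forall>t\<in>{1..m}. S t \<omega> \<noteq> 0) \<longleftrightarrow> (\<forall>n\<ge>1. S n \<omega> \<noteq> 0)" for \<omega>
      by (metis atLeastAtMost_iff order_refl)
    then show ?thesis unfolding A by blast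
  qed
  moreover have "prob (?A m) = no_return m" for m
    unfolding no_return_def by (rule prob_steps_pred[where Q = "\<lambda>w. \<forall>t\<in>{1..m}. sum_list (take t w) \<noteq> 0"])
  ultimately show ?thesis
    using no_return_tendsto by (auto simp: escape_prob_def intro: LIMSEQ_unique)
qed

end

text \<open>\<open>\<epsilon>\<close> is obtained by solving for the exponent. An additive error
  turns into a factor \<open>1 + \<delta>\<close> because \<open>\<Lambda>\<close> is bounded above,
  and into a relative error of the exponent because \<open>\<Lambda>\<close> is bounded away from
  0.\<close>

lemma exponent_correction:
  fixes P \<Lambda> :: "nat \<Rightarrow> real"
  assumes lim: "(\<lambda>n. P n - exp (- \<Lambda> n)) \<longlonglongrightarrow> 0"
    and bounds: "\<forall>\<^sub>F n in sequentially. c \<le> \<Lambda> n \<and> \<Lambda> n \<le> C" and c: "0 < c"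
  shows "\<exists>\<epsilon>::nat \<Rightarrow> real. \<epsilon> \<in> o(\<lambda>_. 1) \<and> (\<forall>\<^sub>F n in sequentially. P n = exp (- (1 + \<epsilon> n) * \<Lambda> n))"
proof -
  define \<epsilon> where "\<epsilon> n = - ln (P n) / \<Lambda> n - 1" for n
  define \<delta> where "\<delta> n = (P n - exp (- \<Lambda> n)) * exp (\<Lambda> n)" for n
  have \<delta>: "\<delta> \<longlonglongrightarrow> 0"
  proof (rule Lim_null_comparison)
    show "\<forall>\<^sub>F n in sequentially. norm (\<delta> n) \<le> \<bar>P n - exp (- \<Lambda> n)\<bar> * exp C"
      using bounds by eventually_elim (auto simp: \<delta>_def abs_mult intro!: mult_left_mono)
    show "(\<lambda>n. \<bar>P n - exp (- \<Lambda> n)\<bar> * exp C) \<longlonglongrightarrow> 0"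
      using tendsto_rabs[OF lim] by (intro tendsto_mult_left_zero) simp
  qed
  have ln: "(\<lambda>n. ln (1 + \<delta> n)) \<longlonglongrightarrow> 0"
    using tendsto_ln[OF tendsto_add[OF tendsto_const[of 1] \<delta>]] by simp
  have pos: "\<forall>\<^sub>F n in sequentially. 0 < 1 + \<delta> n"
    using order_tendstoD(1)[OF tendsto_add[OF tendsto_const[of 1] \<delta>], of 0] by simp
  have P: "P n = exp (- \<Lambda> n) * (1 + \<delta> n)" for n
    by (simp add: \<delta>_def algebra_simps exp_minus)
  have "\<epsilon> \<longlonglongrightarrow> 0"
  proof (rule Lim_null_comparison)
    show "\<forall>\<^sub>F n in sequentially. norm (\<epsilon> n) \<le> \<bar>ln (1 + \<delta> n)\<bar> / c"
      using bounds pos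
    proof eventually_elim
      case (elim n)
      then have "ln (P n) = - \<Lambda> n + ln (1 + \<delta> n)" by (simp add: P ln_mult)
      then have "\<epsilon> n = - ln (1 + \<delta> n) / \<Lambda> n"
      proof -
        have "\<epsilon> n = (- ln (P n) - \<Lambda> n) / \<Lambda> n" using elim c by (simp add: \<epsilon>_def diff_divide_distrib)
        also have "- ln (P n) - \<Lambda> n = - ln (1 + \<delta> n)" unfolding \<open>ln (P n) = _\<close> by simp
        finally show ?thesis .
      qed
      then have "norm (\<epsilon> n) = \<bar>ln (1 + \<delta> n)\<bar> / \<Lambda> n" using elim c by simp
      also have "\<dots> \<le> \<bar>ln (1 + \<delta> n)\<bar> / c" using elim c by (intro divide_left_mono) auto
      finally show ?case .
    qed
    show "(\<lambda>n. \<bar>ln (1 + \<delta> n)\<bar> / c) \<longlonglongrightarrow> 0"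
      using tendsto_divide[OF tendsto_rabs[OF ln] tendsto_const[of c]] c by simp
  qed
  then have "\<epsilon> \<in> o(\<lambda>_. 1)" by (intro smalloI_tendsto) auto
  moreover have "\<forall>\<^sub>F n in sequentially. P n = exp (- (1 + \<epsilon> n) * \<Lambda> n)"
    using bounds pos
  proof eventually_elim
    case (elim n)
    then have "0 < P n" by (simp add: P)
    moreover have "- (1 + \<epsilon> n) * \<Lambda> n = ln (P n)" using elim c by (simp add: \<epsilon>_def)
    ultimately show ?case by simp
  qed
  ultimately show ?thesis by blast
qed

theorem (in simple_random_walk) max_discrete_local_time_asymptotics:
  fixes u :: real
  assumes dim: "3 \<le> CARD('d)"
  defines "\<gamma> \<equiv> escape_prob M S"
  shows "\<exists>\<epsilon>::nat \<Rightarrow> real. \<epsilon> \<in> o(\<lambda>_. 1) \<and>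
     (\<forall>\<^sub>F n in sequentially.
       prob {\<omega> \<in> space M. real (max_discrete_local_time S n \<omega>) \<le> log_rate \<gamma> * ln (real n) + u}
         = exp (- (1 + \<epsilon> n) * osc_factor \<gamma> n u * \<gamma> * (1 - \<gamma>) powr u))"
proof -
  interpret lattice "TYPE('d)" by standard (rule dim)
  have \<gamma>: "\<gamma> = 1 - r" unfolding \<gamma>_def by (rule escape_prob_eq[OF dim])
  have r: "0 < r" "r < 1" using r_pos r_less_1 .
  let ?\<alpha> = "- 1 / ln r"
  have \<alpha>: "log_rate \<gamma> = ?\<alpha>" "0 < ?\<alpha>" "?\<alpha> * ln r = - 1" using r by (auto simp: log_rate_def \<gamma> field_simps)
  define k where "k n = nat \<lfloor>?\<alpha> * ln (real n) + u\<rfloor>" for n :: nat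
  define P where "P n = prob {\<omega> \<in> space M. real (max_discrete_local_time S n \<omega>) \<le> ?\<alpha> * ln (real n) + u}" for n
  define \<Lambda> where "\<Lambda> n = osc_factor \<gamma> n u * \<gamma> * (1 - \<gamma>) powr u" for n
  have "filterlim (\<lambda>n::nat. ?\<alpha> * ln (real n) + u) at_top sequentially"
    using \<alpha>(2) by real_asymp
  then have "\<forall>\<^sub>F n in sequentially. 0 \<le> ?\<alpha> * ln (real n) + u"
    unfolding filterlim_at_top by blast
  then have ev: "\<forall>\<^sub>F n in sequentially. 0 \<le> ?\<alpha> * ln (real n) + u \<and> 1 \<le> n"
    using eventually_ge_at_top by (rule eventually_conj)
  obtain C where C: "\<forall>\<^sub>F n in sequentially. real (Suc n) * r ^ k n \<le> C"
    using discrete_survival_tendsto(2)[of u] unfolding k_def by blast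
  have P: "P n = survival (\<lambda>i. of_bool (i \<le> k n)) (Suc n)" if "0 \<le> ?\<alpha> * ln (real n) + u" for n
  proof -
    have "real m \<le> ?\<alpha> * ln (real n) + u \<longleftrightarrow> m \<le> k n" for m
      using that unfolding k_def by (auto simp: le_nat_iff le_floor_iff)
    then show ?thesis
      unfolding P_def survival_def prob_max_discrete_local_time[symmetric] by simp
  qed
  \<comment> \<open>The powers \<open>(1 - \<gamma>) powr (- u)\<close> and
    \<open>(1 - \<gamma>) powr u\<close> cancel: the oscillating factor only records the rounding of
    the level.\<close>
  have \<Lambda>: "\<Lambda> n = (1 - r) * (real n * r ^ k n)" if "0 \<le> ?\<alpha> * ln (real n) + u" for n
  proof -
    have "r powi \<lfloor>?\<alpha> * ln (real n) + u\<rfloor> = r ^ k n"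
      using that by (simp add: k_def power_int_def)
    moreover have "r powr (- u) * r powr u = 1" using r by (simp add: powr_add[symmetric])
    moreover have "x * a * b * g * c = (a * c) * (g * (x * b))" for x a b g c :: real
      by (simp only: mult_ac)
    ultimately show ?thesis
      unfolding \<Lambda>_def osc_factor_def \<alpha>(1) by (simp add: \<gamma>)
  qed
  \<comment> \<open>Rounding the level down can only increase \<open>r ^ k n\<close>, which keeps
    the exponent away from 0.\<close>
  have lower: "r powr u \<le> real n * r ^ k n" if n: "0 \<le> ?\<alpha> * ln (real n) + u" "1 \<le> n" for n
  proof -
    have "real (k n) \<le> ?\<alpha> * ln (real n) + u" using n unfolding k_def by linarith
    then have 1: "r powr (?\<alpha> * ln (real n) + u) \<le> r powr real (k n)" using r by (intro powr_mono') auto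
    have "r powr (?\<alpha> * ln (real n)) = real n powr (?\<alpha> * ln r)"
      using n r by (simp add: powr_def mult_ac)
    also have "\<dots> = 1 / real n" unfolding \<alpha>(3) using n by (simp add: powr_minus divide_inverse)
    finally have 2: "r powr (?\<alpha> * ln (real n)) = 1 / real n" .
    have "1 / real n * r powr u \<le> r ^ k n"
      using 1 unfolding powr_add 2 powr_realpow[OF r(1)] .
    then show ?thesis using n by (simp add: field_simps)
  qed
  have "(\<lambda>n. P n - exp (- \<Lambda> n)) \<longlonglongrightarrow> 0"
  proof -
    have "(\<lambda>n. r ^ k n) \<longlonglongrightarrow> 0"
    proof (rule Lim_null_comparison)
      show "\<forall>\<^sub>F n in sequentially. norm (r ^ k n) \<le> C * inverse (real (Suc n))"
        using C by eventually_elim (use r in \<open>simp add: field_simps\<close>)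
      show "(\<lambda>n. C * inverse (real (Suc n))) \<longlonglongrightarrow> 0"
        by (intro tendsto_mult_right_zero LIMSEQ_inverse_real_of_nat)
    qed
    then have e: "(\<lambda>n. 1 - exp (- ((1 - r) * r ^ k n))) \<longlonglongrightarrow> 1 - exp (- ((1 - r) * 0))"
      by (intro tendsto_intros)
    \<comment> \<open>Passing from the horizon \<open>Suc n\<close> to \<open>n\<close> changes the
      exponent by \<open>(1 - r) * r ^ k n\<close>, which tends to 0.\<close>
    have "(\<lambda>n. exp (- (1 - r) * real (Suc n) * r ^ k n) - exp (- ((1 - r) * (real n * r ^ k n)))) \<longlonglongrightarrow> 0"
    proof (rule Lim_null_comparison)
      show "\<forall>\<^sub>F n in sequentially. norm (exp (- (1 - r) * real (Suc n) * r ^ k n) - exp (- ((1 - r) * (real n * r ^ k n))))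
          \<le> 1 - exp (- ((1 - r) * r ^ k n))"
      proof (rule always_eventually, rule allI)
        fix n
        let ?x = "(1 - r) * r ^ k n" and ?y = "(1 - r) * (real n * r ^ k n)"
        have nn: "0 \<le> ?x" "0 \<le> ?y" using r by auto
        have "- (1 - r) * real (Suc n) * r ^ k n = - ?y + - ?x" by (simp add: algebra_simps)
        then have "exp (- (1 - r) * real (Suc n) * r ^ k n) - exp (- ?y) = - (exp (- ?y) * (1 - exp (- ?x)))"
          by (simp only: exp_add) (simp add: algebra_simps)
        then have "norm (exp (- (1 - r) * real (Suc n) * r ^ k n) - exp (- ?y)) = exp (- ?y) * (1 - exp (- ?x))"
          using nn by simp
        also have "\<dots> \<le> 1 * (1 - exp (- ?x))" using nn by (intro mult_right_mono) auto
        finally show "norm (exp (- (1 - r) * real (Suc n) * r ^ k n) - exp (- ?y)) \<le> 1 - exp (- ((1 - r) * r ^ k n))"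
          unfolding mult_1 .
      qed
    qed (use e in simp)
    from tendsto_add[OF discrete_survival_tendsto(1)[of u, folded k_def] this]
    have "(\<lambda>n. survival (\<lambda>i. of_bool (i \<le> k n)) (Suc n) - exp (- ((1 - r) * (real n * r ^ k n)))) \<longlonglongrightarrow> 0"
      by (simp add: k_def)
    moreover have "\<forall>\<^sub>F n in sequentially. survival (\<lambda>i. of_bool (i \<le> k n)) (Suc n) - exp (- ((1 - r) * (real n * r ^ k n))) = P n - exp (- \<Lambda> n)"
      using ev by eventually_elim (simp add: P \<Lambda>)
    ultimately show ?thesis by (rule Lim_transform_eventually)
  qed
  moreover have "\<forall>\<^sub>F n in sequentially. (1 - r) * r powr u \<le> \<Lambda> n \<and> \<Lambda> n \<le> (1 - r) * C"
    using ev C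
  proof eventually_elim
    case (elim n)
    have "real n * r ^ k n \<le> real (Suc n) * r ^ k n" using r by (intro mult_right_mono) auto
    also have "\<dots> \<le> C" using elim by simp
    finally show ?case using elim lower[of n] r by (auto simp: \<Lambda> intro!: mult_left_mono)
  qed
  ultimately have "\<exists>\<epsilon>::nat \<Rightarrow> real. \<epsilon> \<in> o(\<lambda>_. 1) \<and> (\<forall>\<^sub>F n in sequentially. P n = exp (- (1 + \<epsilon> n) * \<Lambda> n))"
    by (rule exponent_correction) (use r in simp)
  then show ?thesis
    by (simp only: P_def \<Lambda>_def \<alpha>(1) mult.assoc)
qed

section \<open>Continuous time\<close>

definition arrival :: "(nat \<Rightarrow> 'a \<Rightarrow> real) \<Rightarrow> nat \<Rightarrow> 'a \<Rightarrow> real" where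
  "arrival \<tau> m \<omega> = (\<Sum>k<m. \<tau> k \<omega>)"

text \<open>The continuous local time at the instant of the \<open>m\<close>-th jump, when exactly
  \<open>m\<close> holding times have elapsed.\<close>

definition weighted_time :: "(nat \<Rightarrow> 'a \<Rightarrow> 'b) \<Rightarrow> (nat \<Rightarrow> 'a \<Rightarrow> real) \<Rightarrow> nat \<Rightarrow> 'b \<Rightarrow> 'a \<Rightarrow> real" where
  "weighted_time S \<tau> m x \<omega> = (\<Sum>k<m. indicator {x} (S k \<omega>) * \<tau> k \<omega>)"

lemma arrival_Suc: "arrival \<tau> (Suc m) \<omega> = arrival \<tau> m \<omega> + \<tau> m \<omega>"
  by (simp add: arrival_def)

lemma jump_count_arrival: "jump_count \<tau> t \<omega> = (LEAST n. t < arrival \<tau> (Suc n) \<omega>)"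
  by (simp add: jump_count_def arrival_def lessThan_Suc_atMost)

section \<open>Sample paths with positive holding times\<close>

context
  fixes S :: "nat \<Rightarrow> 'a \<Rightarrow> 'b" and \<tau> :: "nat \<Rightarrow> 'a \<Rightarrow> real" and \<omega> :: 'a
  assumes pos: "\<And>k. 0 < \<tau> k \<omega>"
begin

lemma arrival_mono: "i \<le> k \<Longrightarrow> arrival \<tau> i \<omega> \<le> arrival \<tau> k \<omega>"
  unfolding arrival_def using pos by (intro sum_mono2) (auto simp: less_imp_le)

lemma arrival_nonneg: "0 \<le> arrival \<tau> k \<omega>"
  unfolding arrival_def using pos by (intro sum_nonneg) (auto simp: less_imp_le)

lemma jump_count_eq:
  assumes "arrival \<tau> k \<omega> \<le> s" "s < arrival \<tau> (Suc k) \<omega>"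
  shows "jump_count \<tau> s \<omega> = k"
  unfolding jump_count_arrival
proof (rule Least_equality)
  fix y assume y: "s < arrival \<tau> (Suc y) \<omega>"
  show "k \<le> y"
  proof (rule ccontr)
    assume "\<not> k \<le> y"
    then have "arrival \<tau> (Suc y) \<omega> \<le> arrival \<tau> k \<omega>" by (intro arrival_mono) simp
    then show False using assms y by simp
  qed
qed (rule assms)

lemma indicator_continuous_walk:
  assumes "0 \<le> s" "s < arrival \<tau> m \<omega>"
  shows "indicator {x} (continuous_walk S \<tau> s \<omega>)
    = (\<Sum>k<m. indicator {x} (S k \<omega>) * indicator {arrival \<tau> k \<omega>..<arrival \<tau> (Suc k) \<omega>} s :: real)"
  using assms(2)
proof (induction m)
  case 0
  then show ?case using assms(1) by (simp add: arrival_def)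
next
  case (Suc m)
  show ?case
  proof (cases "s < arrival \<tau> m \<omega>")
    case True
    then show ?thesis using Suc.IH by simp
  next
    case False
    have "(\<Sum>k<m. indicator {x} (S k \<omega>) * indicator {arrival \<tau> k \<omega>..<arrival \<tau> (Suc k) \<omega>} s :: real) = 0"
    proof (intro sum.neutral ballI)
      fix k assume "k \<in> {..<m}"
      then have "arrival \<tau> (Suc k) \<omega> \<le> s" using False arrival_mono[of "Suc k" m] by simp
      then show "indicator {x} (S k \<omega>) * indicator {arrival \<tau> k \<omega>..<arrival \<tau> (Suc k) \<omega>} s = (0 :: real)" by simp
    qed
    moreover have "jump_count \<tau> s \<omega> = m" using False Suc.prems by (intro jump_count_eq) auto
    ultimately show ?thesis using False Suc.prems by (simp add: continuous_walk_def)
  qed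
qed

lemma has_bochner_integral_weighted_time:
  "has_bochner_integral lborel
    (\<lambda>s. \<Sum>k<m. indicator {x} (S k \<omega>) * indicator {arrival \<tau> k \<omega>..<arrival \<tau> (Suc k) \<omega>} s :: real)
    (weighted_time S \<tau> m x \<omega>)"
  unfolding weighted_time_def
proof (intro has_bochner_integral_sum has_bochner_integral_mult_right)
  fix k
  have "has_bochner_integral lborel (indicator {arrival \<tau> k \<omega>..<arrival \<tau> (Suc k) \<omega>} :: real \<Rightarrow> real)
     (measure lborel {arrival \<tau> k \<omega>..<arrival \<tau> (Suc k) \<omega>})"
    using pos[of k] by (intro has_bochner_integral_real_indicator) (auto simp: arrival_Suc)
  then show "has_bochner_integral lborel (indicator {arrival \<tau> k \<omega>..<arrival \<tau> (Suc k) \<omega>} :: real \<Rightarrow> real) (\<tau> k \<omega>)"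
    using pos[of k] by (simp add: arrival_Suc less_imp_le)
qed

text \<open>Up to time \<open>t\<close> the walk stays within its first \<open>m\<close> holding
  periods, and the weighted time counts those spent at \<open>x\<close> in full.\<close>

lemma continuous_local_time_le_weighted_time:
  assumes "t < arrival \<tau> m \<omega>"
  shows "continuous_local_time (continuous_walk S \<tau>) t x \<omega> \<le> weighted_time S \<tau> m x \<omega>"
proof -
  let ?H = "\<lambda>s. \<Sum>k<m. indicator {x} (S k \<omega>) * indicator {arrival \<tau> k \<omega>..<arrival \<tau> (Suc k) \<omega>} s :: real"
  have "continuous_local_time (continuous_walk S \<tau>) t x \<omega>
      = integral\<^sup>L lborel (\<lambda>s. indicator {0..t} s *\<^sub>R indicator {x} (continuous_walk S \<tau> s \<omega>))"
    by (simp add: continuous_local_time_def set_lebesgue_integral_def)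
  also have "\<dots> \<le> integral\<^sup>L lborel ?H"
  proof (rule integral_mono')
    show "integrable lborel ?H" using has_bochner_integral_weighted_time by (rule integrable.intros)
    fix s
    show "0 \<le> ?H s" by (intro sum_nonneg) simp
    then show "indicator {0..t} s *\<^sub>R indicator {x} (continuous_walk S \<tau> s \<omega>) \<le> ?H s"
      using indicator_continuous_walk[of s m x] assms by (cases "s \<in> {0..t}") auto
  qed
  also have "\<dots> = weighted_time S \<tau> m x \<omega>"
    using has_bochner_integral_weighted_time by (rule has_bochner_integral_integral_eq)
  finally show ?thesis .
qed

lemma measurable_continuous_walk_time:
  "(\<lambda>s. continuous_walk S \<tau> s \<omega>) \<in> measurable borel (count_space UNIV)"
proof -
  have "(\<lambda>s. jump_count \<tau> s \<omega>) \<in> measurable borel (count_space UNIV)"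
    unfolding jump_count_arrival by measurable
  then show ?thesis
    unfolding continuous_walk_def by (rule measurable_compose) simp
qed

lemma weighted_time_le_continuous_local_time:
  assumes "arrival \<tau> m \<omega> \<le> t"
  shows "weighted_time S \<tau> m x \<omega> \<le> continuous_local_time (continuous_walk S \<tau>) t x \<omega>"
proof -
  let ?H = "\<lambda>s. \<Sum>k<m. indicator {x} (S k \<omega>) * indicator {arrival \<tau> k \<omega>..<arrival \<tau> (Suc k) \<omega>} s :: real"
  let ?A = "{0..t} \<inter> {s. continuous_walk S \<tau> s \<omega> = x}"
  have ind: "(\<lambda>s. indicator {0..t} s *\<^sub>R indicator {x} (continuous_walk S \<tau> s \<omega>)) = (indicator ?A :: real \<Rightarrow> real)"
    by (auto simp: indicator_def)
  have "{s. continuous_walk S \<tau> s \<omega> = x} = (\<lambda>s. continuous_walk S \<tau> s \<omega>) -` {x} \<inter> space borel" by auto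
  also have "\<dots> \<in> sets borel" by (rule measurable_sets[OF measurable_continuous_walk_time]) simp
  finally have A: "?A \<in> sets lborel" by simp
  have "emeasure lborel ?A \<le> emeasure lborel {0..t}" by (rule emeasure_mono) auto
  also have "\<dots> < \<infinity>" by (cases "0 \<le> t") auto
  finally have fin: "emeasure lborel ?A < \<infinity>" .
  have "weighted_time S \<tau> m x \<omega> = integral\<^sup>L lborel ?H"
    using has_bochner_integral_weighted_time by (rule has_bochner_integral_integral_eq[symmetric])
  also have "\<dots> \<le> integral\<^sup>L lborel (indicator ?A)"
  proof (rule integral_mono')
    show "integrable lborel (indicator ?A :: real \<Rightarrow> real)"
      using A fin by (rule integrable_real_indicator)
    fix s
    show "?H s \<le> indicator ?A s"
    proof (cases "0 \<le> s \<and> s < arrival \<tau> m \<omega>")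
      case True
      then show ?thesis
        using indicator_continuous_walk[of s m x] assms by (auto simp: indicator_def)
    next
      case False
      have "?H s = 0"
      proof (intro sum.neutral ballI)
        fix k assume "k \<in> {..<m}"
        then have "arrival \<tau> (Suc k) \<omega> \<le> arrival \<tau> m \<omega>" by (intro arrival_mono) simp
        then show "indicator {x} (S k \<omega>) * indicator {arrival \<tau> k \<omega>..<arrival \<tau> (Suc k) \<omega>} s = (0 :: real)"
          using False arrival_nonneg[of k] by (auto simp: indicator_def)
      qed
      then show ?thesis by simp
    qed
  qed simp
  also have "\<dots> = continuous_local_time (continuous_walk S \<tau>) t x \<omega>"
    by (simp only: continuous_local_time_def set_lebesgue_integral_def ind)
  finally show ?thesis .
qed

end

lemma continuous_local_time_le:
  assumes "0 \<le> t"
  shows "continuous_local_time Y t x \<omega> \<le> t"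
proof -
  have "continuous_local_time Y t x \<omega> \<le> integral\<^sup>L lborel (indicator {0..t} :: real \<Rightarrow> real)"
    unfolding continuous_local_time_def set_lebesgue_integral_def
  proof (rule integral_mono')
    show "integrable lborel (indicator {0..t} :: real \<Rightarrow> real)"
      using assms by (intro integrable_real_indicator) auto
  qed (auto simp: indicator_def)
  then show ?thesis using assms by simp
qed

lemma max_continuous_local_time_le_iff:
  assumes "0 \<le> t"
  shows "max_continuous_local_time Y t \<omega> \<le> v \<longleftrightarrow> (\<forall>x. continuous_local_time Y t x \<omega> \<le> v)"
  unfolding max_continuous_local_time_def
  by (subst cSUP_le_iff) (auto intro!: bdd_aboveI2 continuous_local_time_le assms)

section \<open>Independent Gamma local times given the walk\<close>

context walk_with_holding_times
begin

lemma measurable_\<tau> [measurable]: "\<tau> n \<in> borel_measurable M"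
  using distributed_measurable[OF distr_holding[of n]] by simp

lemma measurable_arrival [measurable]: "arrival \<tau> m \<in> borel_measurable M"
  unfolding arrival_def[abs_def] by measurable

lemma measurable_weighted_time [measurable]: "weighted_time S \<tau> m x \<in> borel_measurable M"
  unfolding weighted_time_def[abs_def] by measurable

lemma AE_holding_pos: "AE \<omega> in M. \<forall>k. 0 < \<tau> k \<omega>"
proof (subst AE_all_countable, rule allI)
  fix k
  have "prob {\<omega> \<in> space M. \<tau> k \<omega> \<le> 0} = 0"
    using erlang_distributed_le[OF distr_holding[of k], of 0] by (simp add: erlang_CDF_at0)
  then have "AE \<omega> in M. \<not> \<tau> k \<omega> \<le> 0"
    by (intro prob_Collect_eq_0[THEN iffD1]) auto
  then show "AE \<omega> in M. 0 < \<tau> k \<omega>" by eventually_elim simp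
qed

lemma prob_sum_holding:
  assumes "finite J" "0 \<le> v"
  shows "prob {\<omega> \<in> space M. (\<Sum>k\<in>J. \<tau> k \<omega>) \<le> v} = 1 - (\<Sum>j<card J. poisson_weight v j)"
proof (cases "J = {}")
  case True
  then have "{\<omega> \<in> space M. (\<Sum>k\<in>J. \<tau> k \<omega>) \<le> v} = space M" using assms by auto
  then show ?thesis using True by (simp add: prob_space)
next
  case False
  have "distributed M lborel (\<lambda>\<omega>. \<Sum>k\<in>J. \<tau> k \<omega>) (erlang_density (card J - 1) 1)"
    by (rule exponential_distributed_sum[OF assms(1) False])
       (auto intro: distr_holding indep_vars_subset[OF indep_holding])
  from erlang_distributed_le[OF this _ assms(2)]
  have "prob {\<omega> \<in> space M. (\<Sum>k\<in>J. \<tau> k \<omega>) \<le> v} = erlang_CDF (card J - 1) 1 v" by simp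
  also have "\<dots> = 1 - (\<Sum>j\<le>card J - 1. poisson_weight v j)"
    using assms(2) by (simp add: erlang_CDF_def poisson_weight_def mult.commute)
  also have "{..card J - 1} = {..<card J}"
    using False assms(1) card_gt_0_iff[of J] by (simp flip: lessThan_Suc_atMost)
  finally show ?thesis .
qed

lemma prob_disjoint_sums:
  assumes I: "finite I" and K: "\<And>i. i \<in> I \<Longrightarrow> finite (K i)" "disjoint_family_on K I"
  shows "prob {\<omega> \<in> space M. \<forall>i\<in>I. (\<Sum>k\<in>K i. \<tau> k \<omega>) \<le> v}
    = (\<Prod>i\<in>I. prob {\<omega> \<in> space M. (\<Sum>k\<in>K i. \<tau> k \<omega>) \<le> v})"
proof (cases "I = {}")
  case True
  then show ?thesis by (simp add: prob_space)
next
  case False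
  have "indep_vars (\<lambda>i. PiM (K i) (\<lambda>_. borel)) (\<lambda>i \<omega>. restrict (\<lambda>k. \<tau> k \<omega>) (K i)) I"
    by (rule indep_vars_restrict[OF indep_holding _ K(2)]) auto
  then have "indep_vars (\<lambda>_. borel) (\<lambda>i \<omega>. (\<lambda>f. \<Sum>k\<in>K i. f k) (restrict (\<lambda>k. \<tau> k \<omega>) (K i))) I"
    by (rule indep_vars_compose2) (auto intro!: borel_measurable_sum measurable_component_singleton)
  then have ind: "indep_vars (\<lambda>_. borel) (\<lambda>i \<omega>. \<Sum>k\<in>K i. \<tau> k \<omega>) I"
    by (simp cong: sum.cong)
  have "prob (\<Inter>i\<in>I. (\<lambda>\<omega>. \<Sum>k\<in>K i. \<tau> k \<omega>) -` {..v} \<inter> space M)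
     = (\<Prod>i\<in>I. prob ((\<lambda>\<omega>. \<Sum>k\<in>K i. \<tau> k \<omega>) -` {..v} \<inter> space M))"
    by (rule indep_varsD[OF ind False I]) auto
  moreover have "(\<Inter>i\<in>I. (\<lambda>\<omega>. \<Sum>k\<in>K i. \<tau> k \<omega>) -` {..v} \<inter> space M) = {\<omega> \<in> space M. \<forall>i\<in>I. (\<Sum>k\<in>K i. \<tau> k \<omega>) \<le> v}"
    using False by auto
  moreover have "(\<lambda>\<omega>. \<Sum>k\<in>K i. \<tau> k \<omega>) -` {..v} \<inter> space M = {\<omega> \<in> space M. (\<Sum>k\<in>K i. \<tau> k \<omega>) \<le> v}" for i
    by auto
  ultimately show ?thesis by simp
qed

text \<open>If \<open>i + k\<close> positive times add up to at most \<open>v\<close>, then so do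
  the first \<open>i\<close> and the last \<open>k\<close>, and these two sums are independent. The
  Boolean index distinguishes the two groups.\<close>

lemma poisson_weight_submult:
  assumes "0 \<le> v"
  shows "1 - (\<Sum>j<i + k. poisson_weight v j) \<le> (1 - (\<Sum>j<i. poisson_weight v j)) * (1 - (\<Sum>j<k. poisson_weight v j))"
proof -
  let ?K = "\<lambda>b. if b then {..<i} else {i..<i + k}"
  have "prob {\<omega> \<in> space M. (\<Sum>k\<in>{..<i + k}. \<tau> k \<omega>) \<le> v} \<le> prob {\<omega> \<in> space M. \<forall>b\<in>UNIV. (\<Sum>k\<in>?K b. \<tau> k \<omega>) \<le> v}"
  proof (rule finite_measure_mono_AE)
    show "AE \<omega> in M. \<omega> \<in> {\<omega> \<in> space M. (\<Sum>k\<in>{..<i + k}. \<tau> k \<omega>) \<le> v} \<longrightarrow> \<omega> \<in> {\<omega> \<in> space M. \<forall>b\<in>UNIV. (\<Sum>k\<in>?K b. \<tau> k \<omega>) \<le> v}"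
      using AE_holding_pos
    proof eventually_elim
      case (elim \<omega>)
      have le: "(\<Sum>k\<in>?K b. \<tau> k \<omega>) \<le> (\<Sum>k\<in>{..<i + k}. \<tau> k \<omega>)" for b
        using elim by (intro sum_mono2) (auto simp: less_imp_le)
      show ?case
        unfolding mem_Collect_eq using order_trans[OF le] by blast
    qed
    show "{\<omega> \<in> space M. \<forall>b\<in>UNIV. (\<Sum>k\<in>?K b. \<tau> k \<omega>) \<le> v} \<in> events" by measurable
  qed
  also have "\<dots> = (\<Prod>b\<in>UNIV. prob {\<omega> \<in> space M. (\<Sum>k\<in>?K b. \<tau> k \<omega>) \<le> v})"
    by (rule prob_disjoint_sums) (auto simp: disjoint_family_on_def)
  also have "\<dots> = (\<Prod>b\<in>UNIV. 1 - (\<Sum>j<card (?K b). poisson_weight v j))"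
    using assms by (intro prod.cong prob_sum_holding) auto
  finally show ?thesis
    using prob_sum_holding[of "{..<i + k}" v] assms by (simp add: UNIV_bool mult.commute)
qed

lemma indep_steps_holding:
  assumes w: "length w = n"
    and B: "B \<in> sets (vimage_algebra (space M) (\<lambda>\<omega> n. \<tau> n \<omega>) (Pi\<^sub>M UNIV (\<lambda>_. borel)))"
  shows "prob ({\<omega> \<in> space M. steps n \<omega> = w} \<inter> B) = prob {\<omega> \<in> space M. steps n \<omega> = w} * prob B"
proof (rule indep_setD[OF indep_walk_holding _ B])
  let ?P = "Pi\<^sub>M UNIV (\<lambda>_::nat. count_space (UNIV :: (int ^ 'd) set))"
  \<comment> \<open>Independence is assumed for the positions, so the event on the steps is
    rewritten as one on \<open>S 0, ..., S n\<close>.\<close>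
  let ?A = "{s \<in> space ?P. \<forall>k\<in>{..n}. s k = sum_list (take k w)}"
  have "?A \<in> sets ?P" by measurable
  then have "(\<lambda>\<omega> n. S n \<omega>) -` ?A \<inter> space M \<in> sets (vimage_algebra (space M) (\<lambda>\<omega> n. S n \<omega>) ?P)"
    by (rule in_vimage_algebra)
  moreover have "(\<lambda>\<omega> n. S n \<omega>) -` ?A \<inter> space M = {\<omega> \<in> space M. steps n \<omega> = w}"
  proof -
    have "(\<forall>k\<in>{..n}. S k \<omega> = sum_list (take k w)) \<longleftrightarrow> steps n \<omega> = w" if \<omega>: "\<omega> \<in> space M" for \<omega>
    proof
      assume "steps n \<omega> = w"
      then show "\<forall>k\<in>{..n}. S k \<omega> = sum_list (take k w)"
        using sum_take_steps[OF \<omega>, of _ n] by auto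
    next
      assume *: "\<forall>k\<in>{..n}. S k \<omega> = sum_list (take k w)"
      have "S (Suc i) \<omega> - S i \<omega> = w ! i" if "i < n" for i
        using * that w by (simp add: take_Suc_conv_app_nth)
      then show "steps n \<omega> = w" using w by (simp add: steps_eq_iff)
    qed
    then show ?thesis by (auto simp: space_PiM)
  qed
  ultimately show "{\<omega> \<in> space M. steps n \<omega> = w} \<in> sets (vimage_algebra (space M) (\<lambda>\<omega> n. S n \<omega>) ?P)"
    by simp
qed

text \<open>For a fixed word the times spent at different sites use disjoint sets of holding times,
  hence they are independent Gamma variables whose shapes are the visit counts.\<close>

lemma prob_weighted_time:
  assumes v: "0 \<le> v"
  shows "prob {\<omega> \<in> space M. \<forall>x. weighted_time S \<tau> m x \<omega> \<le> v}
    = avg (unit_steps :: (int ^ 'd) set) m (\<lambda>w. occ_prod (\<lambda>i. 1 - (\<Sum>j<i. poisson_weight v j)) (path 0 w))"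
proof -
  define K where "K w x = {k. k < m \<and> path 0 w ! k = x}" for w :: "(int ^ 'd) list" and x
  define B where "B w = {\<omega> \<in> space M. \<forall>x\<in>set (path 0 w). (\<Sum>k\<in>K w x. \<tau> k \<omega>) \<le> v}" for w
  have finK: "finite (K w x)" for w x by (simp add: K_def)
  have wt: "weighted_time S \<tau> m x \<omega> = (\<Sum>k\<in>K (steps m \<omega>) x. \<tau> k \<omega>)" if "\<omega> \<in> space M" for x \<omega>
  proof -
    have "K (steps m \<omega>) x = {k\<in>{..<m}. S k \<omega> = x}"
      using that by (auto simp: K_def path_steps)
    then have "(\<Sum>k\<in>K (steps m \<omega>) x. \<tau> k \<omega>) = (\<Sum>k<m. if S k \<omega> = x then \<tau> k \<omega> else 0)"
      by (simp only: sum.inter_filter[OF finite_lessThan])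
    also have "\<dots> = weighted_time S \<tau> m x \<omega>"
      unfolding weighted_time_def by (intro sum.cong) (auto simp: indicator_def)
    finally show ?thesis by simp
  qed
  have "prob {\<omega> \<in> space M. \<forall>x. weighted_time S \<tau> m x \<omega> \<le> v} = avg unit_steps m (\<lambda>w. prob (B w))"
  proof (rule prob_by_steps)
    show "{\<omega> \<in> space M. \<forall>x. weighted_time S \<tau> m x \<omega> \<le> v} \<in> events" by measurable
  next
    fix w :: "(int ^ 'd) list"
    show "B w \<in> events" unfolding B_def by measurable
  next
    fix w \<omega> assume w: "w \<in> words (unit_steps :: (int ^ 'd) set) m" and \<omega>: "\<omega> \<in> space M" "steps m \<omega> = w"
    have "(\<Sum>k\<in>K w x. \<tau> k \<omega>) \<le> v" if "x \<notin> set (path 0 w)" for x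
    proof -
      have "K w x = {}" using that length_words[OF w] by (auto simp: K_def in_set_conv_nth)
      then show ?thesis using v by simp
    qed
    then show "\<omega> \<in> {\<omega> \<in> space M. \<forall>x. weighted_time S \<tau> m x \<omega> \<le> v} \<longleftrightarrow> \<omega> \<in> B w"
      using \<omega> by (auto simp: B_def wt)
  next
    fix w assume w: "w \<in> words (unit_steps :: (int ^ 'd) set) m"
    let ?P = "Pi\<^sub>M UNIV (\<lambda>_::nat. borel :: real measure)"
    let ?A = "{s \<in> space ?P. \<forall>x\<in>set (path 0 w). (\<Sum>k\<in>K w x. s k) \<le> v}"
    have "?A \<in> sets ?P" by measurable
    then have "(\<lambda>\<omega> n. \<tau> n \<omega>) -` ?A \<inter> space M \<in> sets (vimage_algebra (space M) (\<lambda>\<omega> n. \<tau> n \<omega>) ?P)"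
      by (rule in_vimage_algebra)
    moreover have "(\<lambda>\<omega> n. \<tau> n \<omega>) -` ?A \<inter> space M = B w"
      by (auto simp: B_def space_PiM)
    ultimately show "prob ({\<omega> \<in> space M. steps m \<omega> = w} \<inter> B w) = prob {\<omega> \<in> space M. steps m \<omega> = w} * prob (B w)"
      using w by (intro indep_steps_holding) (auto simp: length_words)
  qed
  also have "\<dots> = avg (unit_steps :: (int ^ 'd) set) m (\<lambda>w. occ_prod (\<lambda>i. 1 - (\<Sum>j<i. poisson_weight v j)) (path 0 w))"
  proof (rule avg_cong)
    fix w assume w: "w \<in> words (unit_steps :: (int ^ 'd) set) m"
    have "prob (B w) = (\<Prod>x\<in>set (path 0 w). prob {\<omega> \<in> space M. (\<Sum>k\<in>K w x. \<tau> k \<omega>) \<le> v})"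
      unfolding B_def by (rule prob_disjoint_sums) (auto simp: disjoint_family_on_def K_def)
    also have "\<dots> = (\<Prod>x\<in>set (path 0 w). 1 - (\<Sum>j<card (K w x). poisson_weight v j))"
      by (intro prod.cong prob_sum_holding finK v refl)
    also have "\<dots> = occ_prod (\<lambda>i. 1 - (\<Sum>j<i. poisson_weight v j)) (path 0 w)"
      unfolding occ_prod_def
      by (intro prod.cong) (auto simp: K_def count_list_eq_length_filter length_filter_conv_card length_words[OF w] eq_commute)
    finally show "prob (B w) = occ_prod (\<lambda>i. 1 - (\<Sum>j<i. poisson_weight v j)) (path 0 w)" .
  qed
  finally show ?thesis .
qed

text \<open>Joint measurability in the sample point and the time makes each local time measurable,
  and the lattice is countable.\<close>

lemma measurable_max_continuous_local_time:
  assumes "0 \<le> t"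
  shows "max_continuous_local_time (continuous_walk S \<tau>) t \<in> borel_measurable M"
proof -
  let ?Y = "continuous_walk S \<tau>"
  have [measurable]: "(\<lambda>z. jump_count \<tau> (snd z) (fst z)) \<in> measurable (M \<Otimes>\<^sub>M lborel) (count_space UNIV)"
    unfolding jump_count_arrival by measurable
  have Y: "(\<lambda>z. ?Y (snd z) (fst z)) \<in> measurable (M \<Otimes>\<^sub>M lborel) (count_space UNIV)"
    unfolding continuous_walk_def
    by (rule measurable_compose_countable[where f = "\<lambda>n z. S n (fst z)"]) measurable
  have L: "continuous_local_time ?Y t x \<in> borel_measurable M" for x
  proof -
    have "(\<lambda>z. indicator {x} (?Y (snd z) (fst z)) :: real) \<in> borel_measurable (M \<Otimes>\<^sub>M lborel)"
      by (rule measurable_compose[OF Y]) simp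
    then have "(\<lambda>z. indicator {0..t} (snd z) *\<^sub>R (indicator {x} (?Y (snd z) (fst z)) :: real)) \<in> borel_measurable (M \<Otimes>\<^sub>M lborel)"
      by measurable
    then have "(\<lambda>(\<omega>, s). indicator {0..t} s *\<^sub>R (indicator {x} (?Y s \<omega>) :: real)) \<in> borel_measurable (M \<Otimes>\<^sub>M lborel)"
      by (simp add: case_prod_unfold)
    from lborel.borel_measurable_lebesgue_integral[OF this] show ?thesis
      by (simp add: continuous_local_time_def[abs_def] set_lebesgue_integral_def)
  qed
  have "(\<lambda>\<omega>. SUP x\<in>UNIV. continuous_local_time ?Y t x \<omega>) \<in> borel_measurable M"
    by (rule borel_measurable_cSUP) (auto intro!: L bdd_aboveI2 continuous_local_time_le assms)
  then show ?thesis by (simp add: max_continuous_local_time_def[abs_def])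
qed

lemma prob_arrival_deviation:
  assumes "0 < a"
  shows "prob {\<omega> \<in> space M. a \<le> \<bar>arrival \<tau> m \<omega> - real m\<bar>} \<le> real m / a\<^sup>2"
proof (cases "m = 0")
  case True
  then have "{\<omega> \<in> space M. a \<le> \<bar>arrival \<tau> m \<omega> - real m\<bar>} = {}" using assms by (auto simp: arrival_def)
  then show ?thesis using True by (simp del: Collect_empty_eq)
next
  case False
  then obtain k where k: "m = Suc k" by (cases m) auto
  have D: "distributed M lborel (arrival \<tau> m) (erlang_density k 1)"
    unfolding arrival_def[abs_def]
    using exponential_distributed_sum[of "{..<m}" 1 \<tau>] distr_holding indep_vars_subset[OF indep_holding, of "{..<m}"] k
    by auto
  have E: "expectation (arrival \<tau> m) = real m"
    using erlang_ith_moment[OF _ D, of 1] k by simp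
  have "prob {\<omega> \<in> space M. a \<le> \<bar>arrival \<tau> m \<omega> - expectation (arrival \<tau> m)\<bar>} \<le> variance (arrival \<tau> m) / a\<^sup>2"
    using erlang_ith_moment_integrable[OF _ D, of 2] assms by (intro Chebyshev_inequality) auto
  then show ?thesis using erlang_distributed_variance[OF _ D] k unfolding E by simp
qed

lemma arrival_concentration:
  fixes s \<delta> :: real
  assumes t: "filterlim t at_top sequentially" and "0 < \<delta>" "0 < s"
  shows "(\<lambda>n. prob {\<omega> \<in> space M. \<delta> * t n \<le> \<bar>arrival \<tau> (nat \<lfloor>s * t n\<rfloor>) \<omega> - real (nat \<lfloor>s * t n\<rfloor>)\<bar>}) \<longlonglongrightarrow> 0"
proof (rule tendsto_sandwich[of "\<lambda>_. 0" _ _ "\<lambda>n. s / \<delta>\<^sup>2 / t n"])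
  show "\<forall>\<^sub>F n in sequentially. prob {\<omega> \<in> space M. \<delta> * t n \<le> \<bar>arrival \<tau> (nat \<lfloor>s * t n\<rfloor>) \<omega> - real (nat \<lfloor>s * t n\<rfloor>)\<bar>} \<le> s / \<delta>\<^sup>2 / t n"
    using t[unfolded filterlim_at_top, rule_format, of 1]
  proof eventually_elim
    case (elim n)
    have "prob {\<omega> \<in> space M. \<delta> * t n \<le> \<bar>arrival \<tau> (nat \<lfloor>s * t n\<rfloor>) \<omega> - real (nat \<lfloor>s * t n\<rfloor>)\<bar>} \<le> real (nat \<lfloor>s * t n\<rfloor>) / (\<delta> * t n)\<^sup>2"
      using elim assms by (intro prob_arrival_deviation) auto
    also have "\<dots> \<le> s * t n / (\<delta> * t n)\<^sup>2"
    proof (rule divide_right_mono)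
      have "0 \<le> s * t n" using elim assms by auto
      then show "real (nat \<lfloor>s * t n\<rfloor>) \<le> s * t n" by linarith
    qed simp
    also have "\<dots> = s / \<delta>\<^sup>2 / t n" using elim by (simp add: power2_eq_square field_simps)
    finally show ?case .
  qed
  show "(\<lambda>n. s / \<delta>\<^sup>2 / t n) \<longlonglongrightarrow> 0"
    by (intro tendsto_divide_0[OF tendsto_const] filterlim_at_top_imp_at_infinity t)
qed auto

theorem max_continuous_local_time_limit:
  fixes u :: real
  assumes dim: "3 \<le> CARD('d)"
  defines "\<gamma> \<equiv> escape_prob M S"
  shows "((\<lambda>t. prob {\<omega> \<in> space M. max_continuous_local_time (continuous_walk S \<tau>) t \<omega> \<le> ln t / \<gamma> + u})
     \<longlongrightarrow> exp (- \<gamma> * exp (- \<gamma> * u))) at_top"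
proof (rule tendsto_at_topI_sequentially)
  fix t :: "nat \<Rightarrow> real" assume t: "filterlim t at_top sequentially"
  interpret lattice "TYPE('d)" by standard (rule dim)
  have \<gamma>: "\<gamma> = 1 - r" unfolding \<gamma>_def by (rule escape_prob_eq[OF dim])
  have \<gamma>0: "0 < \<gamma>" using r_less_1 by (simp add: \<gamma>)
  let ?Y = "continuous_walk S \<tau>"
  define v where "v n = ln (t n) / \<gamma> + u" for n
  define P where "P n = prob {\<omega> \<in> space M. max_continuous_local_time ?Y (t n) \<omega> \<le> v n}" for n
  define h where "h s n = nat \<lfloor>s * t n\<rfloor>" for s n
  define Q where "Q s n = prob {\<omega> \<in> space M. \<forall>x. weighted_time S \<tau> (h s n) x \<omega> \<le> v n}" for s n
  define R where "R \<delta> s n = prob {\<omega> \<in> space M. \<delta> * t n \<le> \<bar>arrival \<tau> (h s n) \<omega> - real (h s n)\<bar>}" for \<delta> s n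
  have v_top: "filterlim v at_top sequentially"
    unfolding v_def[abs_def] using t \<gamma>0 by (rule filterlim_log_level)
  have ev: "\<forall>\<^sub>F n in sequentially. 0 \<le> v n" "\<forall>\<^sub>F n in sequentially. c \<le> t n" for c
    using v_top t unfolding filterlim_at_top by blast+
  have Q_lim: "Q s \<longlonglongrightarrow> exp (- \<gamma> * (s * exp (- \<gamma> * u)))" if "0 < s" for s
  proof -
    have "(\<lambda>n. survival (\<lambda>k. 1 - (\<Sum>j<k. poisson_weight (v n) j)) (h s n)) \<longlonglongrightarrow> exp (- \<gamma> * (s * exp (- \<gamma> * u)))"
      unfolding v_def h_def \<gamma> by (rule continuous_survival_tendsto[OF poisson_weight_submult t that])
    moreover have "\<forall>\<^sub>F n in sequentially. survival (\<lambda>k. 1 - (\<Sum>j<k. poisson_weight (v n) j)) (h s n) = Q s n"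
      using ev(1) by eventually_elim (simp add: Q_def survival_def prob_weighted_time)
    ultimately show ?thesis by (rule Lim_transform_eventually)
  qed
  have R_lim: "R \<delta> s \<longlonglongrightarrow> 0" if "0 < \<delta>" "0 < s" for \<delta> s
    unfolding R_def h_def by (rule arrival_concentration[OF t that])
  \<comment> \<open>For \<open>s < 1\<close> the first \<open>s * t\<close> holding times have
    elapsed by time \<open>t\<close>, unless their sum deviates by
    \<open>(1 - s) * t\<close>.\<close>
  have P_le: "\<forall>\<^sub>F n in sequentially. P n \<le> Q s n + R (1 - s) s n" if s: "0 < s" "s < 1" for s
    using ev(2)[of 1]
  proof eventually_elim
    case (elim n)
    let ?A = "{\<omega> \<in> space M. \<forall>x. weighted_time S \<tau> (h s n) x \<omega> \<le> v n}"
    let ?B = "{\<omega> \<in> space M. (1 - s) * t n \<le> \<bar>arrival \<tau> (h s n) \<omega> - real (h s n)\<bar>}"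
    have "0 \<le> s * t n" using elim s by auto
    then have hs: "real (h s n) \<le> s * t n" unfolding h_def by linarith
    have "P n \<le> prob (?A \<union> ?B)"
      unfolding P_def
    proof (rule finite_measure_mono_AE)
      show "AE \<omega> in M. \<omega> \<in> {\<omega> \<in> space M. max_continuous_local_time ?Y (t n) \<omega> \<le> v n} \<longrightarrow> \<omega> \<in> ?A \<union> ?B"
        using AE_holding_pos
      proof eventually_elim
        case pos: (elim \<omega>)
        show ?case
        proof (cases "arrival \<tau> (h s n) \<omega> \<le> t n")
          case True
          have "weighted_time S \<tau> (h s n) x \<omega> \<le> continuous_local_time ?Y (t n) x \<omega>" for x
            using pos True by (intro weighted_time_le_continuous_local_time) auto
          then show ?thesis using elim by (auto simp: max_continuous_local_time_le_iff intro: order_trans)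
        next
          case False
          then have "(1 - s) * t n \<le> \<bar>arrival \<tau> (h s n) \<omega> - real (h s n)\<bar>"
            using hs by (simp add: algebra_simps)
          then show ?thesis by auto
        qed
      qed
      show "?A \<union> ?B \<in> events" by measurable
    qed
    also have "\<dots> \<le> prob ?A + prob ?B" by (rule measure_Un_le) measurable
    finally show ?case by (simp add: Q_def R_def)
  qed
  \<comment> \<open>For \<open>s > 1\<close> half of the surplus \<open>(s - 1) * t\<close> absorbs
    the rounding of the number of steps, hence the deviation \<open>(s - 1) / 2 * t\<close>.\<close>
  have P_ge: "\<forall>\<^sub>F n in sequentially. Q s n - R ((s - 1) / 2) s n \<le> P n" if s: "1 < s" for s
    using ev(2)[of "max 1 (2 / (s - 1))"]
  proof eventually_elim
    case (elim n)
    let ?A = "{\<omega> \<in> space M. max_continuous_local_time ?Y (t n) \<omega> \<le> v n}"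
    let ?B = "{\<omega> \<in> space M. (s - 1) / 2 * t n \<le> \<bar>arrival \<tau> (h s n) \<omega> - real (h s n)\<bar>}"
    have t0: "0 \<le> t n" using elim by simp
    have [measurable]: "max_continuous_local_time ?Y (t n) \<in> borel_measurable M"
      by (rule measurable_max_continuous_local_time[OF t0])
    have A: "?A \<in> events" by measurable
    have "2 / (s - 1) \<le> t n" using elim by simp
    then have "1 \<le> (s - 1) / 2 * t n" using s by (simp add: field_simps)
    moreover have "s * t n - 1 \<le> real (h s n)" unfolding h_def by linarith
    moreover have "s * t n = t n + ((s - 1) / 2 * t n + (s - 1) / 2 * t n)" by (simp add: field_simps)
    ultimately have hs: "t n + (s - 1) / 2 * t n \<le> real (h s n)" by linarith
    have "Q s n \<le> prob (?A \<union> ?B)"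
      unfolding Q_def
    proof (rule finite_measure_mono_AE)
      show "AE \<omega> in M. \<omega> \<in> {\<omega> \<in> space M. \<forall>x. weighted_time S \<tau> (h s n) x \<omega> \<le> v n} \<longrightarrow> \<omega> \<in> ?A \<union> ?B"
        using AE_holding_pos
      proof eventually_elim
        case pos: (elim \<omega>)
        show ?case
        proof (cases "t n < arrival \<tau> (h s n) \<omega>")
          case True
          have "continuous_local_time ?Y (t n) x \<omega> \<le> weighted_time S \<tau> (h s n) x \<omega>" for x
            using pos True by (intro continuous_local_time_le_weighted_time) auto
          then show ?thesis using elim by (auto simp: max_continuous_local_time_le_iff intro: order_trans)
        next
          case False
          then have "(s - 1) / 2 * t n \<le> \<bar>arrival \<tau> (h s n) \<omega> - real (h s n)\<bar>"
            using hs by linarith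
          then show ?thesis by auto
        qed
      qed
      show "?A \<union> ?B \<in> events" using A by measurable
    qed
    also have "\<dots> \<le> prob ?A + prob ?B" using A by (intro measure_Un_le) measurable
    finally show ?case by (simp add: P_def R_def)
  qed
  define \<Psi> where "\<Psi> s = exp (- \<gamma> * (s * exp (- \<gamma> * u)))" for s
  have \<Psi>: "(\<Psi> \<longlongrightarrow> \<Psi> 1) (at_left 1)" "(\<Psi> \<longlongrightarrow> \<Psi> 1) (at_right 1)"
    unfolding \<Psi>_def by (intro tendsto_intros)+
  have "P \<longlonglongrightarrow> \<Psi> 1"
  \<comment> \<open>The bounds hold for every fixed \<open>s\<close> on either side of 1; continuity
    of \<open>\<Psi>\<close> at 1 closes the gap.\<close>
  proof (rule order_tendstoI)
    fix y assume "y < \<Psi> 1"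
    then have "\<forall>\<^sub>F s in at_right 1. y < \<Psi> s" by (rule order_tendstoD(1)[OF \<Psi>(2)])
    then have "\<forall>\<^sub>F s in at_right 1. y < \<Psi> s \<and> 1 < s"
      using eventually_at_right_less by (rule eventually_conj)
    then obtain s where s: "y < \<Psi> s" "1 < s"
      using eventually_happens trivial_limit_at_right_real by blast
    have "(\<lambda>n. Q s n - R ((s - 1) / 2) s n) \<longlonglongrightarrow> \<Psi> s - 0"
      unfolding \<Psi>_def using s by (intro tendsto_diff Q_lim R_lim) auto
    from order_tendstoD(1)[OF this, of y] s P_ge[OF s(2)]
    show "\<forall>\<^sub>F n in sequentially. y < P n" by (auto elim: eventually_elim2)
  next
    fix y assume "\<Psi> 1 < y"
    then have "\<forall>\<^sub>F s in at_left 1. \<Psi> s < y" by (rule order_tendstoD(2)[OF \<Psi>(1)])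
    moreover have "\<forall>\<^sub>F s in at_left (1::real). s \<in> {0<..<1}"
      by (rule eventually_at_left_real) simp
    ultimately have "\<forall>\<^sub>F s in at_left 1. \<Psi> s < y \<and> s \<in> {0<..<1}" by (rule eventually_conj)
    then obtain s where "\<Psi> s < y \<and> s \<in> {0<..<1}"
      using eventually_happens trivial_limit_at_left_real by blast
    then have s: "\<Psi> s < y" "0 < s" "s < 1" by auto
    have "(\<lambda>n. Q s n + R (1 - s) s n) \<longlonglongrightarrow> \<Psi> s + 0"
      unfolding \<Psi>_def using s by (intro tendsto_add Q_lim R_lim) auto
    from order_tendstoD(2)[OF this, of y] s P_le[OF s(2,3)]
    show "\<forall>\<^sub>F n in sequentially. P n < y" by (auto elim: eventually_elim2)
  qed
  then show "(\<lambda>n. prob {\<omega> \<in> space M. max_continuous_local_time ?Y (t n) \<omega> \<le> ln (t n) / \<gamma> + u}) \<longlonglongrightarrow> exp (- \<gamma> * exp (- \<gamma> * u))"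
    by (simp add: P_def[abs_def] v_def \<Psi>_def)
qed

end

section \<open>The Gumbel law and the conclusion\<close>

lemma cdf_gumbel:
  assumes "0 < b"
  shows "cdf (gumbel m b) x = exp (- exp (- (x - m) / b))"
proof -
  let ?F = "\<lambda>x. exp (- exp (- (x - m) / b))"
  have "cdf (interval_measure ?F) = ?F"
  proof (rule cdf_interval_measure)
    show "?F x \<le> ?F y" if "x \<le> y" for x y
      using that assms by (simp add: divide_right_mono)
    show "continuous (at_right a) ?F" for a
      using assms by (intro continuous_intros) auto
    show "(?F \<longlongrightarrow> 0) at_bot"
      using assms by real_asymp
  qed
  then show ?thesis by (simp add: gumbel_def)
qed

theorem mainTheorem3:
  fixes M :: "'a measure"
    and S :: "nat \<Rightarrow> 'a \<Rightarrow> int ^ 'd::finite"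
    and \<tau> :: "nat \<Rightarrow> 'a \<Rightarrow> real"
    and \<gamma> \<alpha> :: real
  assumes dim: "CARD('d) \<ge> 3"
    and walk: "walk_with_holding_times M S \<tau>"
    and gamma: "\<gamma> = escape_prob M S"
    and alpha: "\<alpha> = log_rate \<gamma>"
  shows
    "weak_conv_along
       (\<lambda>t. distr M borel
         (\<lambda>\<omega>. max_continuous_local_time (continuous_walk S \<tau>) t \<omega> - ln t / \<gamma>))
       (gumbel (ln \<gamma> / \<gamma>) (1 / \<gamma>)) at_top
     \<and> (\<forall>u. cdf (gumbel (ln \<gamma> / \<gamma>) (1 / \<gamma>)) u = exp (- \<gamma> * exp (- \<gamma> * u)))
     \<and> (\<forall>u::real. \<exists>\<epsilon>::nat \<Rightarrow> real. \<epsilon> \<in> o(\<lambda>_. 1) \<and>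
         (\<forall>\<^sub>F n in sequentially.
           measure M {\<omega> \<in> space M. real (max_discrete_local_time S n \<omega>) \<le> \<alpha> * ln (real n) + u}
             \<le> exp (- (1 + \<epsilon> n) * osc_factor \<gamma> n u * \<gamma> * (1 - \<gamma>) powr u)))
     \<and> (\<forall>u::real. \<exists>\<epsilon>::nat \<Rightarrow> real. \<epsilon> \<in> o(\<lambda>_. 1) \<and>
         (\<forall>\<^sub>F n in sequentially.
           measure M {\<omega> \<in> space M. real (max_discrete_local_time S n \<omega>) \<le> \<alpha> * ln (real n) + u}
             = exp (- (1 + \<epsilon> n) * osc_factor \<gamma> n u * \<gamma> * (1 - \<gamma>) powr u)))"
proof -
  interpret walk_with_holding_times M S \<tau> by (rule walk)
  interpret lattice "TYPE('d)" by standard (rule dim)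
  have \<gamma>: "0 < \<gamma>" unfolding gamma escape_prob_eq[OF dim] using r_less_1 by simp
  have cdf: "cdf (gumbel (ln \<gamma> / \<gamma>) (1 / \<gamma>)) u = exp (- \<gamma> * exp (- \<gamma> * u))" for u
  proof -
    \<comment> \<open>The mode \<open>ln \<gamma> / \<gamma>\<close> is what produces the factor
      \<open>\<gamma>\<close> in front of \<open>exp (- \<gamma> * u)\<close>.\<close>
    have "- (u - ln \<gamma> / \<gamma>) / (1 / \<gamma>) = ln \<gamma> + - \<gamma> * u" using \<gamma> by (simp add: field_simps)
    then show ?thesis using \<gamma> by (simp add: cdf_gumbel exp_diff exp_minus divide_inverse)
  qed
  have "((\<lambda>t. cdf (distr M borel (\<lambda>\<omega>. max_continuous_local_time (continuous_walk S \<tau>) t \<omega> - ln t / \<gamma>)) u)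
      \<longlongrightarrow> exp (- \<gamma> * exp (- \<gamma> * u))) at_top" for u
  proof (rule Lim_transform_eventually)
    show "((\<lambda>t. prob {\<omega> \<in> space M. max_continuous_local_time (continuous_walk S \<tau>) t \<omega> \<le> ln t / \<gamma> + u})
        \<longlongrightarrow> exp (- \<gamma> * exp (- \<gamma> * u))) at_top"
      unfolding gamma by (rule max_continuous_local_time_limit[OF dim])
    show "\<forall>\<^sub>F t in at_top. prob {\<omega> \<in> space M. max_continuous_local_time (continuous_walk S \<tau>) t \<omega> \<le> ln t / \<gamma> + u}
        = cdf (distr M borel (\<lambda>\<omega>. max_continuous_local_time (continuous_walk S \<tau>) t \<omega> - ln t / \<gamma>)) u"
      using eventually_ge_at_top[of 0]
    proof eventually_elim
      case (elim t)
      have [measurable]: "max_continuous_local_time (continuous_walk S \<tau>) t \<in> borel_measurable M"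
        by (rule measurable_max_continuous_local_time[OF elim])
      have "cdf (distr M borel (\<lambda>\<omega>. max_continuous_local_time (continuous_walk S \<tau>) t \<omega> - ln t / \<gamma>)) u
          = prob ((\<lambda>\<omega>. max_continuous_local_time (continuous_walk S \<tau>) t \<omega> - ln t / \<gamma>) -` {..u} \<inter> space M)"
        unfolding cdf_def by (rule measure_distr) auto
      also have "\<dots> = prob {\<omega> \<in> space M. max_continuous_local_time (continuous_walk S \<tau>) t \<omega> \<le> ln t / \<gamma> + u}"
        by (rule arg_cong[where f = prob]) (auto simp: algebra_simps)
      finally show ?case by simp
    qed
  qed
  then have "weak_conv_along
       (\<lambda>t. distr M borel
         (\<lambda>\<omega>. max_continuous_local_time (continuous_walk S \<tau>) t \<omega> - ln t / \<gamma>))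
       (gumbel (ln \<gamma> / \<gamma>) (1 / \<gamma>)) at_top"
    by (simp add: weak_conv_along_def cdf)
  moreover have eq: "\<forall>u::real. \<exists>\<epsilon>::nat \<Rightarrow> real. \<epsilon> \<in> o(\<lambda>_. 1) \<and>
         (\<forall>\<^sub>F n in sequentially.
           prob {\<omega> \<in> space M. real (max_discrete_local_time S n \<omega>) \<le> \<alpha> * ln (real n) + u}
             = exp (- (1 + \<epsilon> n) * osc_factor \<gamma> n u * \<gamma> * (1 - \<gamma>) powr u))"
    unfolding gamma alpha using max_discrete_local_time_asymptotics[OF dim] by blast
  moreover from eq have "\<forall>u::real. \<exists>\<epsilon>::nat \<Rightarrow> real. \<epsilon> \<in> o(\<lambda>_. 1) \<and>
         (\<forall>\<^sub>F n in sequentially.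
           prob {\<omega> \<in> space M. real (max_discrete_local_time S n \<omega>) \<le> \<alpha> * ln (real n) + u}
             \<le> exp (- (1 + \<epsilon> n) * osc_factor \<gamma> n u * \<gamma> * (1 - \<gamma>) powr u))"
    by (fast elim: eventually_mono intro: eq_refl)
  ultimately show ?thesis using cdf by blast
qed

end
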